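(* For each $(N,p)$ with $N=n_1+n_2$ and $n_1/N\to c\in(0,1)$, let $\bm X_1,\ldots,\bm X_{n_1}$ be i.i.d. $N_p(\bm\mu_1,\Sigma)$ and $\bm Y_1,\ldots,\bm Y_{n_2}$ i.i.d. $N_p(\bm\mu_2,\Sigma)$, independent, and suppose $p=o(N^2)$. Let $\bar X_j,\bar Y_j$ be the componentwise sample means, $s_{j,\mathrm{pool}}^2=\frac1{N-2}\{\sum_i(X_{ij}-\bar X_j)^2+\sum_k(Y_{kj}-\bar Y_j)^2\}$, $t_{Nj}=\sqrt{n_1n_2/N}(\bar X_j-\bar Y_j)/s_{j,\mathrm{pool}}$, $\nu_2=N-2$, $V_{Nj}=N\log(1+t_{Nj}^2/\nu_2)$, $T_2=\sum_{j=1}^pV_{Nj}$, $\Psi=\Gamma'/\Gamma$, $D(x)=\Psi\{(x+1)/2\}-\Psi(x/2)$, $G_1=ND(\nu_2)$, $G_2=N^2\{D^2(\nu_2)-2D'(\nu_2)\}$. Assume $\{V_{Nj}\}_{j\ge1}$ is stationary and satisfies: (C1) with $\alpha(\mathcal F,\mathcal G)=\sup\{|P(A\cap B)-P(A)P(B)|: A\in\mathcal F, B\in\mathcal G\}$, $\mathcal F_a^b=\sigma\{V_{Nj}: a\le j\le b\}$, $\alpha(r)=\sup\{\alpha(\mathcal F_1^k,\mathcal F_{k+r}^p):1\le k\le p-r\}$, one has $\alpha(r)\downarrow0$ as $r\to\infty$; (C2) $\sum_{r=1}^\infty\alpha(r)^{\delta/(2+\delta)}<\infty$ for some $\delta>0$,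 and for every $k\ge0$ the limit $\gamma(k)=\lim_{p\to\infty}\frac1{p-k}\sum_{j=1}^{p-k}\mathrm{Cov}(V_{Nj},V_{N,j+k})$ exists. Let $\tau_2^2=G_2-G_1^2+2\sum_{k=1}^\infty\gamma(k)$. Suppose the local alternative $\bm\mu_1-\bm\mu_2=\sqrt{N/(n_1n_2)}\,\bm\delta_2$ holds, $\bm\delta_2=(\delta_{21},\ldots,\delta_{2p})^T$, and let $\bm\Delta_2=(\delta_{21}/\sigma_{11},\ldots,\delta_{2p}/\sigma_{pp})^T$, where $\sigma_{jj}^2$ are the diagonal entries of $\Sigma$, with $\Delta_{2j}^2\le M_1$ for all $j$ for a constant $M_1$ independent of $N$ and $p$. Then the asymptotic power of the level-$\alpha$ test based on $T_2$ (rejecting $H_0:\bm\mu_1=\bm\mu_2$ when $(T_2-pG_1)/(\tau_2\sqrt p)>z_\alpha$) is $$\beta(T_2)=1-\Phi\Bigl(z_\alpha-\frac{\bm\Delta_2^T\bm\Delta_2/\sqrt p}{\sqrt{\tau_2^2}}\Bigr)\quad\text{as }(N,p)\to\infty,$$ and hence $\beta(T_2)\to1$ if $\sqrt p=o\bigl(\sum_{j=1}^p\delta_{2j}^2/\sigma_{jj}^2\bigr)$, and $\beta(T_2)\to\alpha$ if $\sum_{j=1}^p\delta_{2j}^2/\sigma_{jj}^2=o(\sqrt p)$.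
   Context: $\Phi$ is the standard normal distribution function and $z_\alpha$ satisfies $\Phi(z_\alpha)=1-\alpha$; $\Gamma$ is the gamma function. *)

theory Defs
  imports "HOL-Probability.Probability" "HOL-Library.Landau_Symbols"
begin

definition Phi :: "real \<Rightarrow> real" where
  "Phi x = measure (density lborel std_normal_density) {..x}"

definition z_quant :: "real \<Rightarrow> real" where
  "z_quant a = (THE z. Phi z = 1 - a)"

definition normal_meas :: "real \<Rightarrow> real \<Rightarrow> real measure" where
  "normal_meas mu v = (if v > 0 then density lborel (normal_density mu (sqrt v)) else return borel mu)"

definition gaussian_vec ::
  "'a measure \<Rightarrow> nat \<Rightarrow> ('a \<Rightarrow> nat \<Rightarrow> real) \<Rightarrow> (nat \<Rightarrow> real) \<Rightarrow> (nat \<Rightarrow> nat \<Rightarrow> real) \<Rightarrow> bool" where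
  "gaussian_vec M p Z mu S \<longleftrightarrow>
     (\<forall>j\<in>{1..p}. (\<lambda>\<omega>. Z \<omega> j) \<in> borel_measurable M) \<and>
     (\<forall>a :: nat \<Rightarrow> real. distr M borel (\<lambda>\<omega>. \<Sum>j=1..p. a j * Z \<omega> j) =
        normal_meas (\<Sum>j=1..p. a j * mu j) (\<Sum>i=1..p. \<Sum>j=1..p. a i * S i j * a j))"

definition cov :: "'a measure \<Rightarrow> ('a \<Rightarrow> real) \<Rightarrow> ('a \<Rightarrow> real) \<Rightarrow> real" where
  "cov M U W = (\<integral>\<omega>. (U \<omega> - (\<integral>x. U x \<partial>M)) * (W \<omega> - (\<integral>x. W x \<partial>M)) \<partial>M)"

definition gen_sigma :: "'a measure \<Rightarrow> (nat \<Rightarrow> 'a \<Rightarrow> real) \<Rightarrow> nat \<Rightarrow> nat \<Rightarrow> 'a set set" where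
  "gen_sigma M V a b = sigma_sets (space M) {V j -` B \<inter> space M | j B. j \<in> {a..b} \<and> B \<in> sets borel}"

definition alpha_coef :: "'a measure \<Rightarrow> 'a set set \<Rightarrow> 'a set set \<Rightarrow> real" where
  "alpha_coef M F G = Sup {\<bar>measure M (A \<inter> B) - measure M A * measure M B\<bar> | A B. A \<in> F \<and> B \<in> G}"

definition mix_alpha :: "'a measure \<Rightarrow> (nat \<Rightarrow> 'a \<Rightarrow> real) \<Rightarrow> nat \<Rightarrow> nat \<Rightarrow> real" where
  "mix_alpha M V p r = (if r < p then
      Sup {alpha_coef M (gen_sigma M V 1 k) (gen_sigma M V (k + r) p) | k. 1 \<le> k \<and> k + r \<le> p}
    else 0)"

definition stationary_fin :: "'a measure \<Rightarrow> (nat \<Rightarrow> 'a \<Rightarrow> real) \<Rightarrow> nat \<Rightarrow> bool" where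
  "stationary_fin M V p \<longleftrightarrow>
     (\<forall>h j j'. 1 \<le> j \<longrightarrow> 1 \<le> j' \<longrightarrow> j + h \<le> p \<longrightarrow> j' + h \<le> p \<longrightarrow>
        distr M (PiM {0..h} (\<lambda>_. borel)) (\<lambda>\<omega>. \<lambda>i\<in>{0..h}. V (j + i) \<omega>) =
        distr M (PiM {0..h} (\<lambda>_. borel)) (\<lambda>\<omega>. \<lambda>i\<in>{0..h}. V (j' + i) \<omega>))"

definition Dfun :: "real \<Rightarrow> real" where
  "Dfun x = Digamma ((x + 1) / 2) - Digamma (x / 2)"

end

(*
  Put Z_j = sqrt (n1 n2 / N) (Xbar_j - Ybar_j) / sigma_jj and let W_j be the standardized within-sample
  sum of squares, so that V_j = N ln (1 + Z_j^2 / W_j). By Helmert's rotations Z_j - Delta_j is standard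
  normal and independent of W_j, which is chi-squared; hence all moments of V_j are bounded,
  E V_j = 1 + Delta_j^2 + O(1/N), and V_j - Z_j^2 tends to 0 in L^2. In particular
  Cov (V_j, V_k) = 2 r^2 + 4 r Delta_j Delta_k + o(1) with r the correlation of Z_j and Z_k.

  Stationarity makes all Delta_j^2 asymptotically equal, and existence of gamma 0 = 2 + 4 lim Delta_j^2
  makes them converge. If the limit is positive, T_2 - p G_1 is of order p and Chebyshev's
  inequality shows that both sides tend to 1. If the limit is 0, all gamma k with k > 0 are nonnegative, tau_2^2 is
  asymptotically the long-run variance and is at least 2, and a central limit theorem for
  stationary strongly mixing arrays applies; p = o(N^2) makes the bias sqrt p * O(1/N) negligible.
  The central limit theorem comes from truncating and then comparing the characteristic functions of
  successive partial sums: each step is approximated by multiplication with exp (- u^2 s / 2), where the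
  new summand is decoupled from the past across a gap.
*)
theory Submission
  imports Defs
begin

section \<open>Normal samples\<close>

text \<open>The obstacle: \<open>tau2sq\<close> carries the null variance \<open>G2 - G1^2\<close>,
  which tends to 2, while the central limit theorem yields the variance
  \<open>gamma 0 + 2 * (\<Sum>k. gamma (Suc k))\<close> of the array under the alternative. They
  agree only if the noncentralities vanish in the limit, whence the case distinction. The shift in
  the claimed power may drift or diverge, so distribution functions must converge uniformly.

  Independence of numerator and denominator is kept in Laplace-transform form because integrating
  the transform in its parameter yields the inverse chi-squared moments that bound \<open>V\<close>.
  Joint normality enters only through linear functionals: sum and difference of two coordinates
  determine their mixed fourth moment.

  Summability of the powers of \<open>alpha\<close> and monotonicity force a polynomial rate
  r^-(1+beta). As all moments of \<open>V\<close> are bounded, truncation at a tiny power of p costs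
  less than any required negative power of p, which leaves room for mixing gaps slightly shorter
  than sqrt p.\<close>

abbreviation std_normal :: "real measure" where
  "std_normal \<equiv> density lborel (\<lambda>x. ennreal (std_normal_density x))"

lemma prob_space_std_normal: "prob_space std_normal"
  by (rule prob_space_normal_density) simp

text \<open>The matrix with rows (a, b) and (b, -a) is orthogonal, so the sum of squares in the
  exponent is preserved. It is a reflection and hence its own inverse, so the same formulas serve in
  both directions of the substitution below.\<close>

lemma std_normal_density_rotate:
  assumes "a\<^sup>2 + b\<^sup>2 = (1::real)"
  shows "std_normal_density (a * u + b * v) * std_normal_density (b * u - a * v)
       = std_normal_density u * std_normal_density v"
proof -
  have "(a * u + b * v)\<^sup>2 + (b * u - a * v)\<^sup>2 = (a\<^sup>2 + b\<^sup>2) * (u\<^sup>2 + v\<^sup>2)"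
    by (simp add: power2_eq_square algebra_simps)
  then have "- (a * u + b * v)\<^sup>2 / 2 + - (b * u - a * v)\<^sup>2 / 2 = - u\<^sup>2 / 2 + - v\<^sup>2 / 2"
    using assms by (simp add: field_simps)
  then show ?thesis
    by (simp add: std_normal_density_def mult_exp_exp field_simps)
qed

text \<open>Two one-dimensional affine substitutions with a Fubini exchange in between: first x is
  replaced by u = a x + b y at fixed y, then y = b u - a v at fixed u. The Jacobians 1/|a| and |a|
  cancel; \<open>a \<noteq> 0\<close> makes both substitutions invertible.\<close>

lemma nn_integral_std_normal_rotate:
  assumes ab: "a\<^sup>2 + b\<^sup>2 = 1" and a: "a \<noteq> 0"
    and [measurable]: "(\<lambda>(x, y). f x y) \<in> borel_measurable (borel \<Otimes>\<^sub>M borel)"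
  shows "(\<integral>\<^sup>+y. \<integral>\<^sup>+x. f (a * x + b * y) (b * x - a * y) \<partial>std_normal \<partial>std_normal)
       = (\<integral>\<^sup>+y. \<integral>\<^sup>+x. f x y \<partial>std_normal \<partial>std_normal)" (is "?L = ?R")
proof -
  let ?n = "\<lambda>x. ennreal (std_normal_density x)"
  have ff: "f (g x) (h x) = (\<lambda>(x, y). f x y) (g x, h x)" for g h and x :: "'z"
    by simp
  have m[measurable]: "(\<lambda>x. f (g x) (h x)) \<in> borel_measurable M"
    if [measurable]: "g \<in> borel_measurable M" "h \<in> borel_measurable M" for g h and M :: "'z measure"
    unfolding ff by measurable
  \<comment> \<open>\<open>e1\<close> recovers the old x from the new pair (u, v); \<open>e2\<close>
    is the second new coordinate in the mixed variables (u, y) that live between the two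
    substitutions.\<close>
  have e1: "(u - b * (b * u - a * v)) / a = a * u + b * v" for u v
  proof -
    have "u - b * (b * u - a * v) = (a\<^sup>2 + b\<^sup>2) * u - b * (b * u - a * v)" using ab by simp
    also have "\<dots> = a * (a * u + b * v)" by (simp add: power2_eq_square algebra_simps)
    finally show ?thesis using a by simp
  qed
  have e2: "b * ((u - b * y) / a) - a * y = (b * u - y) / a" for u y
  proof -
    have "a * (b * ((u - b * y) / a) - a * y) = b * u - (a\<^sup>2 + b\<^sup>2) * y"
      using a by (simp add: power2_eq_square field_simps)
    then show ?thesis using a by (simp add: ab eq_divide_eq mult.commute)
  qed
  have "?L = (\<integral>\<^sup>+y. ?n y * (\<integral>\<^sup>+x. ?n x * f (a * x + b * y) (b * x - a * y) \<partial>lborel) \<partial>lborel)"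
    by (simp add: nn_integral_density)
  also have "\<dots> = (\<integral>\<^sup>+y. ?n y * (ennreal \<bar>1/a\<bar> * (\<integral>\<^sup>+u. ?n ((u - b * y) / a) * f u ((b * u - y) / a) \<partial>lborel)) \<partial>lborel)"
  proof (intro nn_integral_cong arg_cong2[where f="(*)"] refl)
    fix y
    show "(\<integral>\<^sup>+x. ?n x * f (a * x + b * y) (b * x - a * y) \<partial>lborel) =
      ennreal \<bar>1/a\<bar> * (\<integral>\<^sup>+u. ?n ((u - b * y) / a) * f u ((b * u - y) / a) \<partial>lborel)"
    proof -
      have "(\<integral>\<^sup>+x. ?n x * f (a * x + b * y) (b * x - a * y) \<partial>lborel) =
        ennreal \<bar>1/a\<bar> * (\<integral>\<^sup>+u. ?n (- b * y / a + 1/a * u) *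
          f (a * (- b * y / a + 1/a * u) + b * y) (b * (- b * y / a + 1/a * u) - a * y) \<partial>lborel)"
        by (rule nn_integral_real_affine) (use a in auto)
      moreover have "- b * y / a + 1/a * u = (u - b * y) / a" for u
        by (simp add: field_simps diff_divide_distrib)
      moreover have "a * ((u - b * y) / a) + b * y = u" for u using a by simp
      ultimately show ?thesis by (simp only: e2)
    qed
  qed
  also have "\<dots> = (\<integral>\<^sup>+y. (\<integral>\<^sup>+u. ennreal \<bar>1/a\<bar> * (?n y * (?n ((u - b * y) / a) * f u ((b * u - y) / a))) \<partial>lborel) \<partial>lborel)"
    by (simp add: nn_integral_cmult mult.left_commute)
  also have "\<dots> = (\<integral>\<^sup>+u. (\<integral>\<^sup>+y. ennreal \<bar>1/a\<bar> * (?n y * (?n ((u - b * y) / a) * f u ((b * u - y) / a))) \<partial>lborel) \<partial>lborel)"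
    by (rule lborel_pair.Fubini') measurable
  also have "\<dots> = (\<integral>\<^sup>+u. (\<integral>\<^sup>+v. ?n u * (?n v * f u v) \<partial>lborel) \<partial>lborel)"
  proof (rule nn_integral_cong)
    fix u
    have "(\<integral>\<^sup>+y. ennreal \<bar>1/a\<bar> * (?n y * (?n ((u - b * y) / a) * f u ((b * u - y) / a))) \<partial>lborel)
      = ennreal \<bar>- a\<bar> * (\<integral>\<^sup>+v. ennreal \<bar>1/a\<bar> * (?n (b * u + - a * v) * (?n ((u - b * (b * u + - a * v)) / a) * f u ((b * u - (b * u + - a * v)) / a))) \<partial>lborel)"
      by (rule nn_integral_real_affine) (use a in auto)
    also have "\<dots> = (\<integral>\<^sup>+v. ennreal \<bar>- a\<bar> * (ennreal \<bar>1/a\<bar> * (?n (b * u + - a * v) * (?n ((u - b * (b * u + - a * v)) / a) * f u ((b * u - (b * u + - a * v)) / a)))) \<partial>lborel)"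
      by (rule nn_integral_cmult[symmetric]) measurable
    also have "\<dots> = (\<integral>\<^sup>+v. ?n u * (?n v * f u v) \<partial>lborel)"
    proof (intro nn_integral_cong)
      fix v
      have "(b * u - (b * u + - a * v)) / a = v" using a by simp
      moreover have "ennreal \<bar>- a\<bar> * ennreal \<bar>1/a\<bar> = 1"
        using a by (simp flip: ennreal_mult)
      moreover have "?n (b * u - a * v) * ?n (a * u + b * v) = ?n u * ?n v"
        using std_normal_density_rotate[OF ab, of u v]
        by (metis ennreal_mult normal_density_nonneg mult.commute)
      ultimately show "ennreal \<bar>- a\<bar> * (ennreal \<bar>1/a\<bar> * (?n (b * u + - a * v) * (?n ((u - b * (b * u + - a * v)) / a) * f u ((b * u - (b * u + - a * v)) / a)))) = ?n u * (?n v * f u v)"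
        using e1[of u v] by (simp add: mult.assoc[symmetric])
    qed
    finally show "(\<integral>\<^sup>+y. ennreal \<bar>1/a\<bar> * (?n y * (?n ((u - b * y) / a) * f u ((b * u - y) / a))) \<partial>lborel) = (\<integral>\<^sup>+v. ?n u * (?n v * f u v) \<partial>lborel)" .
  qed
  also have "\<dots> = (\<integral>\<^sup>+v. (\<integral>\<^sup>+u. ?n u * (?n v * f u v) \<partial>lborel) \<partial>lborel)"
    by (rule lborel_pair.Fubini'[symmetric]) measurable
  also have "\<dots> = (\<integral>\<^sup>+v. ?n v * (\<integral>\<^sup>+u. ?n u * f u v \<partial>lborel) \<partial>lborel)"
    by (simp add: nn_integral_cmult[symmetric] mult.left_commute)
  also have "\<dots> = ?R"
    by (simp add: nn_integral_density)
  finally show ?thesis .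
qed

text \<open>The Laplace transform of the chi-squared law with one degree of freedom. The exponential
  is absorbed into the density, which becomes \<open>s\<close> times a normal density of standard
  deviation \<open>s\<close>.\<close>

lemma nn_integral_std_normal_exp_sq:
  assumes "t \<ge> 0"
  shows "(\<integral>\<^sup>+x. ennreal (exp (- t * x\<^sup>2)) \<partial>std_normal) = ennreal ((1 + 2 * t) powr (-1/2))"
proof -
  define s where "s = 1 / sqrt (1 + 2 * t)"
  have s: "s > 0" using assms by (simp add: s_def)
  have s2: "s\<^sup>2 = 1 / (1 + 2 * t)" using assms by (simp add: s_def power_divide)
  have e: "std_normal_density x * exp (- t * x\<^sup>2) = s * normal_density 0 s x" for x
  proof -
    have "sqrt (2 * pi * s\<^sup>2) = s * sqrt (2 * pi)" using s by (simp add: real_sqrt_mult)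
    moreover have "- x\<^sup>2 / 2 + - t * x\<^sup>2 = - x\<^sup>2 / (2 * s\<^sup>2)"
      using assms by (simp add: s2 field_simps)
    moreover have "exp (- x\<^sup>2 / 2) * exp (- t * x\<^sup>2) = exp (- x\<^sup>2 / 2 + - t * x\<^sup>2)"
      by (rule mult_exp_exp)
    ultimately show ?thesis
      using s by (simp add: normal_density_def)
  qed
  have "(\<integral>\<^sup>+x. ennreal (exp (- t * x\<^sup>2)) \<partial>std_normal)
      = (\<integral>\<^sup>+x. ennreal (std_normal_density x * exp (- t * x\<^sup>2)) \<partial>lborel)"
    by (simp add: nn_integral_density ennreal_mult)
  also have "\<dots> = ennreal s * (\<integral>\<^sup>+x. ennreal (normal_density 0 s x) \<partial>lborel)"
    unfolding e using s by (simp add: ennreal_mult nn_integral_cmult)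
  also have "(\<integral>\<^sup>+x. ennreal (normal_density 0 s x) \<partial>lborel) = 1"
    using s by (simp add: nn_integral_eq_integral)
  also have "s = (1 + 2 * t) powr (-1/2)"
    using assms by (simp add: s_def powr_minus powr_half_sqrt inverse_eq_divide)
  finally show ?thesis by simp
qed

section \<open>Sums of squared deviations and Helmert's rotations\<close>

definition sqdev :: "'i set \<Rightarrow> ('i \<Rightarrow> real) \<Rightarrow> real" where
  "sqdev I x = (\<Sum>i\<in>I. (x i)\<^sup>2) - (\<Sum>i\<in>I. x i)\<^sup>2 / real (card I)"

text \<open>The polynomial form of \<open>sqdev\<close> turns adding an observation into an
  algebraic identity and vanishes on a singleton. This lemma ties it to the deviations from the mean
  that occur in the pooled variance.\<close>

lemma sum_sq_dev_mean:
  assumes "finite I" "I \<noteq> {}"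
  shows "(\<Sum>i\<in>I. (x i - (\<Sum>i\<in>I. x i) / real (card I))\<^sup>2) = sqdev I x"
proof -
  define n where "n = real (card I)"
  define s where "s = (\<Sum>i\<in>I. x i)"
  have n: "n > 0" using assms by (simp add: n_def card_gt_0_iff)
  have "(\<Sum>i\<in>I. (x i - s / n)\<^sup>2) = (\<Sum>i\<in>I. (x i)\<^sup>2 - 2 * (s / n) * x i + (s/n)\<^sup>2)"
    by (intro sum.cong refl) (simp add: power2_eq_square algebra_simps)
  also have "\<dots> = (\<Sum>i\<in>I. (x i)\<^sup>2) - 2 * (s / n) * s + n * (s/n)\<^sup>2"
    unfolding sum.distrib sum_subtractf sum_distrib_left[symmetric] s_def n_def by simp
  also have "\<dots> = (\<Sum>i\<in>I. (x i)\<^sup>2) - s\<^sup>2 / n"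
    using n by (simp add: power2_eq_square field_simps)
  finally show ?thesis unfolding sqdev_def s_def n_def .
qed

lemma sqdev_nonneg: "finite I \<Longrightarrow> I \<noteq> {} \<Longrightarrow> sqdev I x \<ge> 0"
  by (subst sum_sq_dev_mean[symmetric]) (auto intro: sum_nonneg)

text \<open>Helmert's recursion. The added square is a contrast between the new observation and the
  normalized old sum; its coefficients form a unit vector orthogonal to the one that produces the
  new normalized sum.\<close>

lemma sqdev_insert:
  assumes "finite I" "I \<noteq> {}" "i \<notin> I"
  shows "sqdev (insert i I) (x(i := y)) = sqdev I x +
    (sqrt (card I) / sqrt (card I + 1) * y - 1 / sqrt (card I + 1) * ((\<Sum>i\<in>I. x i) / sqrt (card I)))\<^sup>2"
proof -
  define n where "n = real (card I)"
  define s where "s = (\<Sum>i\<in>I. x i)"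
  have n: "n > 0" using assms by (simp add: n_def card_gt_0_iff)
  have s1: "(\<Sum>j\<in>I. (x(i := y)) j) = s" "(\<Sum>j\<in>I. ((x(i := y)) j)\<^sup>2) = (\<Sum>j\<in>I. (x j)\<^sup>2)"
    unfolding s_def using \<open>i \<notin> I\<close> by (auto intro!: sum.cong)
  have c: "real (card (insert i I)) = n + 1" using assms by (simp add: n_def)
  have "(sqrt n / sqrt (n + 1) * y - 1 / sqrt (n + 1) * (s / sqrt n))\<^sup>2 = (sqrt n * y - s / sqrt n)\<^sup>2 / (sqrt (n + 1))\<^sup>2"
    by (simp add: power_divide[symmetric] diff_divide_distrib mult.commute)
  also have "\<dots> = (n * y\<^sup>2 - 2 * s * y + s\<^sup>2 / n) / (n + 1)"
    using n by (simp add: power2_diff power_mult_distrib power_divide)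
  also have "\<dots> = y\<^sup>2 - (s + y)\<^sup>2 / (n + 1) + s\<^sup>2 / n"
    using n by (simp add: field_simps power2_eq_square)
  finally show ?thesis
    using assms unfolding sqdev_def c n_def[symmetric] s_def[symmetric]
    by (simp del: fun_upd_apply add: s1 s_def[symmetric]) (simp add: n_def[symmetric] add_ac)
qed

lemma sqdev_measurable:
  assumes "J \<subseteq> I"
  shows "(\<lambda>x. sqdev J x) \<in> borel_measurable (Pi\<^sub>M I (\<lambda>_. std_normal))"
proof -
  have [measurable]: "(\<lambda>x. x i) \<in> borel_measurable (Pi\<^sub>M I (\<lambda>_. std_normal))" if "i \<in> J" for i
  proof -
    have "(\<lambda>x. x i) \<in> measurable (Pi\<^sub>M I (\<lambda>_. std_normal)) std_normal"
      using that assms by (intro measurable_component_singleton) auto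
    then show ?thesis by simp
  qed
  show ?thesis unfolding sqdev_def by measurable
qed

lemma sum_measurable_PiM:
  assumes "J \<subseteq> I"
  shows "(\<lambda>x. \<Sum>i\<in>J. x i) \<in> borel_measurable (Pi\<^sub>M I (\<lambda>_. std_normal))"
proof -
  have [measurable]: "(\<lambda>x. x i) \<in> borel_measurable (Pi\<^sub>M I (\<lambda>_. std_normal))" if "i \<in> J" for i
  proof -
    have "(\<lambda>x. x i) \<in> measurable (Pi\<^sub>M I (\<lambda>_. std_normal)) std_normal"
      using that assms by (intro measurable_component_singleton) auto
    then show ?thesis by simp
  qed
  show ?thesis by measurable
qed

lemma product_sigma_finite_std_normal: "product_sigma_finite (\<lambda>_. std_normal)"
  by (rule product_sigma_finite.intro)
     (simp add: prob_space_imp_sigma_finite prob_space_std_normal)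

text \<open>In Laplace form: the normalized sum is standard normal and independent of
  \<open>sqdev\<close>, which is chi-squared with one degree of freedom less than the sample size.
  In the induction step the new sum and the new contrast arise by rotation from the old normalized
  sum and the new observation, so they are again independent standard normals, and the contrast
  contributes one more factor (1 + 2 t)^(-1/2).\<close>

lemma helmert_one_sample:
  assumes "finite I" "I \<noteq> {}" and t: "t \<ge> 0" and "g \<in> borel_measurable borel"
  shows "(\<integral>\<^sup>+x. g ((\<Sum>i\<in>I. x i) / sqrt (card I)) * ennreal (exp (- t * sqdev I x)) \<partial>Pi\<^sub>M I (\<lambda>_. std_normal))
     = ennreal ((1 + 2 * t) powr (- (real (card I) - 1) / 2)) * (\<integral>\<^sup>+x. g x \<partial>std_normal)"
  using assms
proof (induction arbitrary: g rule: finite_ne_induct)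
  case (singleton i)
  interpret product_sigma_finite "\<lambda>_. std_normal" by (rule product_sigma_finite_std_normal)
  note [measurable] = \<open>g \<in> _\<close>
  show ?case
    using t by (simp add: sqdev_def product_nn_integral_singleton)
next
  case (insert i I)
  interpret product_sigma_finite "\<lambda>_. std_normal" by (rule product_sigma_finite_std_normal)
  note [measurable] = \<open>g \<in> _\<close>
  define n where "n = real (card I)"
  have n: "n > 0" using insert by (simp add: n_def card_gt_0_iff)
  define a where "a = sqrt n / sqrt (n + 1)"
  define b where "b = 1 / sqrt (n + 1)"
  have ab: "a\<^sup>2 + b\<^sup>2 = 1" "a \<noteq> 0"
    using n by (auto simp: a_def b_def power_divide add_divide_distrib[symmetric])
  have c: "real (card (insert i I)) = n + 1" using insert by (simp add: n_def)
  \<comment> \<open>For a fixed new observation y, the exponential of the new contrast depends on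
    the old sample only through its sum, so it can join the test function. This is why
    \<open>g\<close> is arbitrary in the induction.\<close>
  define h where "h y u = g (a * u + b * y) * ennreal (exp (- t * (b * u - a * y)\<^sup>2))" for y u
  have upd: "(\<Sum>j\<in>insert i I. (x(i := y)) j) / sqrt (n + 1) = a * ((\<Sum>j\<in>I. x j) / sqrt n) + b * y" for x y
  proof -
    have "(\<Sum>j\<in>I. (x(i := y)) j) = (\<Sum>j\<in>I. x j)" using insert by (intro sum.cong) auto
    then show ?thesis
      using insert n by (simp add: a_def b_def add_divide_distrib del: fun_upd_apply) simp
  qed
  have sq: "sqdev (insert i I) (x(i := y)) = sqdev I x + (b * ((\<Sum>j\<in>I. x j) / sqrt n) - a * y)\<^sup>2" for x y
    using sqdev_insert[of I i x y] insert
    by (simp add: n_def[symmetric] a_def b_def power2_commute add.commute)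
  have e: "ennreal (exp (- t * (q + d))) = ennreal (exp (- t * d)) * ennreal (exp (- t * q))" for q d
    by (subst ennreal_mult[symmetric]) (simp_all add: exp_add[symmetric] algebra_simps)
  have [measurable]: "sqdev (insert i I) \<in> borel_measurable (Pi\<^sub>M (insert i I) (\<lambda>_. std_normal))"
      "(\<lambda>x. \<Sum>i\<in>insert i I. x i) \<in> borel_measurable (Pi\<^sub>M (insert i I) (\<lambda>_. std_normal))"
    by (rule sqdev_measurable sum_measurable_PiM, simp)+
  have m1: "(\<lambda>x. g ((\<Sum>i\<in>insert i I. x i) / sqrt (n + 1)) * ennreal (exp (- t * sqdev (insert i I) x)))
      \<in> borel_measurable (Pi\<^sub>M (insert i I) (\<lambda>_. std_normal))"
    by measurable
  have "(\<integral>\<^sup>+x. g ((\<Sum>i\<in>insert i I. x i) / sqrt (card (insert i I))) * ennreal (exp (- t * sqdev (insert i I) x)) \<partial>Pi\<^sub>M (insert i I) (\<lambda>_. std_normal))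
    = (\<integral>\<^sup>+y. \<integral>\<^sup>+x. g ((\<Sum>j\<in>insert i I. (x(i := y)) j) / sqrt (n + 1)) * ennreal (exp (- t * sqdev (insert i I) (x(i := y)))) \<partial>Pi\<^sub>M I (\<lambda>_. std_normal) \<partial>std_normal)"
    unfolding c
    by (rule product_nn_integral_insert_rev) (use insert in \<open>auto intro: m1\<close>)
  also have "\<dots> = (\<integral>\<^sup>+y. \<integral>\<^sup>+x. h y ((\<Sum>j\<in>I. x j) / sqrt (card I)) * ennreal (exp (- t * sqdev I x)) \<partial>Pi\<^sub>M I (\<lambda>_. std_normal) \<partial>std_normal)"
    unfolding upd sq h_def n_def[symmetric] by (simp only: e mult.assoc)
  also have "\<dots> = (\<integral>\<^sup>+y. ennreal ((1 + 2 * t) powr (- (n - 1) / 2)) * (\<integral>\<^sup>+x. h y x \<partial>std_normal) \<partial>std_normal)"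
    unfolding n_def
    by (intro nn_integral_cong insert.IH t) (unfold h_def, measurable)
  also have "\<dots> = ennreal ((1 + 2 * t) powr (- (n - 1) / 2)) * (\<integral>\<^sup>+y. \<integral>\<^sup>+x. h y x \<partial>std_normal \<partial>std_normal)"
    by (rule nn_integral_cmult) (unfold h_def, measurable)
  also have "(\<integral>\<^sup>+y. \<integral>\<^sup>+x. h y x \<partial>std_normal \<partial>std_normal)
     = (\<integral>\<^sup>+y. \<integral>\<^sup>+x. g x * ennreal (exp (- t * y\<^sup>2)) \<partial>std_normal \<partial>std_normal)"
    unfolding h_def
    by (rule nn_integral_std_normal_rotate[OF ab, where f="\<lambda>x y. g x * ennreal (exp (- t * y\<^sup>2))"]) measurable
  also have "\<dots> = (\<integral>\<^sup>+x. g x \<partial>std_normal) * ennreal ((1 + 2 * t) powr (-1/2))"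
    by (simp add: nn_integral_multc nn_integral_cmult nn_integral_std_normal_exp_sq[OF t, simplified])
  also have "ennreal ((1 + 2 * t) powr (- (n - 1) / 2)) * ((\<integral>\<^sup>+x. g x \<partial>std_normal) * ennreal ((1 + 2 * t) powr (-1/2)))
      = ennreal ((1 + 2 * t) powr (- (n - 1) / 2) * (1 + 2 * t) powr (-1/2)) * (\<integral>\<^sup>+x. g x \<partial>std_normal)"
    by (simp add: ennreal_mult ac_simps)
  also have "(1 + 2 * t) powr (- (n - 1) / 2) * (1 + 2 * t) powr (-1/2) = (1 + 2 * t) powr (- (n + 1 - 1) / 2)"
    by (simp add: powr_add[symmetric] diff_divide_distrib)
  finally show ?case unfolding c .
qed

text \<open>The one-sample result is applied to each sample, which leaves two independent standard
  normal sums and a total of n1 + n2 - 2 degrees of freedom. The standardized difference of means is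
  one coordinate of a rotation of these two sums.\<close>

lemma helmert_two_sample:
  assumes I: "finite I" "I \<noteq> {}" and J: "finite J" "J \<noteq> {}" and IJ: "I \<inter> J = {}"
    and t: "t \<ge> 0" and g[measurable]: "g \<in> borel_measurable borel"
  defines "n1 \<equiv> real (card I)" and "n2 \<equiv> real (card J)"
  shows "(\<integral>\<^sup>+x. g (sqrt (n1 * n2 / (n1 + n2)) * ((\<Sum>i\<in>I. x i) / n1 - (\<Sum>i\<in>J. x i) / n2))
            * ennreal (exp (- t * (sqdev I x + sqdev J x))) \<partial>Pi\<^sub>M (I \<union> J) (\<lambda>_. std_normal))
     = ennreal ((1 + 2 * t) powr (- (n1 + n2 - 2) / 2)) * (\<integral>\<^sup>+x. g x \<partial>std_normal)"
proof -
  interpret product_sigma_finite "\<lambda>_. std_normal" by (rule product_sigma_finite_std_normal)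
  have n: "n1 > 0" "n2 > 0" using I J by (auto simp: n1_def n2_def card_gt_0_iff)
  \<comment> \<open>The weights of the normalized sums of J and of I in the difference of means;
    \<open>a\<close> is negative because the mean over J is subtracted.\<close>
  define a where "a = - sqrt n1 / sqrt (n1 + n2)"
  define b where "b = sqrt n2 / sqrt (n1 + n2)"
  have ab: "a\<^sup>2 + b\<^sup>2 = 1" "a \<noteq> 0"
    using n by (auto simp: a_def b_def power_divide add_divide_distrib[symmetric])
  have lin: "sqrt (n1 * n2 / (n1 + n2)) * (u / n1 - v / n2) = a * (v / sqrt n2) + b * (u / sqrt n1)" for u v
  proof -
    have "sqrt n1 * (u / n1) = u / sqrt n1" "sqrt n2 * (v / n2) = v / sqrt n2"
      using n by (auto simp: field_simps)
    moreover have "sqrt n1 * sqrt n2 * (u / n1 - v / n2) = sqrt n2 * (sqrt n1 * (u / n1)) - sqrt n1 * (sqrt n2 * (v / n2))"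
      by (simp add: algebra_simps)
    ultimately have "sqrt n1 * sqrt n2 * (u / n1 - v / n2) = sqrt n2 * (u / sqrt n1) - sqrt n1 * (v / sqrt n2)"
      by simp
    then show ?thesis
      by (simp add: real_sqrt_mult real_sqrt_divide a_def b_def diff_divide_distrib mult.commute)
  qed
  have sI: "(\<Sum>i\<in>I. merge I J (x, y) i) = (\<Sum>i\<in>I. x i)" "sqdev I (merge I J (x, y)) = sqdev I x" for x y :: "'a \<Rightarrow> real"
    by (auto simp: merge_def sqdev_def intro!: sum.cong)
  have sJ: "(\<Sum>i\<in>J. merge I J (x, y) i) = (\<Sum>i\<in>J. y i)" "sqdev J (merge I J (x, y)) = sqdev J y" for x y :: "'a \<Rightarrow> real"
    using IJ by (auto simp: merge_def sqdev_def intro!: sum.cong arg_cong2[where f="(-)"] arg_cong2[where f="(/)"] arg_cong2[where f="(^)"])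
  have [measurable]: "sqdev I \<in> borel_measurable (Pi\<^sub>M (I \<union> J) (\<lambda>_. std_normal))"
      "sqdev J \<in> borel_measurable (Pi\<^sub>M (I \<union> J) (\<lambda>_. std_normal))"
      "(\<lambda>x. \<Sum>i\<in>I. x i) \<in> borel_measurable (Pi\<^sub>M (I \<union> J) (\<lambda>_. std_normal))"
      "(\<lambda>x. \<Sum>i\<in>J. x i) \<in> borel_measurable (Pi\<^sub>M (I \<union> J) (\<lambda>_. std_normal))"
      "sqdev J \<in> borel_measurable (Pi\<^sub>M J (\<lambda>_. std_normal))"
      "(\<lambda>x. \<Sum>i\<in>J. x i) \<in> borel_measurable (Pi\<^sub>M J (\<lambda>_. std_normal))"
    by (rule sqdev_measurable sum_measurable_PiM, simp)+
  have e: "ennreal (exp (- t * (q + d))) = ennreal (exp (- t * d)) * ennreal (exp (- t * q))" for q d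
    by (subst ennreal_mult[symmetric]) (simp_all add: exp_add[symmetric] algebra_simps)
  define c2 where "c2 = ennreal ((1 + 2 * t) powr (- (n2 - 1) / 2))"
  define c1 where "c1 = ennreal ((1 + 2 * t) powr (- (n1 - 1) / 2))"
  have "(\<integral>\<^sup>+x. g (sqrt (n1 * n2 / (n1 + n2)) * ((\<Sum>i\<in>I. x i) / n1 - (\<Sum>i\<in>J. x i) / n2))
            * ennreal (exp (- t * (sqdev I x + sqdev J x))) \<partial>Pi\<^sub>M (I \<union> J) (\<lambda>_. std_normal))
     = (\<integral>\<^sup>+x. \<integral>\<^sup>+y. g (a * ((\<Sum>i\<in>J. y i) / sqrt n2) + b * ((\<Sum>i\<in>I. x i) / sqrt n1))
            * ennreal (exp (- t * (sqdev I x + sqdev J y))) \<partial>Pi\<^sub>M J (\<lambda>_. std_normal) \<partial>Pi\<^sub>M I (\<lambda>_. std_normal))"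
    unfolding lin by (subst product_nn_integral_fold[OF IJ I(1) J(1)]) (measurable, simp add: sI sJ)
  also have "\<dots> = (\<integral>\<^sup>+x. c2 * (\<integral>\<^sup>+v. g (a * v + b * ((\<Sum>i\<in>I. x i) / sqrt n1)) \<partial>std_normal)
            * ennreal (exp (- t * sqdev I x)) \<partial>Pi\<^sub>M I (\<lambda>_. std_normal))"
  proof (rule nn_integral_cong)
    fix x
    have "(\<integral>\<^sup>+y. g (a * ((\<Sum>i\<in>J. y i) / sqrt n2) + b * ((\<Sum>i\<in>I. x i) / sqrt n1))
            * ennreal (exp (- t * (sqdev I x + sqdev J y))) \<partial>Pi\<^sub>M J (\<lambda>_. std_normal))
      = (\<integral>\<^sup>+y. (g (a * ((\<Sum>i\<in>J. y i) / sqrt n2) + b * ((\<Sum>i\<in>I. x i) / sqrt n1))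
            * ennreal (exp (- t * sqdev J y))) * ennreal (exp (- t * sqdev I x)) \<partial>Pi\<^sub>M J (\<lambda>_. std_normal))"
      by (simp only: e mult.assoc)
    also have "\<dots> = (\<integral>\<^sup>+y. g (a * ((\<Sum>i\<in>J. y i) / sqrt n2) + b * ((\<Sum>i\<in>I. x i) / sqrt n1))
            * ennreal (exp (- t * sqdev J y)) \<partial>Pi\<^sub>M J (\<lambda>_. std_normal)) * ennreal (exp (- t * sqdev I x))"
      by (rule nn_integral_multc) measurable
    also have "(\<integral>\<^sup>+y. g (a * ((\<Sum>i\<in>J. y i) / sqrt n2) + b * ((\<Sum>i\<in>I. x i) / sqrt n1))
            * ennreal (exp (- t * sqdev J y)) \<partial>Pi\<^sub>M J (\<lambda>_. std_normal))
        = c2 * (\<integral>\<^sup>+v. g (a * v + b * ((\<Sum>i\<in>I. x i) / sqrt n1)) \<partial>std_normal)"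
      unfolding c2_def n2_def by (rule helmert_one_sample[OF J t]) measurable
    finally show "(\<integral>\<^sup>+y. g (a * ((\<Sum>i\<in>J. y i) / sqrt n2) + b * ((\<Sum>i\<in>I. x i) / sqrt n1))
            * ennreal (exp (- t * (sqdev I x + sqdev J y))) \<partial>Pi\<^sub>M J (\<lambda>_. std_normal))
        = c2 * (\<integral>\<^sup>+v. g (a * v + b * ((\<Sum>i\<in>I. x i) / sqrt n1)) \<partial>std_normal) * ennreal (exp (- t * sqdev I x))" .
  qed
  also have "\<dots> = c1 * (\<integral>\<^sup>+u. c2 * (\<integral>\<^sup>+v. g (a * v + b * u) \<partial>std_normal) \<partial>std_normal)"
  proof -
    interpret N: sigma_finite_measure std_normal by (simp add: prob_space_imp_sigma_finite prob_space_std_normal)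
    show ?thesis
      unfolding c1_def n1_def by (rule helmert_one_sample[OF I t]) measurable
  qed
  also have "\<dots> = c1 * (c2 * (\<integral>\<^sup>+u. \<integral>\<^sup>+v. g (a * v + b * u) \<partial>std_normal \<partial>std_normal))"
  proof -
    interpret N: sigma_finite_measure std_normal by (simp add: prob_space_imp_sigma_finite prob_space_std_normal)
    show ?thesis by (subst nn_integral_cmult) auto
  qed
  also have "(\<integral>\<^sup>+u. \<integral>\<^sup>+v. g (a * v + b * u) \<partial>std_normal \<partial>std_normal)
     = (\<integral>\<^sup>+y. \<integral>\<^sup>+x. g x \<partial>std_normal \<partial>std_normal)"
    by (rule nn_integral_std_normal_rotate[OF ab, where f="\<lambda>x y. g x"]) measurable
  also have "\<dots> = (\<integral>\<^sup>+x. g x \<partial>std_normal)"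
    using prob_space.emeasure_space_1[OF prob_space_std_normal] by simp
  also have "c1 * (c2 * (\<integral>\<^sup>+x. g x \<partial>std_normal)) = ennreal ((1 + 2 * t) powr (- (n1 + n2 - 2) / 2)) * (\<integral>\<^sup>+x. g x \<partial>std_normal)"
  proof -
    have "- (n1 - 1) / 2 + - (n2 - 1) / 2 = - (n1 + n2 - 2) / 2" by (simp add: field_simps)
    then have "(1 + 2 * t) powr (- (n1 - 1) / 2) * (1 + 2 * t) powr (- (n2 - 1) / 2) = (1 + 2 * t) powr (- (n1 + n2 - 2) / 2)"
      by (simp only: powr_add[symmetric])
    then show ?thesis
      unfolding c1_def c2_def by (simp only: mult.assoc[symmetric] ennreal_mult[symmetric] powr_ge_zero)
  qed
  finally show ?thesis .
qed

text \<open>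
  The Laplace-transform form of: \<open>H\<close> is standard normal, \<open>W\<close> is chi-squared with \<open>nu\<close> degrees
  of freedom, and the two are independent.
\<close>

locale normal_chisq = prob_space +
  fixes H W :: "'a \<Rightarrow> real" and nu :: real
  assumes H[measurable]: "H \<in> borel_measurable M" and W[measurable]: "W \<in> borel_measurable M"
    and W_nonneg: "\<And>\<omega>. W \<omega> \<ge> 0" and nu_pos: "nu > 0"
    and laplace: "\<And>g t. g \<in> borel_measurable borel \<Longrightarrow> t \<ge> 0 \<Longrightarrow>
      (\<integral>\<^sup>+\<omega>. g (H \<omega>) * ennreal (exp (- t * W \<omega>)) \<partial>M) = ennreal ((1 + 2 * t) powr (- nu / 2)) * (\<integral>\<^sup>+x. g x \<partial>std_normal)"

lemma (in prob_space) normal_chisq_two_sample: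
  fixes \<xi> :: "'i \<Rightarrow> 'a \<Rightarrow> real"
  assumes I: "finite I" "I \<noteq> {}" and J: "finite J" "J \<noteq> {}" and IJ: "I \<inter> J = {}"
    and card: "card I + card J > 2"
    and indep: "indep_vars (\<lambda>_. borel) \<xi> (I \<union> J)"
    and distr: "\<And>i. i \<in> I \<union> J \<Longrightarrow> distr M borel (\<xi> i) = std_normal"
  shows "normal_chisq M
      (\<lambda>\<omega>. sqrt (real (card I) * real (card J) / (real (card I) + real (card J))) *
           ((\<Sum>i\<in>I. \<xi> i \<omega>) / real (card I) - (\<Sum>i\<in>J. \<xi> i \<omega>) / real (card J)))
      (\<lambda>\<omega>. sqdev I (\<lambda>i. \<xi> i \<omega>) + sqdev J (\<lambda>i. \<xi> i \<omega>)) (real (card I) + real (card J) - 2)"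
    (is "normal_chisq M ?H ?W _")
proof
  have rv[measurable]: "\<xi> i \<in> borel_measurable M" if "i \<in> I \<union> J" for i
    using indep that by (auto simp: indep_vars_def)
  then have rv'[measurable]: "\<xi> i \<in> borel_measurable M" if "i \<in> I" for i using that by auto
  from rv have rv''[measurable]: "\<xi> i \<in> borel_measurable M" if "i \<in> J" for i using that by auto
  show "?H \<in> borel_measurable M" by measurable
  show "?W \<in> borel_measurable M" unfolding sqdev_def by measurable
  show "?W \<omega> \<ge> 0" for \<omega> using sqdev_nonneg[OF I] sqdev_nonneg[OF J] by simp
  show "real (card I) + real (card J) - 2 > 0" using card by linarith
  fix g :: "real \<Rightarrow> ennreal" and t :: real
  assume g[measurable]: "g \<in> borel_measurable borel" and t: "t \<ge> 0"
  let ?F = "\<lambda>x. g (sqrt (real (card I) * real (card J) / (real (card I) + real (card J))) *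
           ((\<Sum>i\<in>I. x i) / real (card I) - (\<Sum>i\<in>J. x i) / real (card J))) *
        ennreal (exp (- t * (sqdev I x + sqdev J x)))"
  let ?R = "\<lambda>\<omega>. \<lambda>i\<in>I\<union>J. \<xi> i \<omega>"
  have D: "distr M (Pi\<^sub>M (I \<union> J) (\<lambda>_. borel)) ?R = Pi\<^sub>M (I \<union> J) (\<lambda>_. std_normal)"
  proof -
    have "distr M (Pi\<^sub>M (I \<union> J) (\<lambda>_. borel)) ?R = Pi\<^sub>M (I \<union> J) (\<lambda>i. distr M borel (\<xi> i))"
      using indep I by (subst indep_vars_iff_distr_eq_PiM'[symmetric]) auto
    also have "\<dots> = Pi\<^sub>M (I \<union> J) (\<lambda>_. std_normal)"
      by (rule PiM_cong) (use distr in auto)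
    finally show ?thesis .
  qed
  have Rm: "?R \<in> measurable M (Pi\<^sub>M (I \<union> J) (\<lambda>_. borel))"
    by (rule measurable_restrict) (rule rv)
  have sets: "sets (Pi\<^sub>M (I \<union> J) (\<lambda>_. std_normal)) = sets (Pi\<^sub>M (I \<union> J) (\<lambda>_. borel))"
    by (rule sets_PiM_cong) auto
  have [measurable]: "sqdev I \<in> borel_measurable (Pi\<^sub>M (I \<union> J) (\<lambda>_. std_normal))"
      "sqdev J \<in> borel_measurable (Pi\<^sub>M (I \<union> J) (\<lambda>_. std_normal))"
      "(\<lambda>x. \<Sum>i\<in>I. x i) \<in> borel_measurable (Pi\<^sub>M (I \<union> J) (\<lambda>_. std_normal))"
      "(\<lambda>x. \<Sum>i\<in>J. x i) \<in> borel_measurable (Pi\<^sub>M (I \<union> J) (\<lambda>_. std_normal))"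
    by (rule sqdev_measurable sum_measurable_PiM, simp)+
  have Fm: "?F \<in> borel_measurable (Pi\<^sub>M (I \<union> J) (\<lambda>_. borel))"
    unfolding measurable_cong_sets[OF sets[symmetric] refl] by measurable
  have FR: "?F (?R \<omega>) = g (?H \<omega>) * ennreal (exp (- t * ?W \<omega>))" for \<omega>
    by (simp add: sqdev_def)
  have "(\<integral>\<^sup>+\<omega>. g (?H \<omega>) * ennreal (exp (- t * ?W \<omega>)) \<partial>M) = (\<integral>\<^sup>+\<omega>. ?F (?R \<omega>) \<partial>M)"
    by (simp only: FR)
  also have "\<dots> = (\<integral>\<^sup>+x. ?F x \<partial>Pi\<^sub>M (I \<union> J) (\<lambda>_. std_normal))"
    unfolding D[symmetric] by (rule nn_integral_distr[OF Rm, symmetric]) (use Fm in simp)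
  also have "\<dots> = ennreal ((1 + 2 * t) powr (- (real (card I) + real (card J) - 2) / 2)) * (\<integral>\<^sup>+x. g x \<partial>std_normal)"
    by (rule helmert_two_sample[OF I J IJ t g])
  finally show "(\<integral>\<^sup>+\<omega>. g (?H \<omega>) * ennreal (exp (- t * ?W \<omega>)) \<partial>M) =
    ennreal ((1 + 2 * t) powr (- (real (card I) + real (card J) - 2) / 2)) * (\<integral>\<^sup>+x. g x \<partial>std_normal)" .
qed

section \<open>Inverse moments of the chi-squared variable\<close>

context normal_chisq
begin

lemma nn_integral_H: "g \<in> borel_measurable borel \<Longrightarrow> (\<integral>\<^sup>+\<omega>. g (H \<omega>) \<partial>M) = (\<integral>\<^sup>+x. g x \<partial>std_normal)"
  using laplace[of g 0] by simp

lemma distr_H: "distr M borel H = std_normal"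
proof (rule measure_eqI)
  fix A :: "real set" assume "A \<in> sets (distr M borel H)"
  then have [measurable]: "A \<in> sets borel" by simp
  have "emeasure (distr M borel H) A = (\<integral>\<^sup>+\<omega>. indicator A (H \<omega>) \<partial>M)"
    by (simp flip: nn_integral_indicator add: nn_integral_distr)
  also have "\<dots> = (\<integral>\<^sup>+x. indicator A x \<partial>std_normal)" by (rule nn_integral_H) measurable
  finally show "emeasure (distr M borel H) A = emeasure std_normal A"
    by simp
qed simp

text \<open>The event W = 0 is no more probable than the value of the Laplace transform at any n,
  and these values tend to 0. Dividing by W is therefore harmless almost everywhere.\<close>

lemma W_pos: "AE \<omega> in M. W \<omega> > 0"
proof -
  have b: "prob {\<omega>\<in>space M. W \<omega> = 0} \<le> (1 + 2 * real n) powr (- nu / 2)" for n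
  proof -
    have "emeasure M {\<omega>\<in>space M. W \<omega> = 0} = (\<integral>\<^sup>+\<omega>. indicator {\<omega>\<in>space M. W \<omega> = 0} \<omega> \<partial>M)" by simp
    also have "\<dots> \<le> (\<integral>\<^sup>+\<omega>. 1 * ennreal (exp (- real n * W \<omega>)) \<partial>M)"
      by (rule nn_integral_mono) (auto simp: indicator_def)
    also have "\<dots> = ennreal ((1 + 2 * real n) powr (- nu / 2))"
      by (subst laplace[of "\<lambda>_. 1"]) (simp_all add: prob_space.emeasure_space_1[OF prob_space_std_normal, simplified])
    finally show ?thesis by (simp add: emeasure_eq_measure)
  qed
  have "(\<lambda>n. (1 + 2 * real n) powr (- nu / 2)) \<longlonglongrightarrow> 0"
    by (rule tendsto_neg_powr) (use nu_pos in simp, real_asymp)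
  then have "prob {\<omega>\<in>space M. W \<omega> = 0} \<le> 0"
    by (rule LIMSEQ_le_const) (use b in auto)
  then have "emeasure M {\<omega>\<in>space M. W \<omega> = 0} = 0"
    by (simp add: emeasure_eq_measure measure_le_0_iff)
  then have "AE \<omega> in M. W \<omega> \<noteq> 0" by (subst AE_iff_measurable[OF _ refl]) auto
  then show ?thesis by eventually_elim (use W_nonneg in \<open>metis order_le_less\<close>)
qed

text \<open>The moment of order -k of the chi-squared law with \<open>nu\<close> degrees of freedom,
  finite as long as 2 k < nu.\<close>

definition kappa :: "nat \<Rightarrow> real" where
  "kappa k = (\<Prod>i=1..k. 1 / (nu - 2 * real i))"

lemma kappa_nonneg: "real (2 * k) < nu \<Longrightarrow> kappa k \<ge> 0"
  unfolding kappa_def by (rule prod_nonneg) auto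

text \<open>By induction on \<open>k\<close>, from \<open>exp (- t * w) / w\<close> as the integral of \<open>exp (- r * w)\<close> over \<open>r \<ge> t\<close>.\<close>

lemma nn_integral_exp_over_power:
  assumes "real (2 * k) < nu" and "t \<ge> 0" and g[measurable]: "g \<in> borel_measurable borel"
  shows "(\<integral>\<^sup>+\<omega>. g (H \<omega>) * ennreal (exp (- t * W \<omega>) / W \<omega> ^ k) \<partial>M)
     = ennreal (kappa k * (1 + 2 * t) powr (real k - nu / 2)) * (\<integral>\<^sup>+x. g x \<partial>std_normal)"
  using assms(1,2)
proof (induction k arbitrary: t)
  case 0
  then show ?case using laplace[of g t] by (simp add: kappa_def)
next
  case (Suc k)
  have k: "real (2 * k) < nu" using Suc by simp
  define G where "G = (\<integral>\<^sup>+x. g x \<partial>std_normal)"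
  have inner: "ennreal (exp (- t * W \<omega>) / W \<omega> ^ Suc k) = (\<integral>\<^sup>+r. ennreal (exp (- r * W \<omega>) / W \<omega> ^ k) * indicator {t..} r \<partial>lborel)"
    if w: "W \<omega> > 0" for \<omega>
  proof -
    define w where "w = W \<omega>"
    have w: "w > 0" using w by (simp add: w_def)
    have "(\<integral>\<^sup>+r. ennreal (exp (- r * w) / w ^ k) * indicator {t..} r \<partial>lborel) = ennreal (0 - (- exp (- t * w) / w ^ Suc k))"
    proof (rule nn_integral_FTC_atLeast)
      show "((\<lambda>r. - exp (- r * w) / w ^ Suc k) has_real_derivative exp (- r * w) / w ^ k) (at r)" for r
        using w by (auto intro!: derivative_eq_intros simp: field_simps)
      have "((\<lambda>r. - exp (- r * w) / w ^ Suc k) \<longlongrightarrow> - 0 / w ^ Suc k) at_top"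
        using w by (intro tendsto_intros filterlim_compose[OF exp_at_bot])
           (auto intro!: filterlim_tendsto_pos_mult_at_bot[of _ w] simp: filterlim_uminus_at_bot filterlim_at_top_mult_tendsto_pos mult.commute[of _ w] intro: filterlim_tendsto_pos_mult_at_top[OF tendsto_const] filterlim_ident)
      then show "((\<lambda>r. - exp (- r * w) / w ^ Suc k) \<longlongrightarrow> 0) at_top" by simp
    qed (use w in auto)
    then show ?thesis by (simp add: w_def)
  qed
  have "(\<integral>\<^sup>+\<omega>. g (H \<omega>) * ennreal (exp (- t * W \<omega>) / W \<omega> ^ Suc k) \<partial>M)
     = (\<integral>\<^sup>+\<omega>. g (H \<omega>) * (\<integral>\<^sup>+r. ennreal (exp (- r * W \<omega>) / W \<omega> ^ k) * indicator {t..} r \<partial>lborel) \<partial>M)"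
    by (rule nn_integral_cong_AE) (use W_pos in eventually_elim, simp only: inner)
  also have "\<dots> = (\<integral>\<^sup>+\<omega>. (\<integral>\<^sup>+r. g (H \<omega>) * (ennreal (exp (- r * W \<omega>) / W \<omega> ^ k) * indicator {t..} r) \<partial>lborel) \<partial>M)"
    by (subst nn_integral_cmult) auto
  also have "\<dots> = (\<integral>\<^sup>+r. (\<integral>\<^sup>+\<omega>. g (H \<omega>) * (ennreal (exp (- r * W \<omega>) / W \<omega> ^ k) * indicator {t..} r) \<partial>M) \<partial>lborel)"
  proof -
    interpret pair_sigma_finite M lborel ..
    show ?thesis by (rule Fubini'[symmetric]) measurable
  qed
  also have "\<dots> = (\<integral>\<^sup>+r. ennreal (kappa k * (1 + 2 * r) powr (real k - nu / 2)) * indicator {t..} r * G \<partial>lborel)"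
  proof (rule nn_integral_cong)
    fix r
    have "(\<integral>\<^sup>+\<omega>. g (H \<omega>) * ennreal (exp (- r * W \<omega>) / W \<omega> ^ k) \<partial>M) = ennreal (kappa k * (1 + 2 * r) powr (real k - nu / 2)) * G" if "r \<ge> t"
      using Suc.IH[OF k, of r] that Suc.prems by (simp add: G_def)
    then show "(\<integral>\<^sup>+\<omega>. g (H \<omega>) * (ennreal (exp (- r * W \<omega>) / W \<omega> ^ k) * indicator {t..} r) \<partial>M)
       = ennreal (kappa k * (1 + 2 * r) powr (real k - nu / 2)) * indicator {t..} r * G"
      by (simp split: split_indicator)
  qed
  also have "\<dots> = (\<integral>\<^sup>+r. ennreal (kappa k * (1 + 2 * r) powr (real k - nu / 2)) * indicator {t..} r \<partial>lborel) * G"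
    by (rule nn_integral_multc) measurable
  also have "(\<integral>\<^sup>+r. ennreal (kappa k * (1 + 2 * r) powr (real k - nu / 2)) * indicator {t..} r \<partial>lborel)
     = ennreal (0 - - (kappa (Suc k) * (1 + 2 * t) powr (real (Suc k) - nu / 2)))"
  proof (rule nn_integral_FTC_atLeast)
    have K: "kappa (Suc k) = kappa k / (nu - 2 * real (Suc k))" by (simp add: kappa_def)
    show "((\<lambda>r. - (kappa (Suc k) * (1 + 2 * r) powr (real (Suc k) - nu / 2))) has_real_derivative
        kappa k * (1 + 2 * r) powr (real k - nu / 2)) (at r)" if "t \<le> r" for r
    proof -
      have "((\<lambda>r. - (kappa (Suc k) * (1 + 2 * r) powr (real (Suc k) - nu / 2))) has_real_derivative
        - (kappa (Suc k) * ((real (Suc k) - nu / 2) * (1 + 2 * r) powr (real (Suc k) - nu / 2 - 1) * 2))) (at r)"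
        using that Suc.prems by (auto intro!: derivative_eq_intros)
      moreover have "real (Suc k) - nu / 2 - 1 = real k - nu / 2" by simp
      moreover have "- (kappa (Suc k) * ((real (Suc k) - nu / 2) * x * 2)) = kappa k * x" for x
        using Suc.prems unfolding K by (simp add: field_simps)
      ultimately show ?thesis by simp
    qed
    show "((\<lambda>r. - (kappa (Suc k) * (1 + 2 * r) powr (real (Suc k) - nu / 2))) \<longlongrightarrow> 0) at_top"
    proof -
      have "((\<lambda>r. (1 + 2 * r) powr (real (Suc k) - nu / 2)) \<longlongrightarrow> 0) at_top"
        by (rule tendsto_neg_powr) (use Suc.prems in simp, real_asymp)
      then have "((\<lambda>r. - (kappa (Suc k) * (1 + 2 * r) powr (real (Suc k) - nu / 2))) \<longlongrightarrow> - (kappa (Suc k) * 0)) at_top"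
        by (intro tendsto_intros)
      then show ?thesis by simp
    qed
  qed (use kappa_nonneg[OF k] in auto)
  finally show ?case by (simp add: G_def)
qed

lemma nn_integral_over_power:
  assumes "real (2 * k) < nu" and g[measurable]: "g \<in> borel_measurable borel"
  shows "(\<integral>\<^sup>+\<omega>. g (H \<omega>) * ennreal (1 / W \<omega> ^ k) \<partial>M) = ennreal (kappa k) * (\<integral>\<^sup>+x. g x \<partial>std_normal)"
  using nn_integral_exp_over_power[OF assms(1), of 0 g] by simp

end

section \<open>Moments of shifted normal variables\<close>

definition abs_mom :: "real \<Rightarrow> nat \<Rightarrow> real" where
  "abs_mom b n = (\<integral>x. (\<bar>x\<bar> + b) ^ n \<partial>std_normal)"

lemma integrable_abs_mom: "integrable std_normal (\<lambda>x. (\<bar>x\<bar> + b) ^ n)"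
proof -
  have "integrable std_normal (\<lambda>x. \<bar>x\<bar> ^ k)" for k
    using integrable_abs[OF integrable_std_normal_distribution_moment[of k]] by (simp add: power_abs)
  then show ?thesis
    unfolding binomial_ring by (intro Bochner_Integration.integrable_sum integrable_mult_left integrable_mult_right)
qed

lemma integrable_shift_power: "integrable std_normal (\<lambda>x. (x + d) ^ n)"
  unfolding binomial_ring
  by (intro Bochner_Integration.integrable_sum integrable_mult_left integrable_mult_right integrable_std_normal_distribution_moment)

lemma abs_mom_nonneg: "b \<ge> 0 \<Longrightarrow> abs_mom b n \<ge> 0"
  unfolding abs_mom_def by (rule integral_nonneg_AE) auto

text \<open>This makes \<open>abs_mom b n\<close> a constant that serves all shifts of modulus at
  most b at once, so that later bounds are uniform over coordinates and rows.\<close>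

lemma shift_power_le_abs_mom:
  assumes "\<bar>d\<bar> \<le> b"
  shows "(\<integral>x. (x + d) ^ n \<partial>std_normal) \<le> abs_mom b n"
  unfolding abs_mom_def
proof (rule integral_mono[OF integrable_shift_power integrable_abs_mom])
  fix x
  have "(x + d) ^ n \<le> \<bar>x + d\<bar> ^ n" by (metis abs_ge_self power_abs)
  also have "\<dots> \<le> (\<bar>x\<bar> + b) ^ n" using assms by (intro power_mono) auto
  finally show "(x + d) ^ n \<le> (\<bar>x\<bar> + b) ^ n" .
qed

lemma std_normal_moments:
  "(\<integral>x. x \<partial>std_normal) = 0" "(\<integral>x. x\<^sup>2 \<partial>std_normal) = 1"
  "(\<integral>x. x ^ 3 \<partial>std_normal) = 0" "(\<integral>x. x ^ 4 \<partial>std_normal) = 3"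
  using integral_std_normal_distribution_moment_odd[of 1] std_normal_distribution_even_moments(1)[of 1]
    integral_std_normal_distribution_moment_odd[of 3] std_normal_distribution_even_moments(1)[of 2]
  by (simp_all add: fact_numeral)

lemma affine_normal_sq: "(\<integral>x. (d + s * x)\<^sup>2 \<partial>std_normal) = d\<^sup>2 + s\<^sup>2"
proof -
  interpret prob_space std_normal by (rule prob_space_std_normal)
  note [simp] = integrable_std_normal_distribution_moment integrable_std_normal_distribution_moment[of 1, simplified]
  have "(\<integral>x. (d + s * x)\<^sup>2 \<partial>std_normal) = (\<integral>x. d\<^sup>2 + 2 * d * s * x + s\<^sup>2 * x\<^sup>2 \<partial>std_normal)"
    by (intro Bochner_Integration.integral_cong refl) (simp add: power2_eq_square algebra_simps)
  also have "\<dots> = d\<^sup>2 + s\<^sup>2"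
    using prob_space by (simp add: std_normal_moments)
  finally show ?thesis .
qed

lemma affine_normal_fourth: "(\<integral>x. (d + s * x) ^ 4 \<partial>std_normal) = d ^ 4 + 6 * d\<^sup>2 * s\<^sup>2 + 3 * s ^ 4"
proof -
  interpret prob_space std_normal by (rule prob_space_std_normal)
  note [simp] = integrable_std_normal_distribution_moment integrable_std_normal_distribution_moment[of 1, simplified]
  have "(\<integral>x. (d + s * x) ^ 4 \<partial>std_normal)
      = (\<integral>x. d ^ 4 + 4 * d ^ 3 * s * x + 6 * d\<^sup>2 * s\<^sup>2 * x\<^sup>2 + 4 * d * s ^ 3 * x ^ 3 + s ^ 4 * x ^ 4 \<partial>std_normal)"
    by (intro Bochner_Integration.integral_cong refl) (simp add: power2_eq_square power3_eq_cube power4_eq_xxxx algebra_simps)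
  also have "\<dots> = d ^ 4 + 6 * d\<^sup>2 * s\<^sup>2 + 3 * s ^ 4"
    using prob_space by (simp add: std_normal_moments)
  finally show ?thesis .
qed

text \<open>With the full square instead of half of it, the bound holds on the whole half line:
  beyond 1 the left side is negative.\<close>

lemma ln_one_plus_lower:
  assumes "(x::real) \<ge> 0"
  shows "x - x\<^sup>2 \<le> ln (1 + x)"
proof (cases "x \<le> 1")
  case True
  then show ?thesis using ln_one_plus_pos_lower_bound[of x] assms by simp
next
  case False
  then have "x - x\<^sup>2 \<le> 0" by (simp add: power2_eq_square)
  also have "0 \<le> ln (1 + x)" using assms by simp
  finally show ?thesis .
qed

section \<open>Moments of the log statistic\<close>

context normal_chisq
begin

lemma has_integral_over_power:
  assumes "real (2 * k) < nu" and [measurable]: "f \<in> borel_measurable borel"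
    and "\<And>x. f x \<ge> 0" and "integrable std_normal f"
  shows "has_bochner_integral M (\<lambda>\<omega>. f (H \<omega>) / W \<omega> ^ k) (kappa k * (\<integral>x. f x \<partial>std_normal))"
proof (rule has_bochner_integral_nn_integral)
  show "(\<lambda>\<omega>. f (H \<omega>) / W \<omega> ^ k) \<in> borel_measurable M" by measurable
  show "AE \<omega> in M. 0 \<le> f (H \<omega>) / W \<omega> ^ k" using assms(3) W_nonneg by auto
  have fi: "0 \<le> (\<integral>x. f x \<partial>std_normal)" using assms(3) by (intro integral_nonneg_AE) auto
  then show "0 \<le> kappa k * (\<integral>x. f x \<partial>std_normal)" using kappa_nonneg[OF assms(1)] by auto
  have "(\<integral>\<^sup>+\<omega>. ennreal (f (H \<omega>) / W \<omega> ^ k) \<partial>M) = (\<integral>\<^sup>+\<omega>. ennreal (f (H \<omega>)) * ennreal (1 / W \<omega> ^ k) \<partial>M)"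
    by (intro nn_integral_cong, subst ennreal_mult[symmetric]) (use assms(3) W_nonneg in auto)
  also have "\<dots> = ennreal (kappa k) * (\<integral>\<^sup>+x. ennreal (f x) \<partial>std_normal)"
    by (rule nn_integral_over_power[OF assms(1)]) measurable
  also have "(\<integral>\<^sup>+x. ennreal (f x) \<partial>std_normal) = ennreal (\<integral>x. f x \<partial>std_normal)"
    using assms by (intro nn_integral_eq_integral) auto
  finally show "(\<integral>\<^sup>+\<omega>. ennreal (f (H \<omega>) / W \<omega> ^ k) \<partial>M) = ennreal (kappa k * (\<integral>x. f x \<partial>std_normal))"
    using fi kappa_nonneg[OF assms(1)] by (simp add: ennreal_mult)
qed

text \<open>With four degrees of freedom per power each factor nu - 2 i is still at least nu / 2.
  The lower bounds on \<open>nu\<close> in the moment estimates come from here.\<close>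

lemma kappa_le:
  assumes "nu \<ge> 4 * real k"
  shows "kappa k \<le> (2 / nu) ^ k"
proof -
  have "kappa k \<le> (\<Prod>i=1..k. 2 / nu)"
    unfolding kappa_def
  proof (rule prod_mono)
    fix i assume i: "i \<in> {1..k}"
    then have "nu - 2 * real i \<ge> nu / 2" using assms by auto
    then have "1 / (nu - 2 * real i) \<le> 1 / (nu / 2)" using nu_pos by (intro divide_left_mono) auto
    then show "0 \<le> 1 / (nu - 2 * real i) \<and> 1 / (nu - 2 * real i) \<le> 2 / nu"
      using \<open>nu - 2 * real i \<ge> nu / 2\<close> nu_pos by auto
  qed
  then show ?thesis by simp
qed

text \<open>The statistic of one coordinate: nu + 2 is the total sample size N, H + d is the
  noncentral numerator, and its square over W equals t^2 / nu.\<close>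

definition V :: "real \<Rightarrow> 'a \<Rightarrow> real" where
  "V d \<omega> = (nu + 2) * ln (1 + (H \<omega> + d)\<^sup>2 / W \<omega>)"

lemma V_measurable[measurable]: "V d \<in> borel_measurable M"
  unfolding V_def by measurable

lemma V_nonneg: "V d \<omega> \<ge> 0"
  unfolding V_def using nu_pos W_nonneg[of \<omega>] by (intro mult_nonneg_nonneg ln_ge_zero) auto

lemma V_upper: "V d \<omega> \<le> (nu + 2) * ((H \<omega> + d)\<^sup>2 / W \<omega>)"
  unfolding V_def using nu_pos W_nonneg[of \<omega>] by (intro mult_left_mono ln_add_one_self_le_self) auto

lemma V_lower: "V d \<omega> \<ge> (nu + 2) * ((H \<omega> + d)\<^sup>2 / W \<omega> - ((H \<omega> + d)\<^sup>2 / W \<omega>)\<^sup>2)"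
  unfolding V_def using nu_pos W_nonneg[of \<omega>] by (intro mult_left_mono ln_one_plus_lower) auto

lemma has_integral_Z_over_power:
  assumes "real (2 * k) < nu"
  shows "has_bochner_integral M (\<lambda>\<omega>. (H \<omega> + d) ^ (2 * q) / W \<omega> ^ k) (kappa k * (\<integral>x. (x + d) ^ (2 * q) \<partial>std_normal))"
  by (rule has_integral_over_power[OF assms]) (auto intro: integrable_shift_power)

text \<open>From ln (1 + x) at most x, the power is dominated by a numerator moment times an inverse
  moment of W. The constant 4 bounds (nu + 2) * (2 / nu), which uses nu at least 2.\<close>

lemma V_moment:
  assumes nu: "nu > 4 * real q" "nu \<ge> 2" and d: "\<bar>d\<bar> \<le> b"
  shows "integrable M (\<lambda>\<omega>. V d \<omega> ^ q)" "expectation (\<lambda>\<omega>. V d \<omega> ^ q) \<le> 4 ^ q * abs_mom b (2 * q)"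
proof -
  let ?X = "\<lambda>\<omega>. (nu + 2) ^ q * ((H \<omega> + d) ^ (2 * q) / W \<omega> ^ q)"
  have hb: "has_bochner_integral M ?X ((nu + 2) ^ q * (kappa q * (\<integral>x. (x + d) ^ (2 * q) \<partial>std_normal)))"
    by (rule has_bochner_integral_mult_right[OF has_integral_Z_over_power]) (use nu in auto)
  have le: "V d \<omega> ^ q \<le> ?X \<omega>" for \<omega>
    using power_mono[OF V_upper V_nonneg, of d \<omega> q] by (simp add: power_mult_distrib power_divide power_mult)
  show int: "integrable M (\<lambda>\<omega>. V d \<omega> ^ q)"
    by (rule Bochner_Integration.integrable_bound[OF integrable.intros[OF hb]])
       (use order_trans[OF le abs_ge_self] V_nonneg in \<open>auto simp del: abs_mult abs_divide\<close>)
  have "expectation (\<lambda>\<omega>. V d \<omega> ^ q) \<le> expectation ?X"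
    by (rule integral_mono[OF int integrable.intros[OF hb] le])
  also have "\<dots> = (nu + 2) ^ q * (kappa q * (\<integral>x. (x + d) ^ (2 * q) \<partial>std_normal))"
    using hb by (rule has_bochner_integral_integral_eq)
  also have "\<dots> \<le> (nu + 2) ^ q * ((2 / nu) ^ q * abs_mom b (2 * q))"
    using nu nu_pos d by (intro mult_left_mono mult_mono kappa_le shift_power_le_abs_mom integral_nonneg_AE)
      (auto intro: abs_mom_nonneg)
  also have "\<dots> = ((nu + 2) * (2 / nu)) ^ q * abs_mom b (2 * q)"
    by (simp only: power_mult_distrib mult.assoc)
  also have "\<dots> \<le> 4 ^ q * abs_mom b (2 * q)"
    using nu d nu_pos by (intro mult_right_mono power_mono abs_mom_nonneg) (auto simp: field_simps)
  finally show "expectation (\<lambda>\<omega>. V d \<omega> ^ q) \<le> 4 ^ q * abs_mom b (2 * q)" .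
qed

text \<open>The two logarithm bounds sandwich the mean. The linear term has the explicit mean (nu +
  2) (1 + d^2) / (nu - 2), off by O(1/nu), and the quadratic correction is itself O(1/nu).\<close>

lemma V_mean:
  assumes nu: "nu \<ge> 16" and d: "\<bar>d\<bar> \<le> b"
  shows "\<bar>expectation (V d) - (1 + d\<^sup>2)\<bar> \<le> (8 * (1 + b\<^sup>2) + 8 * abs_mom b 4) / nu"
proof -
  have k1: "kappa 1 = 1 / (nu - 2)" by (simp add: kappa_def)
  have iV: "integrable M (V d)" using V_moment(1)[of 1 d b] nu d by simp
  have m2: "(\<integral>x. (x + d)\<^sup>2 \<partial>std_normal) = 1 + d\<^sup>2"
    using affine_normal_sq[of d 1] by (simp add: add.commute)
  let ?X = "\<lambda>\<omega>. (nu + 2) * ((H \<omega> + d)\<^sup>2 / W \<omega>)"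
  let ?Y = "\<lambda>\<omega>. (nu + 2) * ((H \<omega> + d) ^ 4 / W \<omega> ^ 2)"
  have hX: "has_bochner_integral M ?X ((nu + 2) * ((1 + d\<^sup>2) / (nu - 2)))"
    using has_bochner_integral_mult_right[OF has_integral_Z_over_power[of 1 d 1], of "nu + 2"] nu
    by (simp add: k1[simplified] m2)
  have hY: "has_bochner_integral M ?Y ((nu + 2) * (kappa 2 * (\<integral>x. (x + d) ^ 4 \<partial>std_normal)))"
    using has_bochner_integral_mult_right[OF has_integral_Z_over_power[of 2 d 2], of "nu + 2"] nu
    by simp
  have up: "expectation (V d) \<le> (nu + 2) * ((1 + d\<^sup>2) / (nu - 2))"
    using integral_mono[OF iV integrable.intros[OF hX] V_upper] has_bochner_integral_integral_eq[OF hX] by simp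
  have "(nu + 2) * ((1 + d\<^sup>2) / (nu - 2)) - (nu + 2) * (kappa 2 * (\<integral>x. (x + d) ^ 4 \<partial>std_normal)) \<le> expectation (V d)"
  proof -
    have "?X \<omega> - ?Y \<omega> \<le> V d \<omega>" for \<omega>
      using V_lower[of \<omega> d] by (simp add: power_divide right_diff_distrib)
    then have "expectation (\<lambda>\<omega>. ?X \<omega> - ?Y \<omega>) \<le> expectation (V d)"
      by (intro integral_mono iV Bochner_Integration.integrable_diff integrable.intros[OF hX] integrable.intros[OF hY])
    then show ?thesis
      using has_bochner_integral_integral_eq[OF has_bochner_integral_diff[OF hX hY]] by simp
  qed
  moreover have "(nu + 2) * (kappa 2 * (\<integral>x. (x + d) ^ 4 \<partial>std_normal)) \<le> (2 * nu) * ((2 / nu)\<^sup>2 * abs_mom b 4)"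
    using nu nu_pos d by (intro mult_mono kappa_le shift_power_le_abs_mom integral_nonneg_AE mult_nonneg_nonneg kappa_nonneg)
      (auto intro: abs_mom_nonneg)
  moreover have "(2 * nu) * ((2 / nu)\<^sup>2 * abs_mom b 4) = 8 * abs_mom b 4 / nu"
    using nu by (simp add: power2_eq_square field_simps)
  moreover have "(nu + 2) * ((1 + d\<^sup>2) / (nu - 2)) - (1 + d\<^sup>2) = (1 + d\<^sup>2) * (4 / (nu - 2))"
    using nu by (simp add: field_simps)
  moreover have "(1 + d\<^sup>2) * (4 / (nu - 2)) \<le> (1 + b\<^sup>2) * (8 / nu)"
    using nu d by (intro mult_mono) (auto simp: field_simps abs_le_square_iff[symmetric])
  moreover have "0 \<le> (1 + d\<^sup>2) * (4 / (nu - 2))" using nu by simp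
  moreover have "0 \<le> abs_mom b 4" using d by (intro abs_mom_nonneg) auto
  moreover have "(1 + b\<^sup>2) * (8 / nu) = 8 * (1 + b\<^sup>2) / nu" "(8 * (1 + b\<^sup>2) + 8 * abs_mom b 4) / nu = 8 * (1 + b\<^sup>2) / nu + 8 * abs_mom b 4 / nu"
    by (simp_all add: add_divide_distrib)
  moreover have "0 \<le> 8 * abs_mom b 4 / nu" "0 \<le> 8 * (1 + b\<^sup>2) / nu" using d nu_pos abs_mom_nonneg[of b 4] by auto
  ultimately show ?thesis using up by (intro abs_leI) linarith+
qed

lemma integrable_H_poly: "integrable M (\<lambda>\<omega>. (H \<omega> + d) ^ n)"
proof -
  have "integrable (distr M borel H) (\<lambda>x. (x + d) ^ n)"
    unfolding distr_H by (rule integrable_shift_power)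
  then show ?thesis by (rule integrable_distr[rotated]) simp
qed

text \<open>With x = Z^2 / W and N = nu + 2 the difference is split into V - N x, bounded by N x^2,
  and N x - Z^2 = Z^2 (N / W - 1). The square of the first has mean of order N^2 / nu^4, the second
  is small because W / N concentrates at 1.\<close>

lemma V_minus_square:
  assumes nu: "nu > 16" and d: "\<bar>d\<bar> \<le> b"
  shows "integrable M (\<lambda>\<omega>. (V d \<omega> - (H \<omega> + d)\<^sup>2)\<^sup>2)"
    "expectation (\<lambda>\<omega>. (V d \<omega> - (H \<omega> + d)\<^sup>2)\<^sup>2) \<le> (128 * abs_mom b 8 + 48 * abs_mom b 4) / nu"
proof -
  let ?N = "nu + 2"
  let ?m = "\<integral>x. (x + d) ^ 4 \<partial>std_normal"
  let ?Z = "\<lambda>\<omega>. H \<omega> + d"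
  let ?U = "\<lambda>\<omega>. 2 * ?N\<^sup>2 * (?Z \<omega> ^ 8 / W \<omega> ^ 4) +
     2 * (?N\<^sup>2 * (?Z \<omega> ^ 4 / W \<omega> ^ 2) - 2 * ?N * (?Z \<omega> ^ 4 / W \<omega> ^ 1) + ?Z \<omega> ^ 4 / W \<omega> ^ 0)"
  have k: "kappa 0 = 1" "kappa 1 = 1 / (nu - 2)" "kappa 2 = 1 / ((nu - 2) * (nu - 4))"
    by (simp_all add: kappa_def numeral_2_eq_2)
  have hU: "has_bochner_integral M ?U (2 * ?N\<^sup>2 * (kappa 4 * (\<integral>x. (x + d) ^ 8 \<partial>std_normal)) +
     2 * (?N\<^sup>2 * (kappa 2 * ?m) - 2 * ?N * (kappa 1 * ?m) + kappa 0 * ?m))"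
    using has_integral_Z_over_power[of 4 d 4] has_integral_Z_over_power[of 2 d 2]
      has_integral_Z_over_power[of 1 d 2] has_integral_Z_over_power[of 0 d 2] nu
    by (intro has_bochner_integral_add has_bochner_integral_diff has_bochner_integral_mult_right) auto
  have le: "(V d \<omega> - (?Z \<omega>)\<^sup>2)\<^sup>2 \<le> ?U \<omega>" for \<omega>
  proof -
    define w where "w = W \<omega>"
    define z where "z = ?Z \<omega>"
    define x where "x = z\<^sup>2 / w"
    have "x \<ge> 0" using W_nonneg[of \<omega>] by (simp add: x_def w_def)
    have "\<bar>V d \<omega> - ?N * x\<bar> \<le> ?N * x\<^sup>2"
      using V_upper[of d \<omega>] V_lower[of \<omega> d] nu \<open>x \<ge> 0\<close>
      by (auto simp: x_def w_def z_def abs_le_iff algebra_simps)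
    then have 1: "(V d \<omega> - ?N * x)\<^sup>2 \<le> (?N * x\<^sup>2)\<^sup>2" by (metis abs_ge_zero order_trans power2_abs power_mono)
    have 2: "(V d \<omega> - z\<^sup>2)\<^sup>2 \<le> 2 * (V d \<omega> - ?N * x)\<^sup>2 + 2 * (?N * x - z\<^sup>2)\<^sup>2"
      using sum_squares_ge_zero[of "(V d \<omega> - ?N * x) - (?N * x - z\<^sup>2)" 0]
      by (simp add: power2_eq_square algebra_simps)
    have 3: "(?N * x\<^sup>2)\<^sup>2 = ?N\<^sup>2 * (z ^ 8 / w ^ 4)"
      by (simp add: x_def power_mult_distrib power_divide)
    have 4: "(?N * x - z\<^sup>2)\<^sup>2 = ?N\<^sup>2 * (z ^ 4 / w ^ 2) - 2 * ?N * (z ^ 4 / w ^ 1) + z ^ 4 / w ^ 0"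
      by (simp add: x_def power2_diff power_mult_distrib power_divide) (simp add: power2_eq_square power4_eq_xxxx)
    have "a \<le> 2 * p' + 2 * q'" if "a \<le> 2 * p + 2 * q" "p \<le> r" "r = p'" "q = q'" for a p q r p' q' :: real
      using that by linarith
    from this[OF 2 1 3 4] have "(V d \<omega> - z\<^sup>2)\<^sup>2 \<le> 2 * (?N\<^sup>2 * (z ^ 8 / w ^ 4)) + 2 * (?N\<^sup>2 * (z ^ 4 / w ^ 2) - 2 * ?N * (z ^ 4 / w ^ 1) + z ^ 4 / w ^ 0)"
      .
    then show ?thesis unfolding w_def z_def by (simp only: mult.assoc)
  qed
  show int: "integrable M (\<lambda>\<omega>. (V d \<omega> - (H \<omega> + d)\<^sup>2)\<^sup>2)"
    by (rule Bochner_Integration.integrable_bound[OF integrable.intros[OF hU]])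
       (use le in \<open>auto intro: order_trans[OF _ abs_ge_self]\<close>)
  have "expectation (\<lambda>\<omega>. (V d \<omega> - (H \<omega> + d)\<^sup>2)\<^sup>2) \<le> 2 * ?N\<^sup>2 * (kappa 4 * (\<integral>x. (x + d) ^ 8 \<partial>std_normal)) +
     2 * (?N\<^sup>2 * (kappa 2 * ?m) - 2 * ?N * (kappa 1 * ?m) + kappa 0 * ?m)"
    using integral_mono[OF int integrable.intros[OF hU] le] has_bochner_integral_integral_eq[OF hU] by simp
  \<comment> \<open>The coefficient of \<open>?m\<close> is the second moment of N / W - 1. Its
    leading terms cancel, which leaves a quantity of order 1 / nu.\<close>
  also have "?N\<^sup>2 * (kappa 2 * ?m) - 2 * ?N * (kappa 1 * ?m) + kappa 0 * ?m = (2 * nu + 28) / ((nu - 2) * (nu - 4)) * ?m"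
  proof -
    have "?N\<^sup>2 * (1 / ((nu - 2) * (nu - 4))) - 2 * ?N * (1 / (nu - 2)) + 1 = (2 * nu + 28) / ((nu - 2) * (nu - 4))"
      using nu by (simp add: divide_simps) (simp add: power2_eq_square algebra_simps)
    moreover have "A * (B * m) - C * (D * m) + 1 * m = (A * B - C * D + 1) * m" for A B C D m :: real
      by (simp add: algebra_simps)
    ultimately show ?thesis unfolding k by metis
  qed
  also have "2 * ?N\<^sup>2 * (kappa 4 * (\<integral>x. (x + d) ^ 8 \<partial>std_normal)) \<le> 2 * (2 * nu)\<^sup>2 * ((2 / nu) ^ 4 * abs_mom b 8)"
    using nu d by (intro mult_mono kappa_le shift_power_le_abs_mom integral_nonneg_AE mult_nonneg_nonneg kappa_nonneg power_mono)
      (auto intro: abs_mom_nonneg)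
  also have "\<dots> = 128 * abs_mom b 8 / nu\<^sup>2"
    using nu by (simp add: field_simps power4_eq_xxxx power2_eq_square)
  also have "\<dots> \<le> 128 * abs_mom b 8 / nu"
    using nu d abs_mom_nonneg[of b 8] by (intro divide_left_mono) (auto simp: power2_eq_square)
  also have "(2 * nu + 28) / ((nu - 2) * (nu - 4)) * ?m \<le> 24 / nu * abs_mom b 4"
  proof (intro mult_mono shift_power_le_abs_mom d)
    have "(nu / 2) * (nu / 2) \<le> (nu - 2) * (nu - 4)" using nu by (intro mult_mono) auto
    then have "(2 * nu + 28) / ((nu - 2) * (nu - 4)) \<le> (6 * nu) / ((nu / 2) * (nu / 2))"
      using nu by (intro frac_le) auto
    then show "(2 * nu + 28) / ((nu - 2) * (nu - 4)) \<le> 24 / nu" using nu by simp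
  qed (use nu in \<open>auto intro!: integral_nonneg_AE\<close>)
  finally show "expectation (\<lambda>\<omega>. (V d \<omega> - (H \<omega> + d)\<^sup>2)\<^sup>2) \<le> (128 * abs_mom b 8 + 48 * abs_mom b 4) / nu"
    by (simp add: add_divide_distrib)
qed

end

section \<open>Strong mixing\<close>

lemma card_nat_le_real:
  assumes "0 \<le> x" "x \<le> real n"
  shows "card {i\<in>{1..n}. real i \<le> x} = nat \<lfloor>x\<rfloor>"
proof -
  have "{i\<in>{1..n}. real i \<le> x} = {1..nat \<lfloor>x\<rfloor>}"
    using assms by (auto simp: le_nat_floor) linarith+
  then show ?thesis by simp
qed

context prob_space
begin

text \<open>
  The layer-cake decomposition of \<open>f\<close> and \<open>g\<close> into averages of \<open>n\<close> level-set indicators reduces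
  the inequality to events, up to an error \<open>4 / n\<close>.
\<close>

lemma cov_unit_bound:
  assumes F: "subalgebra M F" and G: "subalgebra M G"
    and mix: "\<And>A B. A \<in> sets F \<Longrightarrow> B \<in> sets G \<Longrightarrow> \<bar>prob (A \<inter> B) - prob A * prob B\<bar> \<le> a"
    and f: "f \<in> borel_measurable F" and g: "g \<in> borel_measurable G"
    and f01: "\<And>x. x \<in> space M \<Longrightarrow> 0 \<le> f x \<and> f x \<le> 1" and g01: "\<And>x. x \<in> space M \<Longrightarrow> 0 \<le> g x \<and> g x \<le> (1::real)"
  shows "\<bar>expectation (\<lambda>x. f x * g x) - expectation f * expectation g\<bar> \<le> a"
proof -
  have spF: "space F = space M" "space G = space M" using F G by (auto simp: subalgebra_def)
  have fM[measurable]: "f \<in> borel_measurable M" by (rule measurable_from_subalg[OF F f])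
  have gM[measurable]: "g \<in> borel_measurable M" by (rule measurable_from_subalg[OF G g])
  have bd: "\<bar>expectation (\<lambda>x. f x * g x) - expectation f * expectation g\<bar> \<le> a + 4 / real n" if n: "n > 0" for n
  proof -
    define L where "L h x = (\<Sum>i=1..n. indicator {x\<in>space M. real i \<le> real n * h x} x) / real n" for h :: "'a \<Rightarrow> real" and x :: 'a
    have L: "h x - 1 / real n \<le> L h x \<and> L h x \<le> h x \<and> 0 \<le> L h x" if "0 \<le> h x" "h x \<le> 1" "x \<in> space M" for h x
    proof -
      have "(\<Sum>i=1..n. indicator {x\<in>space M. real i \<le> real n * h x} x) = real (card {i\<in>{1..n}. real i \<le> real n * h x})"
        using that(3) by (simp add: indicator_def sum.If_cases Int_def)
      also have "\<dots> = real (nat \<lfloor>real n * h x\<rfloor>)"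
        by (subst card_nat_le_real) (use that n in \<open>auto simp: mult_le_cancel_left1\<close>)
      also have "\<dots> = real_of_int \<lfloor>real n * h x\<rfloor>" using that by simp
      finally have "L h x = real_of_int \<lfloor>real n * h x\<rfloor> / real n" by (simp add: L_def)
      moreover have "(real n * h x - 1) / real n \<le> real_of_int \<lfloor>real n * h x\<rfloor> / real n"
        by (intro divide_right_mono) linarith+
      moreover have "real_of_int \<lfloor>real n * h x\<rfloor> / real n \<le> real n * h x / real n"
        by (intro divide_right_mono) auto
      ultimately show ?thesis using n that by (simp add: diff_divide_distrib)
    qed
    have Lm[measurable]: "L h \<in> borel_measurable M" if [measurable]: "h \<in> borel_measurable M" for h
      unfolding L_def by measurable
    have ib: "integrable M h" if "h \<in> borel_measurable M" "\<And>x. x \<in> space M \<Longrightarrow> \<bar>h x\<bar> \<le> 1" for h :: "'a \<Rightarrow> real"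
      using that by (intro integrable_const_bound[where B=1]) auto
    have dE: "\<bar>expectation h - expectation k\<bar> \<le> c"
      if "integrable M h" "integrable M k" "\<And>x. x \<in> space M \<Longrightarrow> \<bar>h x - k x\<bar> \<le> c" for h k :: "'a \<Rightarrow> real" and c
    proof -
      have "\<bar>expectation h - expectation k\<bar> = \<bar>expectation (\<lambda>x. h x - k x)\<bar>" using that by simp
      also have "\<dots> \<le> expectation (\<lambda>x. \<bar>h x - k x\<bar>)" by (rule integral_abs_bound)
      also have "\<dots> \<le> expectation (\<lambda>x. c)" using that by (intro integral_mono_AE) auto
      finally show ?thesis using prob_space by simp
    qed
    have u: "\<bar>x * y - x' * y'\<bar> \<le> 2 / real n"
      if "0 \<le> x" "x \<le> 1" "0 \<le> y'" "y' \<le> 1" "\<bar>x - x'\<bar> \<le> 1 / real n" "\<bar>y - y'\<bar> \<le> 1 / real n" for x y x' y' :: real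
    proof -
      have "x * y - x' * y' = x * (y - y') + (x - x') * y'" by (simp add: algebra_simps)
      moreover have "\<bar>x * (y - y')\<bar> \<le> 1 * (1 / real n)" unfolding abs_mult using that by (intro mult_mono) auto
      moreover have "\<bar>(x - x') * y'\<bar> \<le> (1 / real n) * 1" unfolding abs_mult using that by (intro mult_mono) auto
      ultimately show ?thesis by linarith
    qed
    have Lf: "\<bar>f x - L f x\<bar> \<le> 1 / real n \<and> 0 \<le> L f x \<and> L f x \<le> 1" if "x \<in> space M" for x using L[of f x] f01[OF that] that by auto
    have Lg: "\<bar>g x - L g x\<bar> \<le> 1 / real n \<and> 0 \<le> L g x \<and> L g x \<le> 1" if "x \<in> space M" for x using L[of g x] g01[OF that] that by auto
    have e01: "0 \<le> expectation h \<and> expectation h \<le> 1"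
      if "h \<in> borel_measurable M" "\<And>x. x \<in> space M \<Longrightarrow> 0 \<le> h x \<and> h x \<le> 1" for h :: "'a \<Rightarrow> real"
    proof -
      have "expectation h \<le> expectation (\<lambda>x. 1)" using that by (intro integral_mono_AE ib) auto
      moreover have "0 \<le> expectation h" using that by (intro integral_nonneg_AE) auto
      ultimately show ?thesis using prob_space by simp
    qed
    have 1: "\<bar>expectation (\<lambda>x. f x * g x) - expectation (\<lambda>x. L f x * L g x)\<bar> \<le> 2 / real n"
    proof (rule dE)
      have m: "\<bar>x * y\<bar> \<le> 1" if "0 \<le> x" "x \<le> 1" "0 \<le> y" "y \<le> 1" for x y :: real
        using that mult_le_one[of x y] by (simp add: abs_mult)
      show "integrable M (\<lambda>x. f x * g x)" by (rule ib) (measurable, use f01 g01 in \<open>blast intro: m\<close>)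
      show "integrable M (\<lambda>x. L f x * L g x)" by (rule ib) (measurable, use Lf Lg in \<open>blast intro: m\<close>)
      show "\<bar>f x * g x - L f x * L g x\<bar> \<le> 2 / real n" if "x \<in> space M" for x
        using f01[OF that] Lf[OF that] Lg[OF that] by (intro u) auto
    qed
    have 2: "\<bar>expectation f * expectation g - expectation (L f) * expectation (L g)\<bar> \<le> 2 / real n"
    proof (rule u)
      have i: "integrable M f" "integrable M g" "integrable M (L f)" "integrable M (L g)"
        by (rule ib; use f01 g01 Lf Lg in force)+
      show "0 \<le> expectation f" "expectation f \<le> 1" using e01[OF fM f01] by auto
      show "0 \<le> expectation (L g)" "expectation (L g) \<le> 1" using e01[OF Lm[OF gM]] Lg by auto
      show "\<bar>expectation f - expectation (L f)\<bar> \<le> 1 / real n" by (rule dE[OF i(1,3)]) (use Lf in auto)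
      show "\<bar>expectation g - expectation (L g)\<bar> \<le> 1 / real n" by (rule dE[OF i(2,4)]) (use Lg in auto)
    qed
    define A where "A i = {x\<in>space M. real i \<le> real n * f x}" for i
    define B where "B i = {x\<in>space M. real i \<le> real n * g x}" for i
    have AF: "A i \<in> sets F" for i
      using f unfolding A_def spF(1)[symmetric] by measurable
    have BG: "B i \<in> sets G" for i
      using g unfolding B_def spF(2)[symmetric] by measurable
    have AM[measurable]: "A i \<in> sets M" for i unfolding A_def by measurable
    have BM[measurable]: "B i \<in> sets M" for i unfolding B_def by measurable
    have L2: "L f x * L g x = (\<Sum>i=1..n. \<Sum>j=1..n. indicator (A i \<inter> B j) x) / (real n)\<^sup>2" for x
      by (simp only: L_def A_def[symmetric] B_def[symmetric] times_divide_times_eq sum_product indicator_inter_arith power2_eq_square)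
    have "expectation (\<lambda>x. L f x * L g x) = (\<Sum>i=1..n. \<Sum>j=1..n. prob (A i \<inter> B j)) / (real n)\<^sup>2"
      unfolding L2 by (simp add: Bochner_Integration.integral_sum Bochner_Integration.integrable_sum emeasure_eq_measure)
    moreover have "expectation (L f) = (\<Sum>i=1..n. prob (A i)) / real n" "expectation (L g) = (\<Sum>i=1..n. prob (B i)) / real n"
      unfolding L_def A_def[symmetric] B_def[symmetric]
      by (simp_all add: Bochner_Integration.integral_sum emeasure_eq_measure)
    ultimately have "\<bar>expectation (\<lambda>x. L f x * L g x) - expectation (L f) * expectation (L g)\<bar>
        = \<bar>(\<Sum>i=1..n. \<Sum>j=1..n. prob (A i \<inter> B j) - prob (A i) * prob (B j)) / (real n)\<^sup>2\<bar>"
      by (simp add: sum_product sum_subtractf diff_divide_distrib power2_eq_square)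
    also have "\<dots> \<le> (\<Sum>i=1..n. \<Sum>j=1..n. a) / (real n)\<^sup>2"
    proof -
      have "\<bar>\<Sum>i=1..n. \<Sum>j=1..n. prob (A i \<inter> B j) - prob (A i) * prob (B j)\<bar> \<le> (\<Sum>i=1..n. \<Sum>j=1..n. a)"
        by (intro order_trans[OF sum_abs] sum_mono order_trans[OF sum_abs] mix AF BG)
      then show ?thesis using n by (simp add: divide_right_mono)
    qed
    also have "\<dots> = a" using n by (simp add: power2_eq_square)
    finally have "\<bar>expectation (\<lambda>x. L f x * L g x) - expectation (L f) * expectation (L g)\<bar> \<le> a" .
    moreover have "4 / real n = 2 / real n + 2 / real n" by simp
    ultimately show ?thesis using 1 2 by linarith
  qed
  have lim: "(\<lambda>n. a + 4 / real n) \<longlonglongrightarrow> a + 0"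
    by (intro tendsto_intros lim_const_over_n)
  have "\<exists>N. \<forall>n\<ge>N. \<bar>expectation (\<lambda>x. f x * g x) - expectation f * expectation g\<bar> \<le> a + 4 / real n"
    using bd by (intro exI[of _ 1]) simp
  from LIMSEQ_le_const[OF lim this] show ?thesis by simp
qed

text \<open>Affine rescaling of [-A, A] and [-B, B] to the unit interval; the constant is the
  product of the two interval lengths.\<close>

lemma cov_bounded:
  fixes f g :: "'a \<Rightarrow> real"
  assumes F: "subalgebra M F" and G: "subalgebra M G"
    and mix: "\<And>A B. A \<in> sets F \<Longrightarrow> B \<in> sets G \<Longrightarrow> \<bar>prob (A \<inter> B) - prob A * prob B\<bar> \<le> a"
    and f: "f \<in> borel_measurable F" and g: "g \<in> borel_measurable G"
    and fA: "\<And>x. x \<in> space M \<Longrightarrow> \<bar>f x\<bar> \<le> A" and gB: "\<And>x. x \<in> space M \<Longrightarrow> \<bar>g x\<bar> \<le> B"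
    and AB: "A > 0" "B > 0"
  shows "\<bar>expectation (\<lambda>x. f x * g x) - expectation f * expectation g\<bar> \<le> 4 * A * B * a"
proof -
  have fM[measurable]: "f \<in> borel_measurable M" by (rule measurable_from_subalg[OF F f])
  have gM[measurable]: "g \<in> borel_measurable M" by (rule measurable_from_subalg[OF G g])
  have i[simp]: "integrable M f" "integrable M g"
    using fA gB by (auto intro: integrable_const_bound[where B=A] integrable_const_bound[where B=B])
  have ifg[simp]: "integrable M (\<lambda>x. f x * g x)"
    using fA gB AB by (intro integrable_const_bound[where B="A * B"]) (auto simp: abs_mult intro!: mult_mono)
  define f' where "f' x = (f x + A) / (2 * A)" for x
  define g' where "g' x = (g x + B) / (2 * B)" for x
  have "\<bar>expectation (\<lambda>x. f' x * g' x) - expectation f' * expectation g'\<bar> \<le> a"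
  proof (rule cov_unit_bound[OF F G mix])
    show "f' \<in> borel_measurable F" unfolding f'_def using f by measurable
    show "g' \<in> borel_measurable G" unfolding g'_def using g by measurable
    fix x assume x: "x \<in> space M"
    show "0 \<le> f' x \<and> f' x \<le> 1" using fA[OF x] AB by (simp add: f'_def abs_le_iff)
    show "0 \<le> g' x \<and> g' x \<le> 1" using gB[OF x] AB by (simp add: g'_def abs_le_iff)
  qed auto
  moreover have "expectation (\<lambda>x. f' x * g' x) - expectation f' * expectation g'
     = (expectation (\<lambda>x. f x * g x) - expectation f * expectation g) / (4 * A * B)"
  proof -
    have "f' x * g' x = (f x * g x + B * f x + A * g x + A * B) / (4 * A * B)" for x
      unfolding f'_def g'_def by (simp add: algebra_simps)
    then have e1: "expectation (\<lambda>x. f' x * g' x) = (expectation (\<lambda>x. f x * g x) + B * expectation f + A * expectation g + A * B) / (4 * A * B)"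
      using prob_space by simp
    have e2: "expectation f' = (expectation f + A) / (2 * A)" "expectation g' = (expectation g + B) / (2 * B)"
      unfolding f'_def g'_def using prob_space by simp_all
    have "(x + B * y + A * z + A * B) / (4 * A * B) - (y + A) / (2 * A) * ((z + B) / (2 * B)) = (x - y * z) / (4 * A * B)" for x y z :: real
    proof -
      have "(y + A) / (2 * A) * ((z + B) / (2 * B)) = ((y + A) * (z + B)) / (4 * A * B)" by simp
      moreover have "(x + B * y + A * z + A * B) - (y + A) * (z + B) = x - y * z" by (simp add: algebra_simps)
      ultimately show ?thesis by (metis diff_divide_distrib)
    qed
    then show ?thesis unfolding e1 e2 .
  qed
  ultimately have "\<bar>expectation (\<lambda>x. f x * g x) - expectation f * expectation g\<bar> / (4 * A * B) \<le> a"
    using AB by (simp add: abs_mult)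
  then show ?thesis using AB by (subst (asm) pos_divide_le_eq) (auto simp: mult.commute)
qed

text \<open>Real and imaginary part are handled separately, each with bound 4 B a. Since
  \<open>f\<close> enters only through its cosine and sine, it may be unbounded, as partial sums
  are.\<close>

lemma cov_iexp_bounded:
  fixes f g :: "'a \<Rightarrow> real"
  assumes F: "subalgebra M F" and G: "subalgebra M G"
    and mix: "\<And>A B. A \<in> sets F \<Longrightarrow> B \<in> sets G \<Longrightarrow> \<bar>prob (A \<inter> B) - prob A * prob B\<bar> \<le> a"
    and f: "f \<in> borel_measurable F" and g: "g \<in> borel_measurable G"
    and gB: "\<And>x. x \<in> space M \<Longrightarrow> \<bar>g x\<bar> \<le> B" and B: "B > 0"
  shows "cmod (expectation (\<lambda>x. iexp (f x) * complex_of_real (g x)) - expectation (\<lambda>x. iexp (f x)) * expectation (\<lambda>x. complex_of_real (g x))) \<le> 8 * B * a"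
proof -
  have fM[measurable]: "f \<in> borel_measurable M" by (rule measurable_from_subalg[OF F f])
  have gM[measurable]: "g \<in> borel_measurable M" by (rule measurable_from_subalg[OF G g])
  have i1: "integrable M (\<lambda>x. iexp (f x))" by (intro integrable_const_bound[where B=1]) auto
  have i2: "integrable M (\<lambda>x. iexp (f x) * complex_of_real (g x))"
    using gB by (intro integrable_const_bound[where B=B]) (auto simp: norm_mult)
  have e: "Re (iexp y) = cos y" "Im (iexp y) = sin y" for y
    by (simp_all add: Re_exp Im_exp)
  define D where "D = expectation (\<lambda>x. iexp (f x) * complex_of_real (g x)) - expectation (\<lambda>x. iexp (f x)) * expectation (\<lambda>x. complex_of_real (g x))"
  have "Re D = expectation (\<lambda>x. cos (f x) * g x) - expectation (\<lambda>x. cos (f x)) * expectation g"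
    using i1 i2 by (simp add: D_def e flip: integral_Re)
  moreover have "Im D = expectation (\<lambda>x. sin (f x) * g x) - expectation (\<lambda>x. sin (f x)) * expectation g"
    using i1 i2 by (simp add: D_def e flip: integral_Im)
  moreover have "\<bar>expectation (\<lambda>x. cos (f x) * g x) - expectation (\<lambda>x. cos (f x)) * expectation g\<bar> \<le> 4 * 1 * B * a"
    by (rule cov_bounded[OF F G mix]) (use f g gB B in auto)
  moreover have "\<bar>expectation (\<lambda>x. sin (f x) * g x) - expectation (\<lambda>x. sin (f x)) * expectation g\<bar> \<le> 4 * 1 * B * a"
    by (rule cov_bounded[OF F G mix]) (use f g gB B in auto)
  ultimately have "cmod D \<le> 4 * 1 * B * a + 4 * 1 * B * a"
    using cmod_le[of D] by linarith
  then show ?thesis by (simp add: D_def)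
qed

end

section \<open>Taylor bounds for the complex exponential, and sigma-algebras of blocks\<close>

lemma iexp_bound1: "cmod (iexp x - 1) \<le> \<bar>x\<bar>"
  using iexp_approx1[of x 0] by simp

lemma iexp_bound2: "cmod (iexp x - (1 + \<i> * x)) \<le> x\<^sup>2 / 2"
  using iexp_approx1[of x 1] by (simp add: power2_eq_square)

lemma iexp_bound3: "cmod (iexp x - (1 + \<i> * x - x\<^sup>2 / 2)) \<le> \<bar>x\<bar> ^ 3 / 6"
proof -
  have "(\<Sum>k\<le>2. (\<i> * complex_of_real x) ^ k / fact k) = 1 + \<i> * x - x\<^sup>2 / 2"
    by (simp add: numeral_2_eq_2 power_mult_distrib)
  moreover have "Suc 2 = 3" "(fact 3 :: real) = 6" by (simp_all add: fact_numeral)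
  ultimately show ?thesis using iexp_approx1[of x 2] by metis
qed

text \<open>The family \<open>gen_sigma\<close> packaged as a measure, so that measurability of a
  function with respect to it can be expressed; only its space and sets matter.\<close>

definition block_algebra :: "'a measure \<Rightarrow> (nat \<Rightarrow> 'a \<Rightarrow> real) \<Rightarrow> nat \<Rightarrow> nat \<Rightarrow> 'a measure" where
  "block_algebra M V a b = sigma (space M) {V j -` B \<inter> space M | j B. j \<in> {a..b} \<and> B \<in> sets borel}"

lemma sets_block_algebra: "sets (block_algebra M V a b) = gen_sigma M V a b"
  unfolding block_algebra_def gen_sigma_def by (rule sets_measure_of) auto

lemma space_block_algebra: "space (block_algebra M V a b) = space M"
  unfolding block_algebra_def by (rule space_measure_of) auto

lemma measurable_block_algebra:
  assumes "j \<in> {a..b}"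
  shows "V j \<in> borel_measurable (block_algebra M V a b)"
proof (rule measurableI)
  fix B :: "real set" assume "B \<in> sets borel"
  then show "V j -` B \<inter> space (block_algebra M V a b) \<in> sets (block_algebra M V a b)"
    unfolding sets_block_algebra space_block_algebra gen_sigma_def
    using assms by (intro sigma_sets.Basic) auto
qed simp

lemma subalgebra_block_algebra:
  assumes "\<And>j. j \<in> {a..b} \<Longrightarrow> V j \<in> borel_measurable M"
  shows "subalgebra M (block_algebra M V a b)"
  unfolding subalgebra_def space_block_algebra sets_block_algebra gen_sigma_def
  using assms by (auto intro!: sets.sigma_sets_subset measurable_sets)

text \<open>Through this inclusion, truncated and centered coordinates inherit the mixing
  coefficients of the original ones.\<close>

lemma gen_sigma_compose:
  assumes "\<And>j. h j \<in> borel_measurable borel"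
  shows "gen_sigma M (\<lambda>j \<omega>. h j (V j \<omega>)) a b \<subseteq> gen_sigma M V a b"
  unfolding gen_sigma_def
proof (rule sigma_sets_mono')
  show "{(\<lambda>\<omega>. h j (V j \<omega>)) -` B \<inter> space M |j B. j \<in> {a..b} \<and> B \<in> sets borel}
      \<subseteq> {V j -` B \<inter> space M |j B. j \<in> {a..b} \<and> B \<in> sets borel}"
  proof safe
    fix j and B :: "real set" assume "j \<in> {a..b}" "B \<in> sets borel"
    moreover have "h j -` B \<in> sets borel" using measurable_sets[OF assms[of j] \<open>B \<in> sets borel\<close>] by simp
    moreover have "(\<lambda>\<omega>. h j (V j \<omega>)) -` B \<inter> space M = V j -` (h j -` B) \<inter> space M" by auto
    ultimately show "\<exists>ja Ba. (\<lambda>\<omega>. h j (V j \<omega>)) -` B \<inter> space M = V ja -` Ba \<inter> space M \<and> ja \<in> {a..b} \<and> Ba \<in> sets borel"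
      by blast
  qed
qed

text \<open>Appending a summand costs its second moment and twice its products with the earlier
  summands, which depend only on the lag. Bounding by a fixed number L of lags makes every increment
  the same, hence the bound linear in n.\<close>

lemma (in prob_space) second_moment_sum:
  fixes X :: "nat \<Rightarrow> 'a \<Rightarrow> real"
  assumes int: "\<And>i j. i \<in> {s<..s+n} \<Longrightarrow> j \<in> {s<..s+n} \<Longrightarrow> integrable M (\<lambda>\<omega>. X i \<omega> * X j \<omega>)"
    and cov: "\<And>i k. s < i \<Longrightarrow> i + k \<le> s + n \<Longrightarrow> expectation (\<lambda>\<omega>. X i \<omega> * X (i + k) \<omega>) = b k"
    and n: "n \<le> Suc L"
  shows "expectation (\<lambda>\<omega>. (\<Sum>i\<in>{s<..s+n}. X i \<omega>)\<^sup>2) \<le> real n * (b 0 + 2 * (\<Sum>k=1..L. \<bar>b k\<bar>))"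
  using assms
proof (induction n)
  case 0
  then show ?case by simp
next
  case (Suc n)
  let ?S = "\<lambda>\<omega>. \<Sum>i\<in>{s<..s+n}. X i \<omega>"
  let ?Y = "X (s + Suc n)"
  have intS: "integrable M (\<lambda>\<omega>. (?S \<omega>)\<^sup>2)"
    unfolding power2_eq_square sum_product
    by (intro Bochner_Integration.integrable_sum Suc.prems(1)) auto
  have intSY: "integrable M (\<lambda>\<omega>. ?S \<omega> * ?Y \<omega>)"
    unfolding sum_distrib_right
    by (intro Bochner_Integration.integrable_sum Suc.prems(1)) auto
  have intY: "integrable M (\<lambda>\<omega>. ?Y \<omega> * ?Y \<omega>)"
    by (rule Suc.prems(1)) auto
  have set: "{s<..s + Suc n} = insert (s + Suc n) {s<..s+n}" by auto
  have e: "(\<Sum>i\<in>{s<..s+Suc n}. X i \<omega>)\<^sup>2 = (?S \<omega>)\<^sup>2 + 2 * (?S \<omega> * ?Y \<omega>) + ?Y \<omega> * ?Y \<omega>" for \<omega>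
    unfolding set by (simp add: power2_eq_square algebra_simps)
  have "expectation (\<lambda>\<omega>. ?S \<omega> * ?Y \<omega>) = (\<Sum>i\<in>{s<..s+n}. expectation (\<lambda>\<omega>. X i \<omega> * ?Y \<omega>))"
    unfolding sum_distrib_right
    by (intro Bochner_Integration.integral_sum Suc.prems(1)) auto
  also have "\<dots> = (\<Sum>i\<in>{s<..s+n}. b (s + Suc n - i))"
  proof (intro sum.cong refl)
    fix i assume "i \<in> {s<..s+n}"
    then show "expectation (\<lambda>\<omega>. X i \<omega> * ?Y \<omega>) = b (s + Suc n - i)"
      using Suc.prems(2)[of i "s + Suc n - i"] by simp
  qed
  also have "\<dots> = (\<Sum>k=1..n. b k)"
    by (rule sum.reindex_bij_witness[of _ "\<lambda>k. s + Suc n - k" "\<lambda>i. s + Suc n - i"]) auto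
  also have "\<dots> \<le> (\<Sum>k=1..n. \<bar>b k\<bar>)" by (intro sum_mono) auto
  also have "\<dots> \<le> (\<Sum>k=1..L. \<bar>b k\<bar>)" using Suc.prems(3) by (intro sum_mono2) auto
  finally have 1: "expectation (\<lambda>\<omega>. ?S \<omega> * ?Y \<omega>) \<le> (\<Sum>k=1..L. \<bar>b k\<bar>)" .
  have 2: "expectation (\<lambda>\<omega>. ?Y \<omega> * ?Y \<omega>) = b 0" using Suc.prems(2)[of "s + Suc n" 0] by simp
  have 3: "expectation (\<lambda>\<omega>. (?S \<omega>)\<^sup>2) \<le> real n * (b 0 + 2 * (\<Sum>k=1..L. \<bar>b k\<bar>))"
    using Suc.prems by (intro Suc.IH) auto
  show ?case
    unfolding e using 1 2 3 intS intSY intY by (simp add: algebra_simps)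
qed

section \<open>Characteristic functions of sums of bounded mixing variables\<close>

locale mixing_seq = prob_space +
  fixes X :: "nat \<Rightarrow> 'a \<Rightarrow> real" and p :: nat and a :: "nat \<Rightarrow> real"
  assumes X_meas: "\<And>j. j \<in> {1..p} \<Longrightarrow> X j \<in> borel_measurable M"
    and mixing: "\<And>k r A B. 1 \<le> k \<Longrightarrow> 1 \<le> r \<Longrightarrow> k + r \<le> p \<Longrightarrow> A \<in> gen_sigma M X 1 k \<Longrightarrow> B \<in> gen_sigma M X (k + r) p
       \<Longrightarrow> \<bar>prob (A \<inter> B) - prob A * prob B\<bar> \<le> a r"
begin

lemma subalgebra_past: "k \<le> p \<Longrightarrow> subalgebra M (block_algebra M X 1 k)"
  by (rule subalgebra_block_algebra, rule X_meas) auto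

lemma subalgebra_future: "1 \<le> k \<Longrightarrow> subalgebra M (block_algebra M X k p)"
  by (rule subalgebra_block_algebra, rule X_meas) auto

lemma mixing_cov:
  assumes "1 \<le> k" "1 \<le> r" "k + r \<le> p"
    and "f \<in> borel_measurable (block_algebra M X 1 k)" "g \<in> borel_measurable (block_algebra M X (k + r) p)"
    and "\<And>x. x \<in> space M \<Longrightarrow> \<bar>f x\<bar> \<le> A" "\<And>x. x \<in> space M \<Longrightarrow> \<bar>g x\<bar> \<le> B" "A > 0" "B > 0"
  shows "\<bar>expectation (\<lambda>x. f x * g x) - expectation f * expectation g\<bar> \<le> 4 * A * B * a r"
  by (rule cov_bounded[OF subalgebra_past subalgebra_future])
     (use assms mixing[OF assms(1-3)] in \<open>auto simp: sets_block_algebra\<close>)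

lemma mixing_cov_iexp:
  assumes "1 \<le> k" "1 \<le> r" "k + r \<le> p"
    and "f \<in> borel_measurable (block_algebra M X 1 k)" "g \<in> borel_measurable (block_algebra M X (k + r) p)"
    and "\<And>x. x \<in> space M \<Longrightarrow> \<bar>g x\<bar> \<le> B" "B > 0"
  shows "cmod (expectation (\<lambda>x. iexp (f x) * complex_of_real (g x)) - expectation (\<lambda>x. iexp (f x)) * complex_of_real (expectation g)) \<le> 8 * B * a r"
proof -
  have "cmod (expectation (\<lambda>x. iexp (f x) * complex_of_real (g x)) - expectation (\<lambda>x. iexp (f x)) * expectation (\<lambda>x. complex_of_real (g x))) \<le> 8 * B * a r"
    by (rule cov_iexp_bounded[OF subalgebra_past subalgebra_future])
       (use assms mixing[OF assms(1-3)] in \<open>auto simp: sets_block_algebra\<close>)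
  then show ?thesis by (simp add: integral_complex_of_real)
qed

end

text \<open>The position-free autocovariance \<open>b\<close> is the only trace of stationarity
  here. Taking K at least 1 allows lower powers of K to be absorbed into its fourth power.\<close>

locale bounded_mixing = mixing_seq +
  fixes K :: real and b :: "nat \<Rightarrow> real"
  assumes K: "K \<ge> 1"
    and bound: "\<And>j \<omega>. j \<in> {1..p} \<Longrightarrow> \<omega> \<in> space M \<Longrightarrow> \<bar>X j \<omega>\<bar> \<le> K"
    and centered: "\<And>j. j \<in> {1..p} \<Longrightarrow> expectation (X j) = 0"
    and autocov: "\<And>j k. 1 \<le> j \<Longrightarrow> j + k \<le> p \<Longrightarrow> expectation (\<lambda>\<omega>. X j \<omega> * X (j + k) \<omega>) = b k"
begin

lemma autocov_bound:
  assumes "1 \<le> k" "k < p"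
  shows "\<bar>b k\<bar> \<le> 4 * K\<^sup>2 * a k"
proof -
  have "\<bar>expectation (\<lambda>\<omega>. X 1 \<omega> * X (1 + k) \<omega>) - expectation (X 1) * expectation (X (1 + k))\<bar> \<le> 4 * K * K * a k"
    by (rule mixing_cov[of 1 k]; (rule measurable_block_algebra)?; use assms bound K in simp)
  then show ?thesis using autocov[of 1 k] centered assms by (simp add: power2_eq_square)
qed

lemma autocov_0: "1 \<le> p \<Longrightarrow> 0 \<le> b 0 \<and> b 0 \<le> K\<^sup>2"
proof
  assume p: "1 \<le> p"
  have b0: "expectation (\<lambda>\<omega>. X 1 \<omega> * X 1 \<omega>) = b 0" using autocov[of 1 0] p by simp
  show "0 \<le> b 0" unfolding b0[symmetric] by (rule integral_nonneg_AE) auto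
  have [measurable]: "X (Suc 0) \<in> borel_measurable M" using X_meas p by auto
  have sq: "X 1 \<omega> * X 1 \<omega> \<le> K\<^sup>2" if "\<omega> \<in> space M" for \<omega>
    using bound[of 1 \<omega>] that p K by (metis abs_le_square_iff abs_of_nonneg atLeastAtMost_iff order_refl power2_eq_square zero_le_one order_trans)
  have "b 0 \<le> expectation (\<lambda>\<omega>. K\<^sup>2)"
    unfolding b0[symmetric] by (rule integral_mono_AE) (use sq in \<open>auto intro!: integrable_const_bound[where B="K\<^sup>2"]\<close>)
  then show "b 0 \<le> K\<^sup>2" using prob_space by simp
qed

definition T :: "nat \<Rightarrow> 'a \<Rightarrow> real" where
  "T n \<omega> = (\<Sum>i=1..n. X i \<omega>)"

lemma T_past: "n \<le> k \<Longrightarrow> T n \<in> borel_measurable (block_algebra M X 1 k)"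
  unfolding T_def by (intro borel_measurable_sum measurable_block_algebra) auto

lemma T_meas: "n \<le> p \<Longrightarrow> T n \<in> borel_measurable M"
  unfolding T_def by (intro borel_measurable_sum X_meas) auto

lemma T_diff: "T (s + n) \<omega> - T s \<omega> = (\<Sum>i\<in>{s<..s+n}. X i \<omega>)"
proof -
  have "{1..s+n} = {1..s} \<union> {s<..s+n}" by auto
  then show ?thesis unfolding T_def by (simp add: sum.union_disjoint ivl_disj_int)
qed

lemma abs_T_diff_le:
  assumes "s + n \<le> p" "\<omega> \<in> space M"
  shows "\<bar>T (s + n) \<omega> - T s \<omega>\<bar> \<le> real n * K"
proof -
  have "\<bar>T (s + n) \<omega> - T s \<omega>\<bar> \<le> (\<Sum>i\<in>{s<..s+n}. K)"
    unfolding T_diff by (rule order_trans[OF sum_abs sum_mono]) (use assms bound in auto)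
  then show ?thesis by simp
qed

lemma T_diff_second_moment:
  assumes "s + n \<le> p" "n \<le> Suc L"
  shows "expectation (\<lambda>\<omega>. (T (s + n) \<omega> - T s \<omega>)\<^sup>2) \<le> real n * (b 0 + 2 * (\<Sum>k=1..L. \<bar>b k\<bar>))"
  unfolding T_diff
proof (rule second_moment_sum[OF _ _ assms(2)])
  fix i j assume ij: "i \<in> {s<..s + n}" "j \<in> {s<..s + n}"
  then have [measurable]: "X i \<in> borel_measurable M" "X j \<in> borel_measurable M" using assms X_meas by auto
  show "integrable M (\<lambda>\<omega>. X i \<omega> * X j \<omega>)"
    using ij assms bound K by (intro integrable_const_bound[where B="K * K"]) (auto simp: abs_mult intro!: mult_mono)
qed (use assms autocov in auto)

lemma integrable_bounded:
  fixes f :: "'a \<Rightarrow> complex"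
  shows "f \<in> borel_measurable M \<Longrightarrow> (\<And>\<omega>. \<omega> \<in> space M \<Longrightarrow> cmod (f \<omega>) \<le> B) \<Longrightarrow> integrable M f"
  by (rule integrable_const_bound[where B=B]) auto

text \<open>
  One Lindeberg step. The increment \<open>X (j + 1)\<close> is compared with the past \<open>T (j - l)\<close>; the
  quadratic term is in turn decoupled from \<open>T (j - 2 * l)\<close>, so that mixing is always used across
  a gap of \<open>l + 1\<close>.
\<close>

lemma char_step:
  assumes l: "1 \<le> l" and j: "2 * l + 1 \<le> j" "j + 1 \<le> p" and C: "1 \<le> C" "1 + 8 * (\<Sum>k=1..2*l. a k) \<le> C"
    and a_nonneg: "\<And>k. 1 \<le> k \<Longrightarrow> 0 \<le> a k"
  defines "s \<equiv> b 0 + 2 * (\<Sum>k=1..l. b k)"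
  shows "cmod (expectation (\<lambda>\<omega>. iexp (u * T (j + 1) \<omega>)) - complex_of_real (1 - u\<^sup>2 * s / 2) * expectation (\<lambda>\<omega>. iexp (u * T j \<omega>)))
    \<le> 7 * \<bar>u\<bar> ^ 3 * K ^ 4 * C\<^sup>2 * real l + (8 * \<bar>u\<bar> * K + 16 * u\<^sup>2 * real l * K\<^sup>2) * a (l + 1)"
proof -
  define Y where "Y = X (j + 1)"
  define A where "A \<omega> = T j \<omega> - T (j - l) \<omega>" for \<omega>
  define B where "B \<omega> = T (j - l) \<omega> - T (j - 2 * l) \<omega>" for \<omega>
  \<comment> \<open>The coefficient of -u^2 that remains when the factor of \<open>Y\<close> is
    expanded to second order and then, in the linear term, the factor of \<open>A\<close> to first
    order. Its mean is s / 2.\<close>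
  define G where "G \<omega> = Y \<omega> * A \<omega> + (Y \<omega>)\<^sup>2 / 2" for \<omega>
  define e where "e n \<omega> = iexp (u * T n \<omega>)" for n \<omega>
  define P where "P = j - l"
  define Q where "Q = j - 2 * l"
  define D where "D = K\<^sup>2 * C"
  have jl: "j - l + l = j" "j - 2 * l + l = j - l" using j by auto
  have [measurable]: "T j \<in> borel_measurable M" "T (j - l) \<in> borel_measurable M" "T (j - 2 * l) \<in> borel_measurable M"
    "Y \<in> borel_measurable M" "T (j + 1) \<in> borel_measurable M" "T P \<in> borel_measurable M" "T Q \<in> borel_measurable M"
    using j by (auto intro!: T_meas X_meas simp: Y_def P_def Q_def)
  have [measurable]: "A \<in> borel_measurable M" "B \<in> borel_measurable M" unfolding A_def B_def by measurable
  have [measurable]: "G \<in> borel_measurable M" unfolding G_def by measurable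
  have [measurable]: "e j \<in> borel_measurable M" "e P \<in> borel_measurable M" "e Q \<in> borel_measurable M"
    "e (j + 1) \<in> borel_measurable M"
    unfolding e_def by measurable
  have ne: "cmod (e n \<omega>) = 1" for n \<omega> by (simp add: e_def)
  have Yb: "\<bar>Y \<omega>\<bar> \<le> K" if "\<omega> \<in> space M" for \<omega> using bound that j by (simp add: Y_def)
  have Ab: "\<bar>A \<omega>\<bar> \<le> real l * K" if "\<omega> \<in> space M" for \<omega>
    using abs_T_diff_le[of "j - l" l \<omega>] that j by (simp add: A_def jl)
  have Bb: "\<bar>B \<omega>\<bar> \<le> real l * K" if "\<omega> \<in> space M" for \<omega>
    using abs_T_diff_le[of "j - 2 * l" l \<omega>] that j by (simp add: B_def jl)
  have Y2: "(Y \<omega>)\<^sup>2 \<le> K\<^sup>2" if "\<omega> \<in> space M" for \<omega>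
    using power_mono[OF Yb[OF that] abs_ge_zero, of 2] by simp
  have lK: "K * (real l * K) + K\<^sup>2 / 2 \<le> 2 * real l * K\<^sup>2"
  proof -
    have "1 * K\<^sup>2 \<le> real l * K\<^sup>2" using l by (intro mult_right_mono) auto
    moreover have "0 \<le> K\<^sup>2" by simp
    moreover have "K * (real l * K) = real l * K\<^sup>2" by (simp add: power2_eq_square)
    ultimately show ?thesis by linarith
  qed
  have Gb: "\<bar>G \<omega>\<bar> \<le> 2 * real l * K\<^sup>2" if "\<omega> \<in> space M" for \<omega>
  proof -
    have "\<bar>G \<omega>\<bar> \<le> \<bar>Y \<omega> * A \<omega>\<bar> + \<bar>(Y \<omega>)\<^sup>2 / 2\<bar>" unfolding G_def by (rule abs_triangle_ineq)
    also have "\<dots> \<le> K * (real l * K) + K\<^sup>2 / 2"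
      unfolding abs_mult using Yb[OF that] Ab[OF that] Y2[OF that] K by (intro add_mono mult_mono) auto
    finally show ?thesis using lK by simp
  qed
  have EY: "expectation Y = 0" using centered j by (simp add: Y_def)
  have EG: "expectation G = s / 2"
  proof -
    have Ge: "G = (\<lambda>\<omega>. (\<Sum>i\<in>{j-l<..j}. X i \<omega> * Y \<omega>) + (Y \<omega> * Y \<omega>) / 2)"
      using T_diff[of "j - l" l] by (simp add: fun_eq_iff G_def A_def jl power2_eq_square sum_distrib_left mult.commute)
    have i: "integrable M (\<lambda>\<omega>. X i \<omega> * Y \<omega>)" if "i \<in> {1..p}" for i
      using Yb bound[OF that] K X_meas[OF that] by (intro integrable_const_bound[where B="K * K"]) (auto simp: abs_mult intro!: mult_mono)
    have iYY: "integrable M (\<lambda>\<omega>. Y \<omega> * Y \<omega>)" using i[of "j + 1"] j by (simp add: Y_def)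
    have "expectation G = (\<Sum>i\<in>{j-l<..j}. expectation (\<lambda>\<omega>. X i \<omega> * Y \<omega>)) + expectation (\<lambda>\<omega>. Y \<omega> * Y \<omega>) / 2"
    proof -
      have ii: "integrable M (\<lambda>\<omega>. X i \<omega> * Y \<omega>)" if "i \<in> {j-l<..j}" for i using i that j by simp
      have "expectation G = expectation (\<lambda>\<omega>. \<Sum>i\<in>{j-l<..j}. X i \<omega> * Y \<omega>) + expectation (\<lambda>\<omega>. (Y \<omega> * Y \<omega>) / 2)"
        unfolding Ge by (rule Bochner_Integration.integral_add) (use ii iYY in \<open>auto intro!: Bochner_Integration.integrable_sum\<close>)
      then show ?thesis using ii by (simp add: Bochner_Integration.integral_sum)
    qed
    also have "expectation (\<lambda>\<omega>. Y \<omega> * Y \<omega>) = b 0" using autocov[of "j + 1" 0] j by (simp add: Y_def)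
    also have "(\<Sum>i\<in>{j-l<..j}. expectation (\<lambda>\<omega>. X i \<omega> * Y \<omega>)) = (\<Sum>i\<in>{j-l<..j}. b (j + 1 - i))"
      
    proof (intro sum.cong refl)
      fix i assume "i \<in> {j-l<..j}"
      then show "expectation (\<lambda>\<omega>. X i \<omega> * Y \<omega>) = b (j + 1 - i)"
        using autocov[of i "j + 1 - i"] j by (simp add: Y_def)
    qed
    also have "\<dots> = (\<Sum>k=1..l. b k)"
      by (rule sum.reindex_bij_witness[of _ "\<lambda>k. j + 1 - k" "\<lambda>i. j + 1 - i"]) (use j l in auto)
    finally show ?thesis by (simp add: s_def)
  qed
  have D: "b 0 + 2 * (\<Sum>k=1..2*l. \<bar>b k\<bar>) \<le> D"
  proof -
    have "(\<Sum>k=1..2*l. \<bar>b k\<bar>) \<le> (\<Sum>k=1..2*l. 4 * K\<^sup>2 * a k)"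
      using j by (intro sum_mono autocov_bound) auto
    also have "\<dots> = 4 * K\<^sup>2 * (\<Sum>k=1..2*l. a k)" by (simp add: sum_distrib_left)
    finally have "b 0 + 2 * (\<Sum>k=1..2*l. \<bar>b k\<bar>) \<le> K\<^sup>2 * (1 + 8 * (\<Sum>k=1..2*l. a k))"
      using autocov_0 j by (simp add: algebra_simps)
    also have "\<dots> \<le> D" unfolding D_def using C by (intro mult_left_mono) auto
    finally show ?thesis .
  qed
  have D0: "D \<ge> 1" unfolding D_def using K C by (metis mult_mono' one_le_power zero_le_one mult_1 )
  have sD: "\<bar>s\<bar> \<le> D"
  proof -
    have "\<bar>s\<bar> \<le> \<bar>b 0\<bar> + \<bar>2 * (\<Sum>k=1..l. b k)\<bar>" unfolding s_def by (rule abs_triangle_ineq)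
    also have "\<bar>2 * (\<Sum>k=1..l. b k)\<bar> \<le> 2 * (\<Sum>k=1..l. \<bar>b k\<bar>)" by (simp add: abs_mult)
    also have "(\<Sum>k=1..l. \<bar>b k\<bar>) \<le> (\<Sum>k=1..2*l. \<bar>b k\<bar>)" by (intro sum_mono2) auto
    finally show ?thesis using D autocov_0 j by auto
  qed
  have EA2: "expectation (\<lambda>\<omega>. (A \<omega>)\<^sup>2) \<le> real l * D"
    using T_diff_second_moment[of "j - l" l "2 * l"] j order_trans[OF _ mult_left_mono[OF D, of "real l"]] by (simp add: A_def jl)
  have EB2: "expectation (\<lambda>\<omega>. (B \<omega>)\<^sup>2) \<le> real l * D"
    using T_diff_second_moment[of "j - 2 * l" l "2 * l"] j order_trans[OF _ mult_left_mono[OF D, of "real l"]] by (simp add: B_def jl)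
  have iA: "integrable M (\<lambda>\<omega>. (A \<omega>)\<^sup>2)"
    using power_mono[OF Ab abs_ge_zero, of _ 2] by (intro integrable_const_bound[where B="(real l * K)\<^sup>2"]) auto
  have iB: "integrable M (\<lambda>\<omega>. (B \<omega>)\<^sup>2)"
    using power_mono[OF Bb abs_ge_zero, of _ 2] by (intro integrable_const_bound[where B="(real l * K)\<^sup>2"]) auto
  \<comment> \<open>What is left after removing the linear term, paired with the past up to P, and
    the centered quadratic term, paired with the past up to Q. The expectations of the removed terms
    are small by mixing, whereas \<open>R\<close> is small by Taylor expansion.\<close>
  define R where "R \<omega> = e (j + 1) \<omega> - (1 - u\<^sup>2 * s / 2) * e j \<omega>
      - (\<i> * u) * (e P \<omega> * Y \<omega>) + u\<^sup>2 * (e Q \<omega> * (G \<omega> - s / 2))" for \<omega>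
  have Rb: "cmod (R \<omega>) \<le> \<bar>u\<bar> ^ 3 * (K ^ 3 / 6 + K * (A \<omega>)\<^sup>2 / 2 + K\<^sup>2 * (1 + (A \<omega>)\<^sup>2) / 2
       + (K * ((A \<omega>)\<^sup>2 + (B \<omega>)\<^sup>2) / 2 + K\<^sup>2 * (1 + (B \<omega>)\<^sup>2) / 2) + D / 2 * (1 + 2 * (A \<omega>)\<^sup>2 + 2 * (B \<omega>)\<^sup>2))"
    if \<omega>: "\<omega> \<in> space M" for \<omega>
  proof -
    define y where "y = Y \<omega>"
    define x where "x = A \<omega>"
    define z where "z = B \<omega>"
    define g where "g = G \<omega>"
    have ej1: "e (j + 1) \<omega> = e j \<omega> * iexp (u * y)"
    proof -
      have "T (j + 1) \<omega> = T j \<omega> + y" by (simp add: T_def y_def Y_def)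
      then have "e (j + 1) \<omega> = iexp (u * (T j \<omega> + y))" unfolding e_def by (simp only:)
      also have "\<dots> = e j \<omega> * iexp (u * y)" by (simp add: e_def exp_add[symmetric] algebra_simps)
      finally show ?thesis .
    qed
    have ejP: "e j \<omega> = e P \<omega> * iexp (u * x)"
      by (simp add: e_def x_def A_def P_def exp_add[symmetric] algebra_simps)
    have ePQ: "e P \<omega> = e Q \<omega> * iexp (u * z)"
      by (simp add: e_def z_def B_def P_def Q_def exp_add[symmetric] algebra_simps)
    have ejQ: "e j \<omega> = e Q \<omega> * iexp (u * (x + z))"
      unfolding ejP ePQ by (simp add: exp_add[symmetric] algebra_simps)
    have g: "g = y * x + y\<^sup>2 / 2" by (simp add: g_def G_def y_def x_def)
    define r1 where "r1 = e j \<omega> * (iexp (u * y) - (1 + \<i> * (u * y) - (u * y)\<^sup>2 / 2))"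
    define r2 where "r2 = \<i> * (u * y) * (e P \<omega> * (iexp (u * x) - (1 + \<i> * (u * x))))"
    have dec: "R \<omega> = r1 + r2 + complex_of_real (- (u\<^sup>2 * y\<^sup>2 / 2)) * (e P \<omega> * (iexp (u * x) - 1))
        + complex_of_real (- (u\<^sup>2 * g)) * (e Q \<omega> * (iexp (u * z) - 1)) + complex_of_real (u\<^sup>2 * s / 2) * (e Q \<omega> * (iexp (u * (x + z)) - 1))"
    proof -
      have "R \<omega> = (e j \<omega> * iexp (u * y) - (1 - u\<^sup>2 * s / 2) * e j \<omega>) - \<i> * u * (e P \<omega> * y) + u\<^sup>2 * (e Q \<omega> * (g - s / 2))"
        unfolding R_def ej1 y_def g_def ..
      also have "\<dots> = r1 + \<i> * (u * y) * e j \<omega> - (u * y)\<^sup>2 / 2 * e j \<omega> + u\<^sup>2 * s / 2 * e j \<omega> - \<i> * u * (e P \<omega> * y) + u\<^sup>2 * (e Q \<omega> * (g - s / 2))"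
        by (simp add: r1_def algebra_simps)
      also have "\<i> * (u * y) * e j \<omega> = r2 + \<i> * u * (e P \<omega> * y) - u\<^sup>2 * (y * x) * e P \<omega>"
        unfolding ejP r2_def by (simp add: algebra_simps power2_eq_square)
      also have "(u * y)\<^sup>2 / 2 * e j \<omega> = (u\<^sup>2 * y\<^sup>2 / 2) * (e P \<omega> * (iexp (u * x) - 1)) + (u\<^sup>2 * y\<^sup>2 / 2) * e P \<omega>"
        unfolding ejP by (simp add: algebra_simps power2_eq_square)
      also have "u\<^sup>2 * s / 2 * e j \<omega> = (u\<^sup>2 * s / 2) * (e Q \<omega> * (iexp (u * (x + z)) - 1)) + (u\<^sup>2 * s / 2) * e Q \<omega>"
        unfolding ejQ by (simp add: algebra_simps)
      finally have "R \<omega> = r1 + r2 - (u\<^sup>2 * y\<^sup>2 / 2) * (e P \<omega> * (iexp (u * x) - 1)) + (u\<^sup>2 * s / 2) * (e Q \<omega> * (iexp (u * (x + z)) - 1))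
         - u\<^sup>2 * g * e P \<omega> + u\<^sup>2 * g * e Q \<omega>"
        unfolding g by (simp add: algebra_simps)
      also have "u\<^sup>2 * g * e P \<omega> = (u\<^sup>2 * g) * (e Q \<omega> * (iexp (u * z) - 1)) + u\<^sup>2 * g * e Q \<omega>"
        unfolding ePQ by (simp add: algebra_simps)
      finally show ?thesis by (simp add: algebra_simps)
    qed
    have yK: "\<bar>y\<bar> \<le> K" "y\<^sup>2 \<le> K\<^sup>2" using Yb[OF \<omega>] Y2[OF \<omega>] by (auto simp: y_def)
    \<comment> \<open>First powers of block sums are traded for squares because the second moment of
      a block grows only linearly in its length l, while the sup bound of its square grows like
      l^2.\<close>
    have abs1: "\<bar>t\<bar> \<le> 1 + t\<^sup>2" for t :: real
      
    proof -
      have "0 \<le> (\<bar>t\<bar> - 1)\<^sup>2 + t\<^sup>2" by simp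
      then have "2 * \<bar>t\<bar> \<le> 1 + 2 * t\<^sup>2" by (simp add: power2_diff)
      then show ?thesis by linarith
    qed
    have n1: "cmod r1 \<le> \<bar>u\<bar> ^ 3 * (K ^ 3 / 6)"
    proof -
      have "cmod r1 \<le> \<bar>u * y\<bar> ^ 3 / 6"
        using iexp_bound3[of "u * y"] by (simp add: r1_def norm_mult ne)
      also have "\<dots> = \<bar>u\<bar> ^ 3 * (\<bar>y\<bar> ^ 3 / 6)" by (simp add: abs_mult power_mult_distrib)
      also have "\<dots> \<le> \<bar>u\<bar> ^ 3 * (K ^ 3 / 6)" using yK by (intro mult_left_mono divide_right_mono power_mono) auto
      finally show ?thesis .
    qed
    have u3: "u\<^sup>2 * \<bar>u\<bar> = \<bar>u\<bar> ^ 3"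
      by (simp add: power3_eq_cube power2_eq_square)
    have n2: "cmod r2 \<le> \<bar>u\<bar> ^ 3 * (K * x\<^sup>2 / 2)"
    proof -
      have "cmod r2 = \<bar>u\<bar> * \<bar>y\<bar> * cmod (iexp (u * x) - (1 + \<i> * (u * x)))"
        by (simp add: r2_def norm_mult ne)
      also have "\<dots> \<le> \<bar>u\<bar> * K * ((u * x)\<^sup>2 / 2)"
        using yK K iexp_bound2[of "u * x"] by (intro mult_mono) auto
      also have "\<dots> = (u\<^sup>2 * \<bar>u\<bar>) * (K * x\<^sup>2 / 2)"
        by (simp add: power_mult_distrib)
      finally show ?thesis unfolding u3 .
    qed
    have n4: "cmod (complex_of_real (- (u\<^sup>2 * y\<^sup>2 / 2)) * (e P \<omega> * (iexp (u * x) - 1))) \<le> \<bar>u\<bar> ^ 3 * (K\<^sup>2 * (1 + x\<^sup>2) / 2)"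
    proof -
      have "cmod (complex_of_real (- (u\<^sup>2 * y\<^sup>2 / 2)) * (e P \<omega> * (iexp (u * x) - 1))) = u\<^sup>2 * y\<^sup>2 / 2 * cmod (iexp (u * x) - 1)"
        unfolding norm_mult ne norm_of_real by simp
      also have "\<dots> \<le> u\<^sup>2 * K\<^sup>2 / 2 * (\<bar>u\<bar> * (1 + x\<^sup>2))"
      proof (intro mult_mono divide_right_mono)
        show "cmod (iexp (u * x) - 1) \<le> \<bar>u\<bar> * (1 + x\<^sup>2)"
          using iexp_bound1[of "u * x"] mult_left_mono[OF abs1[of x] abs_ge_zero[of u]] unfolding abs_mult by linarith
      qed (use yK in auto)
      also have "\<dots> = (u\<^sup>2 * \<bar>u\<bar>) * (K\<^sup>2 * (1 + x\<^sup>2) / 2)" by simp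
      finally show ?thesis unfolding u3 .
    qed
    have n5: "cmod (complex_of_real (- (u\<^sup>2 * g)) * (e Q \<omega> * (iexp (u * z) - 1))) \<le> \<bar>u\<bar> ^ 3 * (K * (x\<^sup>2 + z\<^sup>2) / 2 + K\<^sup>2 * (1 + z\<^sup>2) / 2)"
    proof -
      have "cmod (complex_of_real (- (u\<^sup>2 * g)) * (e Q \<omega> * (iexp (u * z) - 1))) = u\<^sup>2 * \<bar>g\<bar> * cmod (iexp (u * z) - 1)"
        unfolding norm_mult ne norm_of_real by (simp add: abs_mult)
      also have "\<dots> \<le> u\<^sup>2 * \<bar>g\<bar> * (\<bar>u\<bar> * \<bar>z\<bar>)"
        using iexp_bound1[of "u * z"] by (intro mult_left_mono) (auto simp: abs_mult)
      also have "\<dots> = (u\<^sup>2 * \<bar>u\<bar>) * (\<bar>g\<bar> * \<bar>z\<bar>)" by simp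
      also have "\<dots> \<le> (u\<^sup>2 * \<bar>u\<bar>) * (K * (x\<^sup>2 + z\<^sup>2) / 2 + K\<^sup>2 * (1 + z\<^sup>2) / 2)"
      proof (rule mult_left_mono)
        have "\<bar>g\<bar> \<le> \<bar>y * x\<bar> + \<bar>y\<^sup>2 / 2\<bar>" unfolding g by (rule abs_triangle_ineq)
        also have "\<dots> \<le> K * \<bar>x\<bar> + K\<^sup>2 / 2" using yK by (auto simp: abs_mult intro!: add_mono mult_mono)
        finally have "\<bar>g\<bar> * \<bar>z\<bar> \<le> (K * \<bar>x\<bar> + K\<^sup>2 / 2) * \<bar>z\<bar>" by (rule mult_right_mono) simp
        also have "\<dots> = K * (\<bar>x\<bar> * \<bar>z\<bar>) + K\<^sup>2 / 2 * \<bar>z\<bar>" by (simp add: algebra_simps)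
        also have "\<dots> \<le> K * ((x\<^sup>2 + z\<^sup>2) / 2) + K\<^sup>2 / 2 * (1 + z\<^sup>2)"
        proof (intro add_mono mult_left_mono abs1)
          have "0 \<le> (\<bar>x\<bar> - \<bar>z\<bar>)\<^sup>2" by simp
          then show "\<bar>x\<bar> * \<bar>z\<bar> \<le> (x\<^sup>2 + z\<^sup>2) / 2" by (simp add: power2_diff)
        qed (use K in auto)
        finally show "\<bar>g\<bar> * \<bar>z\<bar> \<le> K * (x\<^sup>2 + z\<^sup>2) / 2 + K\<^sup>2 * (1 + z\<^sup>2) / 2" by simp
      qed simp
      finally show ?thesis unfolding u3 .
    qed
    have n7: "cmod (complex_of_real (u\<^sup>2 * s / 2) * (e Q \<omega> * (iexp (u * (x + z)) - 1))) \<le> \<bar>u\<bar> ^ 3 * (D / 2 * (1 + 2 * x\<^sup>2 + 2 * z\<^sup>2))"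
    proof -
      have "cmod (complex_of_real (u\<^sup>2 * s / 2) * (e Q \<omega> * (iexp (u * (x + z)) - 1))) = u\<^sup>2 * \<bar>s\<bar> / 2 * cmod (iexp (u * (x + z)) - 1)"
        unfolding norm_mult ne norm_of_real by (simp add: abs_mult)
      also have "\<dots> \<le> u\<^sup>2 * D / 2 * (\<bar>u\<bar> * (1 + 2 * x\<^sup>2 + 2 * z\<^sup>2))"
      proof (intro mult_mono divide_right_mono sD)
        have "0 \<le> (x - z)\<^sup>2" by simp
        then have "\<bar>x + z\<bar> \<le> 1 + 2 * x\<^sup>2 + 2 * z\<^sup>2" using abs1[of "x + z"] by (simp add: power2_diff power2_sum)
        then have "\<bar>u\<bar> * \<bar>x + z\<bar> \<le> \<bar>u\<bar> * (1 + 2 * x\<^sup>2 + 2 * z\<^sup>2)" by (rule mult_left_mono) simp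
        then show "cmod (iexp (u * (x + z)) - 1) \<le> \<bar>u\<bar> * (1 + 2 * x\<^sup>2 + 2 * z\<^sup>2)"
          using iexp_bound1[of "u * (x + z)"] unfolding abs_mult by linarith
      qed (use D0 in auto)
      also have "\<dots> = (u\<^sup>2 * \<bar>u\<bar>) * (D / 2 * (1 + 2 * x\<^sup>2 + 2 * z\<^sup>2))" by simp
      finally show ?thesis unfolding u3 .
    qed
    have "cmod (R \<omega>) \<le> \<bar>u\<bar> ^ 3 * (K ^ 3 / 6) + \<bar>u\<bar> ^ 3 * (K * x\<^sup>2 / 2) + \<bar>u\<bar> ^ 3 * (K\<^sup>2 * (1 + x\<^sup>2) / 2)
       + \<bar>u\<bar> ^ 3 * (K * (x\<^sup>2 + z\<^sup>2) / 2 + K\<^sup>2 * (1 + z\<^sup>2) / 2) + \<bar>u\<bar> ^ 3 * (D / 2 * (1 + 2 * x\<^sup>2 + 2 * z\<^sup>2))"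
      unfolding dec by (intro order_trans[OF norm_triangle_ineq add_mono] n1 n2 n4 n5 n7)
    then show ?thesis unfolding x_def z_def by (simp only: distrib_left)
  qed
  have iY: "integrable M (\<lambda>\<omega>. e P \<omega> * complex_of_real (Y \<omega>))"
    using Yb by (intro integrable_bounded[where B=K]) (auto simp: norm_mult ne)
  have iG: "integrable M (\<lambda>\<omega>. e Q \<omega> * complex_of_real (G \<omega>))"
    using Gb by (intro integrable_bounded[where B="2 * real l * K\<^sup>2"]) (auto simp: norm_mult ne)
  have ie: "integrable M (e n)" if "e n \<in> borel_measurable M" for n
    using that by (intro integrable_bounded[where B=1]) (auto simp: ne)
  have Re: "R = (\<lambda>\<omega>. e (j + 1) \<omega> - (1 - u\<^sup>2 * s / 2) * e j \<omega>
      - (\<i> * u) * (e P \<omega> * Y \<omega>) + u\<^sup>2 * (e Q \<omega> * G \<omega>) - (u\<^sup>2 * complex_of_real (s / 2)) * e Q \<omega>)"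
    unfolding R_def[abs_def] of_real_diff by (simp only: right_diff_distrib fun_eq_iff add_diff_eq mult_ac simp_thms)
  have iR: "integrable M R"
    unfolding Re
    by (intro Bochner_Integration.integrable_add Bochner_Integration.integrable_diff integrable_mult_right iY iG ie) measurable
  have ER: "expectation (e (j + 1)) - (1 - u\<^sup>2 * s / 2) * expectation (e j)
      = expectation R + \<i> * u * expectation (\<lambda>\<omega>. e P \<omega> * complex_of_real (Y \<omega>))
        - u\<^sup>2 * (expectation (\<lambda>\<omega>. e Q \<omega> * complex_of_real (G \<omega>)) - expectation (e Q) * complex_of_real (s / 2))"
  proof -
    have "expectation R = expectation (e (j + 1)) - (1 - u\<^sup>2 * s / 2) * expectation (e j)
       - (\<i> * u) * expectation (\<lambda>\<omega>. e P \<omega> * complex_of_real (Y \<omega>))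
        + u\<^sup>2 * expectation (\<lambda>\<omega>. e Q \<omega> * complex_of_real (G \<omega>)) - (u\<^sup>2 * complex_of_real (s / 2)) * expectation (e Q)"
    proof -
      have i1: "integrable M (e (j + 1))" "integrable M (e j)" "integrable M (e Q)" by (rule ie, measurable)+
      show ?thesis
        unfolding Re
        by (intro has_bochner_integral_integral_eq has_bochner_integral_diff has_bochner_integral_add
            has_bochner_integral_mult_right has_bochner_integral_integrable iY iG i1)
    qed
    then show ?thesis by (simp add: algebra_simps)
  qed
  \<comment> \<open>The index j + 1 of \<open>Y\<close> is l + 1 steps after P = j - l. As
    \<open>Y\<close> is centered, the whole expectation is a covariance.\<close>
  have cY: "cmod (expectation (\<lambda>\<omega>. e P \<omega> * complex_of_real (Y \<omega>))) \<le> 8 * K * a (l + 1)"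
  proof -
    have m1: "(\<lambda>\<omega>. u * T P \<omega>) \<in> borel_measurable (block_algebra M X 1 P)"
      by (intro borel_measurable_times T_past borel_measurable_const) simp
    have m2: "Y \<in> borel_measurable (block_algebra M X (P + (l + 1)) p)"
      unfolding Y_def by (rule measurable_block_algebra) (use j l in \<open>auto simp: P_def\<close>)
    have "1 \<le> P" "1 \<le> l + 1" "P + (l + 1) \<le> p" "0 < K" using j l K by (auto simp: P_def)
    from mixing_cov_iexp[OF this(1-3) m1 m2 Yb this(4)] show ?thesis by (simp add: e_def EY)
  qed
  \<comment> \<open>\<open>G\<close> involves only indices above j - l, so it too starts l + 1 steps
    after Q = j - 2 l.\<close>
  have cG: "cmod (expectation (\<lambda>\<omega>. e Q \<omega> * complex_of_real (G \<omega>)) - expectation (e Q) * complex_of_real (s / 2)) \<le> 8 * (2 * real l * K\<^sup>2) * a (l + 1)"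
  proof -
    have "G = (\<lambda>\<omega>. Y \<omega> * (\<Sum>i\<in>{j-l<..j}. X i \<omega>) + (Y \<omega>)\<^sup>2 / 2)"
      using T_diff[of "j - l" l] by (simp add: G_def A_def jl fun_eq_iff)
    moreover have "\<dots> \<in> borel_measurable (block_algebra M X (Q + (l + 1)) p)"
      unfolding Y_def
      by (intro borel_measurable_add borel_measurable_times borel_measurable_sum borel_measurable_divide borel_measurable_power
          measurable_block_algebra borel_measurable_const) (use j l in \<open>auto simp: Q_def\<close>)
    ultimately have "G \<in> borel_measurable (block_algebra M X (Q + (l + 1)) p)" by simp
    note m2 = this
    have m1: "(\<lambda>\<omega>. u * T Q \<omega>) \<in> borel_measurable (block_algebra M X 1 Q)"
      by (intro borel_measurable_times T_past borel_measurable_const) simp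
    have "1 \<le> Q" "1 \<le> l + 1" "Q + (l + 1) \<le> p" "0 < 2 * real l * K\<^sup>2" using j l K by (auto simp: Q_def)
    from mixing_cov_iexp[OF this(1-3) m1 m2 Gb this(4)] show ?thesis by (simp add: e_def[abs_def] EG)
  qed
  define W where "W = K ^ 4 * C\<^sup>2 * real l"
  have cR: "cmod (expectation R) \<le> \<bar>u\<bar> ^ 3 * (7 * W)"
  proof -
    let ?A2 = "expectation (\<lambda>\<omega>. (A \<omega>)\<^sup>2)" and ?B2 = "expectation (\<lambda>\<omega>. (B \<omega>)\<^sup>2)"
    have "cmod (expectation R) \<le> expectation (\<lambda>\<omega>. cmod (R \<omega>))" by (rule integral_norm_bound)
    also have "\<dots> \<le> expectation (\<lambda>\<omega>. \<bar>u\<bar> ^ 3 * (K ^ 3 / 6 + K * (A \<omega>)\<^sup>2 / 2 + K\<^sup>2 * (1 + (A \<omega>)\<^sup>2) / 2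
       + (K * ((A \<omega>)\<^sup>2 + (B \<omega>)\<^sup>2) / 2 + K\<^sup>2 * (1 + (B \<omega>)\<^sup>2) / 2) + D / 2 * (1 + 2 * (A \<omega>)\<^sup>2 + 2 * (B \<omega>)\<^sup>2)))"
      using iR iA iB Rb by (intro integral_mono) auto
    also have "\<dots> = \<bar>u\<bar> ^ 3 * (K ^ 3 / 6 + K * ?A2 / 2 + K\<^sup>2 * (1 + ?A2) / 2
       + (K * (?A2 + ?B2) / 2 + K\<^sup>2 * (1 + ?B2) / 2) + D / 2 * (1 + 2 * ?A2 + 2 * ?B2))"
      using iA iB prob_space by simp
    \<comment> \<open>Every product of powers of K, C and l that occurs is at most \<open>W\<close>;
      the coefficients then sum to 37/6.\<close>
    also have "\<dots> \<le> \<bar>u\<bar> ^ 3 * (7 * W)"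
    proof (rule mult_left_mono)
      have l1: "1 \<le> real l" using l by simp
      have mono: "K ^ i * C ^ j * real l ^ k \<le> W" if "i \<le> 4" "j \<le> 2" "k \<le> 1" for i j k
        unfolding W_def using K C l1 that power_increasing[of k 1 "real l"]
        by (intro mult_mono power_increasing) auto
      have w: "K ^ 3 \<le> W" "K\<^sup>2 \<le> W" "D \<le> W" "K * (real l * D) \<le> W" "K\<^sup>2 * (real l * D) \<le> W" "D * (real l * D) \<le> W"
        using mono[of 3 0 0] mono[of 2 0 0] mono[of 2 1 0] mono[of 3 1 1] mono[of 4 1 1] mono[of 4 2 1]
        by (simp_all add: D_def power2_eq_square power3_eq_cube power4_eq_xxxx mult_ac)
      have "K * ?A2 \<le> W" "K * ?B2 \<le> W" "K\<^sup>2 * ?A2 \<le> W" "K\<^sup>2 * ?B2 \<le> W" "D * ?A2 \<le> W" "D * ?B2 \<le> W"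
        using w(4-6) EA2 EB2 K D0 by (auto intro: order_trans[OF mult_left_mono])
      then show "K ^ 3 / 6 + K * ?A2 / 2 + K\<^sup>2 * (1 + ?A2) / 2
       + (K * (?A2 + ?B2) / 2 + K\<^sup>2 * (1 + ?B2) / 2) + D / 2 * (1 + 2 * ?A2 + 2 * ?B2) \<le> 7 * W"
        using w(1-3) order_trans[OF zero_le_power2 w(2)]
        unfolding distrib_left distrib_right add_divide_distrib mult_1_right by linarith
    qed simp
    finally show ?thesis .
  qed
  have "cmod (expectation (e (j + 1)) - (1 - u\<^sup>2 * s / 2) * expectation (e j))
      \<le> \<bar>u\<bar> ^ 3 * (7 * W) + \<bar>u\<bar> * (8 * K * a (l + 1)) + u\<^sup>2 * (8 * (2 * real l * K\<^sup>2) * a (l + 1))"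
    unfolding ER
    by (rule order_trans[OF norm_triangle_ineq4 add_mono[OF order_trans[OF norm_triangle_ineq add_mono]]])
       (use cR cY cG in \<open>auto simp: norm_mult norm_power simp del: of_real_divide intro!: mult_left_mono\<close>)
  also have "\<dots> = 7 * \<bar>u\<bar> ^ 3 * K ^ 4 * C\<^sup>2 * real l + (8 * \<bar>u\<bar> * K + 16 * u\<^sup>2 * real l * K\<^sup>2) * a (l + 1)"
    by (simp add: W_def algebra_simps)
  finally show ?thesis by (simp only: e_def[abs_def])
qed

text \<open>The one-step estimate is iterated with the multiplier q = exp (-x) in [0, 1], so the
  step errors merely add up. Replacing 1 - x by q costs x^2 per step.\<close>

lemma char_sum_approx:
  assumes l: "1 \<le> l" "2 * l + 1 \<le> p" and C: "1 \<le> C" "1 + 8 * (\<Sum>k=1..2*l. a k) \<le> C"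
    and a_nonneg: "\<And>k. 1 \<le> k \<Longrightarrow> 0 \<le> a k"
  defines "s \<equiv> b 0 + 2 * (\<Sum>k=1..l. b k)"
  assumes s: "0 \<le> s"
  shows "cmod (expectation (\<lambda>\<omega>. iexp (u * T p \<omega>)) - exp (- (u\<^sup>2 * s / 2) * real (p - (2 * l + 1))))
    \<le> real p * (7 * \<bar>u\<bar> ^ 3 * K ^ 4 * C\<^sup>2 * real l + (8 * \<bar>u\<bar> * K + 16 * u\<^sup>2 * real l * K\<^sup>2) * a (l + 1) + (u\<^sup>2 * s / 2)\<^sup>2)
      + \<bar>u\<bar> * real (2 * l + 1) * K"
proof -
  define j0 where "j0 = 2 * l + 1"
  define x where "x = u\<^sup>2 * s / 2"
  define q where "q = exp (- x)"
  define E where "E n = expectation (\<lambda>\<omega>. iexp (u * T n \<omega>))" for n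
  define \<epsilon> where "\<epsilon> = 7 * \<bar>u\<bar> ^ 3 * K ^ 4 * C\<^sup>2 * real l + (8 * \<bar>u\<bar> * K + 16 * u\<^sup>2 * real l * K\<^sup>2) * a (l + 1) + x\<^sup>2"
  have x0: "x \<ge> 0" using s by (simp add: x_def)
  then have q01: "0 \<le> q" "q \<le> 1" by (auto simp: q_def)
  have q: "\<bar>1 - x - q\<bar> \<le> x\<^sup>2"
  proof -
    have "1 - x \<le> q" unfolding q_def using exp_ge_add_one_self[of "- x"] by simp
    moreover have "q \<le> 1 - x + x\<^sup>2"
    proof -
      have "q * (1 + x) \<le> q * exp x" using q01 by (intro mult_left_mono) auto
      also have "\<dots> = 1" by (simp add: q_def mult_exp_exp)
      finally have "q * (1 + x) \<le> 1" .
      also have "1 \<le> (1 - x + x\<^sup>2) * (1 + x)"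
        using x0 by (simp add: power2_eq_square algebra_simps)
      finally show ?thesis using x0 by (simp add: mult_le_cancel_right)
    qed
    ultimately show ?thesis by linarith
  qed
  have E1: "cmod (E n) \<le> 1" for n
  proof -
    have "cmod (E n) \<le> expectation (\<lambda>\<omega>. cmod (iexp (u * T n \<omega>)))" unfolding E_def by (rule integral_norm_bound)
    then show ?thesis using prob_space by (simp del: of_real_mult)
  qed
  have step: "cmod (E (Suc j) - q * E j) \<le> \<epsilon>" if "j0 \<le> j" "j < p" for j
  proof -
    have 1: "cmod (E (j + 1) - (1 - x) * E j) \<le> \<epsilon> - x\<^sup>2"
      using char_step[OF l(1) _ _ C a_nonneg, of j u] that
      unfolding E_def \<epsilon>_def j0_def x_def s_def by (simp add: add_ac)
    have 2: "cmod (complex_of_real (1 - x - q) * E j) \<le> x\<^sup>2 * 1"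
      unfolding norm_mult norm_of_real using q E1[of j] by (intro mult_mono) auto
    have "E (Suc j) - q * E j = (E (j + 1) - (1 - x) * E j) + complex_of_real (1 - x - q) * E j" by (simp add: algebra_simps)
    then have "cmod (E (Suc j) - q * E j) \<le> cmod (E (j + 1) - (1 - x) * E j) + cmod (complex_of_real (1 - x - q) * E j)"
      by (metis norm_triangle_ineq)
    with 1 2 show ?thesis by linarith
  qed
  have \<epsilon>0: "\<epsilon> \<ge> 0"
    unfolding \<epsilon>_def using K C a_nonneg by (intro add_nonneg_nonneg mult_nonneg_nonneg) auto
  have tel: "cmod (E (j0 + n) - q ^ n * E j0) \<le> real n * \<epsilon>" if "j0 + n \<le> p" for n
    using that
  proof (induction n)
    case (Suc n)
    have "E (j0 + Suc n) - q ^ Suc n * E j0 = (E (Suc (j0 + n)) - q * E (j0 + n)) + q * (E (j0 + n) - q ^ n * E j0)"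
      by (simp add: algebra_simps)
    then have "cmod (E (j0 + Suc n) - q ^ Suc n * E j0) \<le> cmod (E (Suc (j0 + n)) - q * E (j0 + n)) + cmod (q * (E (j0 + n) - q ^ n * E j0))"
      by (metis norm_triangle_ineq)
    also have "\<dots> \<le> \<epsilon> + 1 * (real n * \<epsilon>)"
      unfolding norm_mult using Suc step[of "j0 + n"] q01
      by (intro add_mono mult_mono) auto
    finally show ?case by (simp add: algebra_simps)
  qed simp
  have "cmod (E p - q ^ (p - j0) * E j0) \<le> real p * \<epsilon>"
  proof -
    have "cmod (E p - q ^ (p - j0) * E j0) \<le> real (p - j0) * \<epsilon>"
      using tel[of "p - j0"] l by (simp add: j0_def)
    also have "\<dots> \<le> real p * \<epsilon>" using \<epsilon>0 by (intro mult_right_mono) auto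
    finally show ?thesis .
  qed
  \<comment> \<open>The first 2 l + 1 summands leave no room for two gaps before them; their effect
    is bounded by their size alone.\<close>
  moreover have "cmod (q ^ (p - j0) * E j0 - q ^ (p - j0)) \<le> \<bar>u\<bar> * real j0 * K"
  proof -
    have Tm: "T j0 \<in> borel_measurable M" using l by (intro T_meas) (simp add: j0_def)
    have i: "integrable M (\<lambda>\<omega>. iexp (u * T j0 \<omega>))" using Tm by (intro integrable_bounded[where B=1]) (auto simp del: of_real_mult)
    have "E j0 - 1 = expectation (\<lambda>\<omega>. iexp (u * T j0 \<omega>) - 1)" unfolding E_def using i prob_space by simp
    also have "cmod \<dots> \<le> expectation (\<lambda>\<omega>. cmod (iexp (u * T j0 \<omega>) - 1))" by (rule integral_norm_bound)
    also have "\<dots> \<le> expectation (\<lambda>\<omega>. \<bar>u\<bar> * (real j0 * K))"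
    proof (rule integral_mono)
      fix \<omega> assume "\<omega> \<in> space M"
      then have "\<bar>T j0 \<omega>\<bar> \<le> real j0 * K" using abs_T_diff_le[of 0 j0 \<omega>] l by (simp add: j0_def T_def)
      then show "cmod (iexp (u * T j0 \<omega>) - 1) \<le> \<bar>u\<bar> * (real j0 * K)"
        using iexp_bound1[of "u * T j0 \<omega>"] mult_left_mono[of "\<bar>T j0 \<omega>\<bar>" "real j0 * K" "\<bar>u\<bar>"] by (simp add: abs_mult del: of_real_mult)
    qed (use i in auto)
    finally have "cmod (E j0 - 1) \<le> \<bar>u\<bar> * real j0 * K" using prob_space by simp
    moreover have "cmod (q ^ (p - j0) * E j0 - q ^ (p - j0)) \<le> 1 * cmod (E j0 - 1)"
    proof -
      have "q ^ (p - j0) * E j0 - q ^ (p - j0) = q ^ (p - j0) * (E j0 - 1)" by (simp add: algebra_simps)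
      then show ?thesis unfolding norm_mult[symmetric] using q01 by (simp add: norm_mult norm_power power_le_one mult_left_le_one_le)
    qed
    ultimately show ?thesis by simp
  qed
  moreover have "cmod (E p - q ^ (p - j0)) \<le> cmod (E p - q ^ (p - j0) * E j0) + cmod (q ^ (p - j0) * E j0 - q ^ (p - j0))"
    using norm_triangle_ineq[of "E p - q ^ (p - j0) * E j0" "q ^ (p - j0) * E j0 - q ^ (p - j0)"] by simp
  ultimately have "cmod (E p - q ^ (p - j0)) \<le> real p * \<epsilon> + \<bar>u\<bar> * real j0 * K"
    by linarith
  then have "cmod (E p - complex_of_real (q ^ (p - j0))) \<le> real p * \<epsilon> + \<bar>u\<bar> * real j0 * K" by simp
  moreover have "q ^ (p - j0) = exp (- x * real (p - j0))"
    by (simp add: q_def exp_of_nat_mult[symmetric] mult.commute)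
  ultimately have "cmod (E p - complex_of_real (exp (- x * real (p - j0)))) \<le> real p * \<epsilon> + \<bar>u\<bar> * real j0 * K" by metis
  then show ?thesis unfolding E_def \<epsilon>_def x_def j0_def by simp
qed

end

section \<open>Central limit theorem for stationary mixing arrays\<close>

lemma (in prob_space) cov_eq:
  assumes "integrable M f" "integrable M g" "integrable M (\<lambda>x. f x * g x)"
  shows "cov M f g = expectation (\<lambda>x. f x * g x) - expectation f * expectation g"
proof -
  have "cov M f g = expectation (\<lambda>x. f x * g x - expectation g * f x - expectation f * g x + expectation f * expectation g)"
    unfolding cov_def by (intro Bochner_Integration.integral_cong refl) (simp add: algebra_simps)
  also have "\<dots> = expectation (\<lambda>x. f x * g x) - expectation f * expectation g"
    using assms prob_space by simp
  finally show ?thesis .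
qed

text \<open>Where truncation acts, v / K is at least 1, so any power of it may be inserted: high
  moments buy arbitrary negative powers of the truncation level.\<close>

lemma trunc_error:
  fixes v K :: real
  assumes "0 \<le> v" "1 \<le> K"
  shows "0 \<le> v - min v K" "v - min v K \<le> v ^ Suc q / K ^ q"
proof -
  show "0 \<le> v - min v K" by simp
  show "v - min v K \<le> v ^ Suc q / K ^ q"
  proof (cases "v \<le> K")
    case True
    then show ?thesis using assms by simp
  next
    case False
    then have "1 \<le> (v / K) ^ q" using assms by (intro one_le_power) simp
    then have "v * 1 \<le> v * (v / K) ^ q" using assms by (intro mult_left_mono)
    then show ?thesis using False assms by (simp add: power_divide)
  qed
qed

lemma (in prob_space) integrable_mult_powers:
  fixes f g :: "'a \<Rightarrow> real"
  assumes [measurable]: "f \<in> borel_measurable M" "g \<in> borel_measurable M"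
    and "integrable M (\<lambda>x. f x ^ 2)" "integrable M (\<lambda>x. g x ^ 2)"
  shows "integrable M (\<lambda>x. f x * g x)"
    "expectation (\<lambda>x. f x * g x) \<le> (expectation (\<lambda>x. f x ^ 2) + expectation (\<lambda>x. g x ^ 2)) / 2"
proof -
  have b: "\<bar>f x * g x\<bar> \<le> (f x ^ 2 + g x ^ 2) / 2" for x
  proof -
    have "0 \<le> (\<bar>f x\<bar> - \<bar>g x\<bar>)\<^sup>2" by simp
    then show ?thesis by (simp add: power2_diff abs_mult)
  qed
  show i: "integrable M (\<lambda>x. f x * g x)"
  proof (rule Bochner_Integration.integrable_bound)
    show "integrable M (\<lambda>x. (f x ^ 2 + g x ^ 2) / 2)" using assms by simp
  qed (use b in \<open>auto intro: order_trans[OF _ abs_ge_self]\<close>)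
  have "expectation (\<lambda>x. f x * g x) \<le> expectation (\<lambda>x. (f x ^ 2 + g x ^ 2) / 2)"
    by (rule integral_mono[OF i]) (use assms order_trans[OF abs_ge_self b] in auto)
  also have "\<dots> = (expectation (\<lambda>x. f x ^ 2) + expectation (\<lambda>x. g x ^ 2)) / 2" using assms by simp
  finally show "expectation (\<lambda>x. f x * g x) \<le> (expectation (\<lambda>x. f x ^ 2) + expectation (\<lambda>x. g x ^ 2)) / 2" .
qed

text \<open>One factor is truncated at a time. Its error is at most its power q + 1 divided by
  \<open>K ^ q\<close>, and the mean of that power times the other factor is controlled by two
  second moments. This is the origin of the four orders 1, 2, q + 1 and 2 q + 2.\<close>

lemma (in prob_space) cov_trunc:
  fixes f g :: "'a \<Rightarrow> real"
  assumes m[measurable]: "f \<in> borel_measurable M" "g \<in> borel_measurable M"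
    and nonneg: "\<And>x. x \<in> space M \<Longrightarrow> 0 \<le> f x" "\<And>x. x \<in> space M \<Longrightarrow> 0 \<le> g x"
    and int: "\<And>n. n \<in> {1, 2, Suc q, 2 * Suc q} \<Longrightarrow> integrable M (\<lambda>x. f x ^ n)"
      "\<And>n. n \<in> {1, 2, Suc q, 2 * Suc q} \<Longrightarrow> integrable M (\<lambda>x. g x ^ n)"
    and C: "\<And>n. n \<in> {1, 2, Suc q, 2 * Suc q} \<Longrightarrow> expectation (\<lambda>x. f x ^ n) \<le> C"
      "\<And>n. n \<in> {1, 2, Suc q, 2 * Suc q} \<Longrightarrow> expectation (\<lambda>x. g x ^ n) \<le> C"
    and K: "1 \<le> K"
  shows "\<bar>cov M f g - cov M (\<lambda>x. min (f x) K) (\<lambda>x. min (g x) K)\<bar> \<le> (2 * C + 2 * C\<^sup>2) / K ^ q"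
proof -
  let ?f = "\<lambda>x. min (f x) K" and ?g = "\<lambda>x. min (g x) K"
  have i1: "integrable M f" "integrable M g" using int(1)[of 1] int(2)[of 1] by auto
  have iq: "integrable M (\<lambda>x. f x ^ Suc q)" "integrable M (\<lambda>x. g x ^ Suc q)" using int(1)[of "Suc q"] int(2)[of "Suc q"] by auto
  have i2: "integrable M (\<lambda>x. f x ^ 2)" "integrable M (\<lambda>x. g x ^ 2)" using int(1)[of 2] int(2)[of 2] by auto
  have i2q: "integrable M (\<lambda>x. (f x ^ Suc q) ^ 2)" "integrable M (\<lambda>x. (g x ^ Suc q) ^ 2)"
    using int(1)[of "2 * Suc q"] int(2)[of "2 * Suc q"]
    unfolding power_mult[symmetric] mult.commute[of "Suc q" 2] by blast+
  have e2q: "expectation (\<lambda>x. (f x ^ Suc q) ^ 2) \<le> C" "expectation (\<lambda>x. (g x ^ Suc q) ^ 2) \<le> C"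
    using C(1)[of "2 * Suc q"] C(2)[of "2 * Suc q"]
    unfolding power_mult[symmetric] mult.commute[of "Suc q" 2] by blast+
  have e2: "expectation (\<lambda>x. f x ^ 2) \<le> C" "expectation (\<lambda>x. g x ^ 2) \<le> C" using C(1)[of 2] C(2)[of 2] by auto
  have it: "integrable M ?f" "integrable M ?g" "integrable M (\<lambda>x. ?f x * ?g x)"
  proof -
    have b: "\<bar>?f x\<bar> \<le> K" "\<bar>?g x\<bar> \<le> K" if "x \<in> space M" for x
      using nonneg[OF that] K by (auto simp: min_def)
    show "integrable M ?f" by (rule integrable_const_bound[where B=K]) (use b in auto)
    show "integrable M ?g" by (rule integrable_const_bound[where B=K]) (use b in auto)
    have "\<bar>?f x * ?g x\<bar> \<le> K * K" if "x \<in> space M" for x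
      unfolding abs_mult using b[OF that] K by (intro mult_mono) auto
    then show "integrable M (\<lambda>x. ?f x * ?g x)" by (intro integrable_const_bound[where B="K * K"]) auto
  qed
  have ifg: "integrable M (\<lambda>x. f x * g x)" by (rule integrable_mult_powers[OF m i2])
  have mq: "(\<lambda>x. f x ^ Suc q) \<in> borel_measurable M" "(\<lambda>x. g x ^ Suc q) \<in> borel_measurable M"
    by measurable
  have ip: "integrable M (\<lambda>x. f x ^ Suc q * g x)" "integrable M (\<lambda>x. g x ^ Suc q * f x)"
    by (rule integrable_mult_powers(1)[OF mq(1) m(2) i2q(1) i2(2)], rule integrable_mult_powers(1)[OF mq(2) m(1) i2q(2) i2(1)])
  have ep: "expectation (\<lambda>x. f x ^ Suc q * g x) \<le> C" "expectation (\<lambda>x. g x ^ Suc q * f x) \<le> C"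
  proof -
    have avg: "x \<le> C" if "x \<le> (a + b) / 2" "a \<le> C" "b \<le> C" for x a b :: real
      using that by (simp add: field_simps)
    show "expectation (\<lambda>x. f x ^ Suc q * g x) \<le> C"
      by (rule avg[OF integrable_mult_powers(2)[OF mq(1) m(2) i2q(1) i2(2)] e2q(1) e2(2)])
    show "expectation (\<lambda>x. g x ^ Suc q * f x) \<le> C"
      by (rule avg[OF integrable_mult_powers(2)[OF mq(2) m(1) i2q(2) i2(1)] e2q(2) e2(1)])
  qed
  have e0: "0 \<le> expectation f" "expectation f \<le> C" "0 \<le> expectation g" "expectation g \<le> C" "0 \<le> expectation ?f" "expectation ?f \<le> expectation f"
  proof -
    show "expectation f \<le> C" "expectation g \<le> C" using C(1)[of 1] C(2)[of 1] by simp_all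
    show "0 \<le> expectation f" "0 \<le> expectation g" "0 \<le> expectation ?f"
      by (rule integral_nonneg_AE, use nonneg K in simp)+
    show "expectation ?f \<le> expectation f" by (rule integral_mono[OF it(1) i1(1)]) simp
  qed
  have C0: "0 \<le> C" using e0 by linarith
  have 1: "0 \<le> expectation (\<lambda>x. f x * g x) - expectation (\<lambda>x. ?f x * ?g x)"
       "expectation (\<lambda>x. f x * g x) - expectation (\<lambda>x. ?f x * ?g x) \<le> 2 * C / K ^ q"
  proof -
    have "expectation (\<lambda>x. ?f x * ?g x) \<le> expectation (\<lambda>x. f x * g x)"
      using nonneg K by (intro integral_mono it ifg) (auto intro!: mult_mono)
    then show "0 \<le> expectation (\<lambda>x. f x * g x) - expectation (\<lambda>x. ?f x * ?g x)" by simp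
    have "expectation (\<lambda>x. f x * g x) - expectation (\<lambda>x. ?f x * ?g x) = expectation (\<lambda>x. f x * g x - ?f x * ?g x)"
      using it ifg by simp
    also have "\<dots> \<le> expectation (\<lambda>x. (f x ^ Suc q * g x + g x ^ Suc q * f x) / K ^ q)"
    proof (rule integral_mono)
      fix x assume x: "x \<in> space M"
      have "f x * g x - ?f x * ?g x = (f x - ?f x) * g x + (g x - ?g x) * ?f x" by (simp add: algebra_simps)
      also have "\<dots> \<le> (f x ^ Suc q / K ^ q) * g x + (g x ^ Suc q / K ^ q) * f x"
        using nonneg[OF x] K trunc_error(1)[of "f x" K] trunc_error(1)[of "g x" K] trunc_error(2)[of "f x" K q] trunc_error(2)[of "g x" K q] by (intro add_mono mult_mono) auto
      finally show "f x * g x - ?f x * ?g x \<le> (f x ^ Suc q * g x + g x ^ Suc q * f x) / K ^ q"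
        by (simp add: add_divide_distrib)
    qed (use it ifg ip in auto)
    also have "\<dots> = (expectation (\<lambda>x. f x ^ Suc q * g x) + expectation (\<lambda>x. g x ^ Suc q * f x)) / K ^ q"
      using ip by simp
    also have "\<dots> \<le> 2 * C / K ^ q" using ep K by (intro divide_right_mono) auto
    finally show "expectation (\<lambda>x. f x * g x) - expectation (\<lambda>x. ?f x * ?g x) \<le> 2 * C / K ^ q" .
  qed
  have te: "0 \<le> expectation h - expectation (\<lambda>x. min (h x) K)" "expectation h - expectation (\<lambda>x. min (h x) K) \<le> C / K ^ q"
    if h: "integrable M h" "integrable M (\<lambda>x. min (h x) K)" "integrable M (\<lambda>x. h x ^ Suc q)" "\<And>x. x \<in> space M \<Longrightarrow> 0 \<le> h x" "expectation (\<lambda>x. h x ^ Suc q) \<le> C" for h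
  proof -
    have "expectation (\<lambda>x. min (h x) K) \<le> expectation h" using h by (intro integral_mono) auto
    then show "0 \<le> expectation h - expectation (\<lambda>x. min (h x) K)" by simp
    have "expectation h - expectation (\<lambda>x. min (h x) K) = expectation (\<lambda>x. h x - min (h x) K)" using h by simp
    also have "\<dots> \<le> expectation (\<lambda>x. h x ^ Suc q / K ^ q)"
      using h trunc_error[OF h(4) K] by (intro integral_mono) auto
    also have "\<dots> \<le> C / K ^ q" using h K by (simp add: divide_right_mono)
    finally show "expectation h - expectation (\<lambda>x. min (h x) K) \<le> C / K ^ q" .
  qed
  have tf: "0 \<le> expectation f - expectation ?f" "expectation f - expectation ?f \<le> C / K ^ q"
    using te[OF i1(1) it(1) iq(1) nonneg(1)] C(1)[of "Suc q"] by auto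
  have tg: "0 \<le> expectation g - expectation ?g" "expectation g - expectation ?g \<le> C / K ^ q"
    using te[OF i1(2) it(2) iq(2) nonneg(2)] C(2)[of "Suc q"] by auto
  have d: "expectation f * expectation g - expectation ?f * expectation ?g
     = (expectation f - expectation ?f) * expectation g + (expectation g - expectation ?g) * expectation ?f" by (simp add: algebra_simps)
  have 2: "0 \<le> expectation f * expectation g - expectation ?f * expectation ?g"
    "expectation f * expectation g - expectation ?f * expectation ?g \<le> C / K ^ q * C + C / K ^ q * C"
  proof -
    show "0 \<le> expectation f * expectation g - expectation ?f * expectation ?g"
      unfolding d using tf tg e0 by (intro add_nonneg_nonneg mult_nonneg_nonneg)
    have "0 \<le> C / K ^ q" using C0 K by simp
    moreover have "expectation ?f \<le> C" using e0 by linarith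
    ultimately show "expectation f * expectation g - expectation ?f * expectation ?g \<le> C / K ^ q * C + C / K ^ q * C"
      unfolding d using tf tg e0 by (intro add_mono mult_mono)
  qed
  have "(2 * C + 2 * C\<^sup>2) / K ^ q = 2 * C / K ^ q + (C / K ^ q * C + C / K ^ q * C)"
    by (simp add: add_divide_distrib power2_eq_square)
  then show ?thesis
    unfolding cov_eq[OF i1 ifg] cov_eq[OF it] using 1 2 by linarith
qed

text \<open>Stationarity equates the laws of whole windows; reading the window at its positions 0
  and k transfers every function of a pair at lag k.\<close>

lemma stationary_expectation:
  fixes f :: "real \<Rightarrow> real \<Rightarrow> 'b::{banach, second_countable_topology}"
  assumes stat: "stationary_fin M V p" and meas: "\<And>j. j \<in> {1..p} \<Longrightarrow> V j \<in> borel_measurable M"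
    and f: "(\<lambda>(x, y). f x y) \<in> borel_measurable (borel \<Otimes>\<^sub>M borel)"
    and j: "1 \<le> j" "j + k \<le> p"
  shows "(\<integral>\<omega>. f (V j \<omega>) (V (j + k) \<omega>) \<partial>M) = (\<integral>\<omega>. f (V 1 \<omega>) (V (1 + k) \<omega>) \<partial>M)"
    "integrable M (\<lambda>\<omega>. f (V j \<omega>) (V (j + k) \<omega>)) \<longleftrightarrow> integrable M (\<lambda>\<omega>. f (V 1 \<omega>) (V (1 + k) \<omega>))"
proof -
  let ?P = "PiM {0..k} (\<lambda>_. borel :: real measure)"
  let ?R = "\<lambda>j \<omega>. \<lambda>i\<in>{0..k}. V (j + i) \<omega>"
  have D: "distr M ?P (?R j) = distr M ?P (?R 1)"
  proof -
    have "1 + k \<le> p" using j by simp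
    then show ?thesis using stat[unfolded stationary_fin_def, THEN spec, THEN spec, THEN spec, of j 1 k] j by simp
  qed
  have R: "?R i \<in> measurable M ?P" if "1 \<le> i" "i + k \<le> p" for i
    by (rule measurable_restrict, rule meas) (use that in auto)
  define F where "F x = (\<lambda>(x, y). f x y) (x 0, x k)" for x :: "nat \<Rightarrow> real"
  have F: "F \<in> borel_measurable ?P"
    unfolding F_def by (rule measurable_compose[OF _ f]) (intro measurable_Pair measurable_component_singleton; simp)
  have e: "F (?R i \<omega>) = f (V i \<omega>) (V (i + k) \<omega>)" for i \<omega> by (simp add: F_def)
  have "(\<integral>x. F x \<partial>distr M ?P (?R i)) = (\<integral>\<omega>. f (V i \<omega>) (V (i + k) \<omega>) \<partial>M)" if "1 \<le> i" "i + k \<le> p" for i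
    unfolding integral_distr[OF R[OF that] F] e ..
  note I = this
  have j1: "1 \<le> (1::nat)" "1 + k \<le> p" using j by auto
  show "(\<integral>\<omega>. f (V j \<omega>) (V (j + k) \<omega>) \<partial>M) = (\<integral>\<omega>. f (V 1 \<omega>) (V (1 + k) \<omega>) \<partial>M)"
    unfolding I[OF j, symmetric] I[OF j1, symmetric] D ..
  have "integrable (distr M ?P (?R i)) F \<longleftrightarrow> integrable M (\<lambda>\<omega>. f (V i \<omega>) (V (i + k) \<omega>))" if "1 \<le> i" "i + k \<le> p" for i
    unfolding integrable_distr_eq[OF R[OF that] F] e ..
  note I = this
  show "integrable M (\<lambda>\<omega>. f (V j \<omega>) (V (j + k) \<omega>)) \<longleftrightarrow> integrable M (\<lambda>\<omega>. f (V 1 \<omega>) (V (1 + k) \<omega>))"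
    unfolding I[OF j, symmetric] I[OF j1, symmetric] D ..
qed

lemma stationary_expectation_single:
  fixes f :: "real \<Rightarrow> 'b::{banach, second_countable_topology}"
  assumes stat: "stationary_fin M V p" and meas: "\<And>j. j \<in> {1..p} \<Longrightarrow> V j \<in> borel_measurable M"
    and f[measurable]: "f \<in> borel_measurable borel" and j: "1 \<le> j" "j \<le> p"
  shows "(\<integral>\<omega>. f (V j \<omega>) \<partial>M) = (\<integral>\<omega>. f (V 1 \<omega>) \<partial>M)"
  using stationary_expectation(1)[OF stat meas, where f="\<lambda>x y. f x" and j=j and k=0] j by simp

lemma stationary_cov:
  fixes h :: "real \<Rightarrow> real"
  assumes stat: "stationary_fin M V p" and meas: "\<And>j. j \<in> {1..p} \<Longrightarrow> V j \<in> borel_measurable M"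
    and h[measurable]: "h \<in> borel_measurable borel" and j: "1 \<le> j" "j + k \<le> p"
  shows "cov M (\<lambda>\<omega>. h (V j \<omega>)) (\<lambda>\<omega>. h (V (j + k) \<omega>)) = cov M (\<lambda>\<omega>. h (V 1 \<omega>)) (\<lambda>\<omega>. h (V (1 + k) \<omega>))"
proof -
  have 1: "(\<integral>\<omega>. h (V i \<omega>) \<partial>M) = (\<integral>\<omega>. h (V 1 \<omega>) \<partial>M)" if "1 \<le> i \<and> i \<le> p" for i
    using stationary_expectation_single[OF stat meas h conjunct1[OF that] conjunct2[OF that]] .
  have jp: "1 \<le> j \<and> j \<le> p" "1 \<le> j + k \<and> j + k \<le> p" "1 \<le> 1 + k \<and> 1 + k \<le> p" using j by auto
  show ?thesis
    unfolding cov_def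
    unfolding 1[OF jp(1)] 1[OF jp(2)] 1[OF jp(3)]
    by (rule stationary_expectation(1)[OF stat meas, where f="\<lambda>x y. (h x - (\<integral>\<omega>. h (V 1 \<omega>) \<partial>M)) * (h y - (\<integral>\<omega>. h (V 1 \<omega>) \<partial>M))"])
       (use j in auto)
qed

text \<open>The central limit setting with normality stripped off: one polynomial mixing rate for
  all rows and eventually bounded moments of every order. Nonnegativity makes truncation one-sided,
  and the bound 1 on the rate parameter, harmless since a slower rate is weaker, keeps the exponent
  arithmetic simple.\<close>

locale mixing_array =
  fixes M :: "nat \<Rightarrow> 'a measure" and V :: "nat \<Rightarrow> nat \<Rightarrow> 'a \<Rightarrow> real" and p :: "nat \<Rightarrow> nat"
    and al :: "nat \<Rightarrow> real" and \<beta> Ca :: real and g :: "nat \<Rightarrow> real"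
  assumes prob: "\<And>m. prob_space (M m)"
    and V_meas: "\<And>m j. j \<in> {1..p m} \<Longrightarrow> V m j \<in> borel_measurable (M m)"
    and V_nonneg: "\<forall>\<^sub>F m in sequentially. \<forall>j\<in>{1..p m}. \<forall>\<omega>\<in>space (M m). 0 \<le> V m j \<omega>"
    and stat: "\<And>m. stationary_fin (M m) (V m) (p m)"
    and mix: "\<And>m k r A B. 1 \<le> k \<Longrightarrow> 1 \<le> r \<Longrightarrow> k + r \<le> p m \<Longrightarrow> A \<in> gen_sigma (M m) (V m) 1 k
       \<Longrightarrow> B \<in> gen_sigma (M m) (V m) (k + r) (p m)
       \<Longrightarrow> \<bar>measure (M m) (A \<inter> B) - measure (M m) A * measure (M m) B\<bar> \<le> al r"
    and al_nonneg: "\<And>r. 0 \<le> al r"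
    and al_bound: "\<And>r. 1 \<le> r \<Longrightarrow> al r \<le> Ca * real r powr - (1 + \<beta>)"
    and \<beta>: "0 < \<beta>" "\<beta> \<le> 1"
    and p_lim: "filterlim p at_top sequentially"
    and moments: "\<And>q. \<exists>C. \<forall>\<^sub>F m in sequentially. \<forall>j\<in>{1..p m}.
       integrable (M m) (\<lambda>\<omega>. V m j \<omega> ^ q) \<and> (\<integral>\<omega>. V m j \<omega> ^ q \<partial>M m) \<le> C"
    and cov_lim: "\<And>k. (\<lambda>m. cov (M m) (V m 1) (V m (1 + k))) \<longlonglongrightarrow> g k"
begin

sublocale P: prob_space "M m" for m by (rule prob)

lemma Ca_nonneg: "0 \<le> Ca"
  using al_bound[of 1] al_nonneg[of 1] by simp

lemma ev_p_ge: "\<forall>\<^sub>F m in sequentially. n \<le> p m"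
  using p_lim by (simp add: filterlim_at_top)

text \<open>One constant and one threshold for the four orders that the truncation of covariances at
  level q requires.\<close>

lemma good_moments:
  "\<exists>C\<ge>0. \<forall>\<^sub>F m in sequentially. (\<forall>j\<in>{1..p m}. \<forall>\<omega>\<in>space (M m). 0 \<le> V m j \<omega>) \<and>
     (\<forall>j\<in>{1..p m}. \<forall>n\<in>{1, 2, Suc q, 2 * Suc q}. integrable (M m) (\<lambda>\<omega>. V m j \<omega> ^ n) \<and> (\<integral>\<omega>. V m j \<omega> ^ n \<partial>M m) \<le> C)"
proof -
  define B where "B n = (SOME C. \<forall>\<^sub>F m in sequentially. \<forall>j\<in>{1..p m}.
       integrable (M m) (\<lambda>\<omega>. V m j \<omega> ^ n) \<and> (\<integral>\<omega>. V m j \<omega> ^ n \<partial>M m) \<le> C)" for n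
  have B: "\<forall>\<^sub>F m in sequentially. \<forall>j\<in>{1..p m}. integrable (M m) (\<lambda>\<omega>. V m j \<omega> ^ n) \<and> (\<integral>\<omega>. V m j \<omega> ^ n \<partial>M m) \<le> B n" for n
    unfolding B_def by (rule someI_ex[OF moments])
  define S :: "nat set" where "S = {1, 2, Suc q, 2 * Suc q}"
  define C where "C = (\<Sum>n\<in>S. \<bar>B n\<bar>)"
  have BC: "B n \<le> C" if "n \<in> S" for n
  proof -
    have "\<bar>B n\<bar> \<le> C" unfolding C_def using that by (intro member_le_sum) (auto simp: S_def)
    then show ?thesis by linarith
  qed
  have "\<forall>\<^sub>F m in sequentially. \<forall>n\<in>S. \<forall>j\<in>{1..p m}. integrable (M m) (\<lambda>\<omega>. V m j \<omega> ^ n) \<and> (\<integral>\<omega>. V m j \<omega> ^ n \<partial>M m) \<le> B n"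
    using B by (intro eventually_ball_finite) (auto simp: S_def)
  with V_nonneg have "\<forall>\<^sub>F m in sequentially. (\<forall>j\<in>{1..p m}. \<forall>\<omega>\<in>space (M m). 0 \<le> V m j \<omega>) \<and>
     (\<forall>j\<in>{1..p m}. \<forall>n\<in>S. integrable (M m) (\<lambda>\<omega>. V m j \<omega> ^ n) \<and> (\<integral>\<omega>. V m j \<omega> ^ n \<partial>M m) \<le> C)"
    by eventually_elim (use BC order_trans in blast)
  then show ?thesis unfolding S_def by (intro exI[of _ C]) (auto simp: C_def intro!: sum_nonneg)
qed

definition tc :: "nat \<Rightarrow> real \<Rightarrow> nat \<Rightarrow> real" where
  "tc m K k = cov (M m) (\<lambda>\<omega>. min (V m 1 \<omega>) K) (\<lambda>\<omega>. min (V m (1 + k) \<omega>) K)"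

definition tX :: "nat \<Rightarrow> real \<Rightarrow> nat \<Rightarrow> 'a \<Rightarrow> real" where
  "tX m K j \<omega> = min (V m j \<omega>) K - P.expectation m (\<lambda>\<omega>. min (V m j \<omega>) K)"

text \<open>The truncated value and its mean both lie in [0, K], so the centered variable is bounded
  by K itself and not merely by 2 K.\<close>

lemma tX_bounded_mixing:
  assumes nonneg: "\<And>j \<omega>. j \<in> {1..p m} \<Longrightarrow> \<omega> \<in> space (M m) \<Longrightarrow> 0 \<le> V m j \<omega>" and K: "1 \<le> K"
  shows "bounded_mixing (M m) (tX m K) (p m) al K (tc m K)"
proof -
  have im: "integrable (M m) (\<lambda>\<omega>. min (V m j \<omega>) K)" if "j \<in> {1..p m}" for j
    using V_meas[OF that] nonneg[OF that] K by (intro P.integrable_const_bound[where B=K]) auto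
  have mean: "0 \<le> P.expectation m (\<lambda>\<omega>. min (V m j \<omega>) K) \<and> P.expectation m (\<lambda>\<omega>. min (V m j \<omega>) K) \<le> K" if "j \<in> {1..p m}" for j
  proof
    show "0 \<le> P.expectation m (\<lambda>\<omega>. min (V m j \<omega>) K)" using nonneg[OF that] K by (intro integral_nonneg_AE) auto
    have "P.expectation m (\<lambda>\<omega>. min (V m j \<omega>) K) \<le> P.expectation m (\<lambda>\<omega>. K)"
      using im[OF that] by (intro integral_mono) auto
    then show "P.expectation m (\<lambda>\<omega>. min (V m j \<omega>) K) \<le> K" using P.prob_space by simp
  qed
  show ?thesis
  proof
    show "tX m K j \<in> borel_measurable (M m)" if "j \<in> {1..p m}" for j
      unfolding tX_def using V_meas[OF that] by measurable
    show "\<bar>P.prob m (A \<inter> B) - P.prob m A * P.prob m B\<bar> \<le> al r"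
      if "1 \<le> k" "1 \<le> r" "k + r \<le> p m" "A \<in> gen_sigma (M m) (tX m K) 1 k" "B \<in> gen_sigma (M m) (tX m K) (k + r) (p m)" for k r A B
    proof -
      have "gen_sigma (M m) (tX m K) a b \<subseteq> gen_sigma (M m) (V m) a b" for a b
        unfolding tX_def[abs_def]
        by (rule gen_sigma_compose[where h="\<lambda>j v. min v K - P.expectation m (\<lambda>\<omega>. min (V m j \<omega>) K)"]) measurable
      then show ?thesis using mix[OF that(1-3)] that(4,5) by blast
    qed
    show "1 \<le> K" by fact
    show "\<bar>tX m K j \<omega>\<bar> \<le> K" if "j \<in> {1..p m}" "\<omega> \<in> space (M m)" for j \<omega>
      using nonneg[OF that] mean[OF that(1)] K by (auto simp: tX_def abs_le_iff min_def)
    show "P.expectation m (tX m K j) = 0" if "j \<in> {1..p m}" for j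
      unfolding tX_def using im[OF that] P.prob_space by simp
    show "P.expectation m (\<lambda>\<omega>. tX m K j \<omega> * tX m K (j + k) \<omega>) = tc m K k" if "1 \<le> j" "j + k \<le> p m" for j k
      using stationary_cov[OF stat V_meas, where h="\<lambda>v. min v K" and j=j and k=k] that
      unfolding tX_def tc_def cov_def by simp
  qed
qed

lemma tc_error:
  assumes "\<And>j \<omega>. j \<in> {1..p m} \<Longrightarrow> \<omega> \<in> space (M m) \<Longrightarrow> 0 \<le> V m j \<omega>"
    and "\<And>j n. j \<in> {1..p m} \<Longrightarrow> n \<in> {1, 2, Suc q, 2 * Suc q} \<Longrightarrow> integrable (M m) (\<lambda>\<omega>. V m j \<omega> ^ n) \<and> (\<integral>\<omega>. V m j \<omega> ^ n \<partial>M m) \<le> C"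
    and "1 \<le> K" "k < p m"
  shows "\<bar>cov (M m) (V m 1) (V m (1 + k)) - tc m K k\<bar> \<le> (2 * C + 2 * C\<^sup>2) / K ^ q"
proof -
  have 1: "1 \<in> {1..p m}" "1 + k \<in> {1..p m}" using assms(4) by auto
  show ?thesis
    unfolding tc_def
    by (rule P.cov_trunc)
      (use assms(2)[OF 1(1)] assms(2)[OF 1(2)] assms(1)[OF 1(1)] assms(1)[OF 1(2)] V_meas[OF 1(1)] V_meas[OF 1(2)] assms(3) in blast)+
qed

text \<open>The truncation level is tied to the lag: at K = k^(beta/4) the bounded covariance
  inequality gives K^2 k^-(1+beta) = k^-(1+beta/2), and the truncation error K^-q is of order k^-2
  at most, since q is chosen with q * beta at least 8. Half of the excess rate is lost, yet
  summability survives.\<close>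

lemma cov_decay: "\<exists>B\<ge>0. \<forall>\<^sub>F m in sequentially. \<forall>k. 1 \<le> k \<longrightarrow> k < p m \<longrightarrow>
    \<bar>cov (M m) (V m 1) (V m (1 + k))\<bar> \<le> B * real k powr - (1 + \<beta> / 2)"
proof -
  define q where "q = nat \<lceil>8 / \<beta>\<rceil>"
  have q: "real q * \<beta> \<ge> 8"
  proof -
    have "8 / \<beta> \<le> real q" unfolding q_def by linarith
    then show ?thesis using \<beta> by (simp add: divide_le_eq)
  qed
  obtain C where C: "C \<ge> 0" and ev: "\<forall>\<^sub>F m in sequentially. (\<forall>j\<in>{1..p m}. \<forall>\<omega>\<in>space (M m). 0 \<le> V m j \<omega>) \<and>
     (\<forall>j\<in>{1..p m}. \<forall>n\<in>{1, 2, Suc q, 2 * Suc q}. integrable (M m) (\<lambda>\<omega>. V m j \<omega> ^ n) \<and> (\<integral>\<omega>. V m j \<omega> ^ n \<partial>M m) \<le> C)"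
    using good_moments[of q] by blast
  define B where "B = 4 * Ca + (2 * C + 2 * C\<^sup>2)"
  have "\<forall>\<^sub>F m in sequentially. \<forall>k. 1 \<le> k \<longrightarrow> k < p m \<longrightarrow> \<bar>cov (M m) (V m 1) (V m (1 + k))\<bar> \<le> B * real k powr - (1 + \<beta> / 2)"
    using ev
  proof eventually_elim
    case (elim m)
    show ?case
    proof (intro allI impI)
      fix k assume k: "1 \<le> k" "k < p m"
      define K where "K = real k powr (\<beta> / 4)"
      have K: "1 \<le> K" unfolding K_def using k \<beta> by (intro ge_one_powr_ge_zero) auto
      interpret bounded_mixing "M m" "tX m K" "p m" al K "tc m K"
        by (rule tX_bounded_mixing) (use elim K in auto)
      have "\<bar>tc m K k\<bar> \<le> 4 * K\<^sup>2 * al k" by (rule autocov_bound[OF k])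
      also have "\<dots> \<le> 4 * K\<^sup>2 * (Ca * real k powr - (1 + \<beta>))" using al_bound[OF k(1)] by (intro mult_left_mono) auto
      also have "\<dots> = 4 * Ca * real k powr - (1 + \<beta> / 2)"
      proof -
        have "K\<^sup>2 = real k powr (\<beta> / 2)" unfolding K_def using k by (simp add: powr_power mult.commute)
        moreover have "real k powr (\<beta> / 2) * real k powr - (1 + \<beta>) = real k powr - (1 + \<beta> / 2)"
          unfolding powr_add[symmetric] by (rule arg_cong[where f="\<lambda>x. real k powr x"]) (simp add: field_simps)
        ultimately show ?thesis by simp
      qed
      finally have 1: "\<bar>tc m K k\<bar> \<le> 4 * Ca * real k powr - (1 + \<beta> / 2)" .
      have "\<bar>cov (M m) (V m 1) (V m (1 + k)) - tc m K k\<bar> \<le> (2 * C + 2 * C\<^sup>2) / K ^ q"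
        by (rule tc_error) (use elim K k in auto)
      also have "\<dots> = (2 * C + 2 * C\<^sup>2) * real k powr - (\<beta> / 4 * real q)"
      proof -
        have "K ^ q = real k powr (\<beta> / 4 * real q)" unfolding K_def using k by (simp add: powr_power mult.commute)
        then show ?thesis by (simp only: powr_minus divide_inverse)
      qed
      also have "\<dots> \<le> (2 * C + 2 * C\<^sup>2) * real k powr - (1 + \<beta> / 2)"
      proof (rule mult_left_mono)
        have "\<beta> / 4 * real q = real q * \<beta> / 4" by simp
        then have "1 + \<beta> / 2 \<le> \<beta> / 4 * real q" using q \<beta> by linarith
        then show "real k powr - (\<beta> / 4 * real q) \<le> real k powr - (1 + \<beta> / 2)"
          using k by (intro powr_mono) auto
      qed (use C in simp)
      finally have 2: "\<bar>cov (M m) (V m 1) (V m (1 + k)) - tc m K k\<bar> \<le> (2 * C + 2 * C\<^sup>2) * real k powr - (1 + \<beta> / 2)" .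
      show "\<bar>cov (M m) (V m 1) (V m (1 + k))\<bar> \<le> B * real k powr - (1 + \<beta> / 2)"
        using 1 2 unfolding B_def distrib_right by linarith
    qed
  qed
  moreover have "B \<ge> 0" using C Ca_nonneg by (simp add: B_def)
  ultimately show ?thesis by blast
qed

lemma summable_decay: "0 < b \<Longrightarrow> summable (\<lambda>k. real (Suc k) powr - (1 + b))"
  using summable_real_powr_iff[of "- (1 + b)"] by (subst summable_Suc_iff) simp

lemma sum_decay_le: "0 < b \<Longrightarrow> (\<Sum>k=1..n. real k powr - (1 + b)) \<le> (\<Sum>k. real (Suc k) powr - (1 + b))"
proof -
  assume b: "0 < b"
  have "(\<Sum>k=1..n. real k powr - (1 + b)) = (\<Sum>k<n. real (Suc k) powr - (1 + b))"
    by (rule sum.reindex_bij_witness[of _ Suc "\<lambda>k. k - 1"]) auto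
  also have "\<dots> \<le> (\<Sum>k. real (Suc k) powr - (1 + b))"
    by (rule sum_le_suminf[OF summable_decay[OF b]]) auto
  finally show ?thesis .
qed

text \<open>Summable covariances make the variance of the row sum linear in its length. This is the
  input of the Chebyshev argument in the regime where no central limit theorem is invoked.\<close>

lemma variance_bound:
  "\<exists>B\<ge>0. \<forall>\<^sub>F m in sequentially.
     integrable (M m) (\<lambda>\<omega>. ((\<Sum>j=1..p m. V m j \<omega>) - (\<Sum>j=1..p m. P.expectation m (V m j)))\<^sup>2) \<and>
     P.expectation m (\<lambda>\<omega>. ((\<Sum>j=1..p m. V m j \<omega>) - (\<Sum>j=1..p m. P.expectation m (V m j)))\<^sup>2) \<le> B * real (p m)"
proof -
  obtain B0 where B0: "B0 \<ge> 0" and ev1: "\<forall>\<^sub>F m in sequentially. \<forall>k. 1 \<le> k \<longrightarrow> k < p m \<longrightarrow>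
    \<bar>cov (M m) (V m 1) (V m (1 + k))\<bar> \<le> B0 * real k powr - (1 + \<beta> / 2)" using cov_decay by blast
  obtain C where C: "C \<ge> 0" and ev2: "\<forall>\<^sub>F m in sequentially. (\<forall>j\<in>{1..p m}. \<forall>\<omega>\<in>space (M m). 0 \<le> V m j \<omega>) \<and>
     (\<forall>j\<in>{1..p m}. \<forall>n\<in>{1, 2, Suc 0, 2 * Suc 0}. integrable (M m) (\<lambda>\<omega>. V m j \<omega> ^ n) \<and> (\<integral>\<omega>. V m j \<omega> ^ n \<partial>M m) \<le> C)"
    using good_moments[of 0] by blast
  define S where "S = (\<Sum>k. real (Suc k) powr - (1 + \<beta> / 2))"
  have S0: "0 \<le> S" unfolding S_def by (intro suminf_nonneg summable_decay) (use \<beta> in auto)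
  have ev3: "\<forall>\<^sub>F m in sequentially. cov (M m) (V m 1) (V m (1 + 0)) < g 0 + 1"
    using cov_lim[of 0] by (rule order_tendstoD) simp
  define B where "B = \<bar>g 0 + 1\<bar> + 2 * (B0 * S)"
  have "\<forall>\<^sub>F m in sequentially.
     integrable (M m) (\<lambda>\<omega>. ((\<Sum>j=1..p m. V m j \<omega>) - (\<Sum>j=1..p m. P.expectation m (V m j)))\<^sup>2) \<and>
     P.expectation m (\<lambda>\<omega>. ((\<Sum>j=1..p m. V m j \<omega>) - (\<Sum>j=1..p m. P.expectation m (V m j)))\<^sup>2) \<le> B * real (p m)"
    using ev1 ev2 ev3 ev_p_ge[of 1]
  proof eventually_elim
    case (elim m)
    define X where "X j \<omega> = V m j \<omega> - P.expectation m (V m j)" for j \<omega>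
    define b where "b k = cov (M m) (V m 1) (V m (1 + k))" for k
    have i1: "integrable (M m) (V m j)" if "j \<in> {1..p m}" for j using elim(2) that by (auto dest!: bspec)
    have i2: "integrable (M m) (\<lambda>\<omega>. V m j \<omega> ^ 2)" if "j \<in> {1..p m}" for j using elim(2) that by auto
    have iX: "integrable (M m) (\<lambda>\<omega>. X i \<omega> * X j \<omega>)" if ij: "i \<in> {1..p m}" "j \<in> {1..p m}" for i j
    proof -
      have "X i \<omega> * X j \<omega> = V m i \<omega> * V m j \<omega> - P.expectation m (V m j) * V m i \<omega> - P.expectation m (V m i) * V m j \<omega> + P.expectation m (V m i) * P.expectation m (V m j)" for \<omega>
        by (simp add: X_def algebra_simps)
      moreover have "integrable (M m) (\<lambda>\<omega>. V m i \<omega> * V m j \<omega>)"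
        using ij by (intro P.integrable_mult_powers V_meas i2)
      ultimately show ?thesis using i1 ij by simp
    qed
    have e: "(\<Sum>j=1..p m. V m j \<omega>) - (\<Sum>j=1..p m. P.expectation m (V m j)) = (\<Sum>j\<in>{0<..0+p m}. X j \<omega>)" for \<omega>
      by (simp add: X_def sum_subtractf atLeastSucAtMost_greaterThanAtMost[symmetric])
    have "P.expectation m (\<lambda>\<omega>. (\<Sum>j\<in>{0<..0+p m}. X j \<omega>)\<^sup>2) \<le> real (p m) * (b 0 + 2 * (\<Sum>k=1..p m - 1. \<bar>b k\<bar>))"
    proof (rule P.second_moment_sum)
      show "P.expectation m (\<lambda>\<omega>. X i \<omega> * X (i + k) \<omega>) = b k" if "0 < i" "i + k \<le> 0 + p m" for i k
        using stationary_cov[OF stat V_meas, where h="\<lambda>x. x" and j=i and k=k] that by (simp add: b_def X_def cov_def)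
    qed (use iX in auto)
    also have "\<dots> \<le> real (p m) * B"
    proof (rule mult_left_mono)
      have "(\<Sum>k=1..p m - 1. \<bar>b k\<bar>) \<le> (\<Sum>k=1..p m - 1. B0 * real k powr - (1 + \<beta> / 2))"
        using elim(1) unfolding b_def by (intro sum_mono) auto
      also have "\<dots> = B0 * (\<Sum>k=1..p m - 1. real k powr - (1 + \<beta> / 2))" by (simp add: sum_distrib_left)
      also have "\<dots> \<le> B0 * S" unfolding S_def using B0 \<beta> by (intro mult_left_mono sum_decay_le) auto
      finally show "b 0 + 2 * (\<Sum>k=1..p m - 1. \<bar>b k\<bar>) \<le> B" using elim(3) unfolding B_def b_def by linarith
    qed simp
    finally have "P.expectation m (\<lambda>\<omega>. (\<Sum>j\<in>{0<..0+p m}. X j \<omega>)\<^sup>2) \<le> B * real (p m)" by (simp add: mult.commute)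
    moreover have "integrable (M m) (\<lambda>\<omega>. (\<Sum>j\<in>{0<..0+p m}. X j \<omega>)\<^sup>2)"
      unfolding power2_eq_square sum_product by (intro Bochner_Integration.integrable_sum iX) auto
    ultimately show ?case unfolding e by blast
  qed
  moreover have "B \<ge> 0" using B0 S0 by (simp add: B_def)
  ultimately show ?thesis by blast
qed

text \<open>Tannery's theorem: covariances beyond lag \<open>l m\<close> are replaced by 0, and the
  decay bound is a summable majorant independent of the row. Keeping l below p ensures that all lags
  used exist in the row.\<close>

lemma partial_cov_sum_lim:
  assumes l: "filterlim l at_top sequentially" and lp: "\<forall>\<^sub>F m in sequentially. l m < p m"
  shows "(\<lambda>m. \<Sum>k=1..l m. cov (M m) (V m 1) (V m (1 + k))) \<longlonglongrightarrow> (\<Sum>k. g (Suc k))"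
    "summable (\<lambda>k. \<bar>g (Suc k)\<bar>)"
proof -
  obtain B where B: "B \<ge> 0" and ev1: "\<forall>\<^sub>F m in sequentially. \<forall>k. 1 \<le> k \<longrightarrow> k < p m \<longrightarrow>
    \<bar>cov (M m) (V m 1) (V m (1 + k))\<bar> \<le> B * real k powr - (1 + \<beta> / 2)" using cov_decay by blast
  define c where "c k m = (if Suc k \<le> l m then cov (M m) (V m 1) (V m (1 + Suc k)) else 0)" for k m
  have T: "eventually (\<lambda>m. summable (\<lambda>k. norm (c k m))) sequentially \<and> summable (\<lambda>k. norm (g (Suc k))) \<and>
     ((\<lambda>m. suminf (\<lambda>k. c k m)) \<longlongrightarrow> suminf (\<lambda>k. g (Suc k))) sequentially"
  proof (rule tannerys_theorem)
    show "(\<lambda>m. c k m) \<longlonglongrightarrow> g (Suc k)" for k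
    proof (rule Lim_transform_eventually[OF cov_lim[of "Suc k"]])
      have "\<forall>\<^sub>F m in sequentially. Suc k \<le> l m" using l by (simp add: filterlim_at_top)
      then show "\<forall>\<^sub>F m in sequentially. cov (M m) (V m 1) (V m (1 + Suc k)) = c k m"
        by eventually_elim (simp add: c_def)
    qed
    have "\<forall>\<^sub>F m in sequentially. \<forall>k. norm (c k m) \<le> B * real (Suc k) powr - (1 + \<beta> / 2)"
      using ev1 lp
    proof eventually_elim
      case (elim m)
      show ?case
      proof
        fix k
        show "norm (c k m) \<le> B * real (Suc k) powr - (1 + \<beta> / 2)"
          using elim(1)[rule_format, of "Suc k"] elim(2) B by (auto simp: c_def)
      qed
    qed
    then show "\<forall>\<^sub>F (k, m) in at_top \<times>\<^sub>F sequentially. norm (c k m) \<le> B * real (Suc k) powr - (1 + \<beta> / 2)"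
      unfolding eventually_prod_filter
      by (intro exI[of _ "\<lambda>_. True"] exI[of _ "\<lambda>m. \<forall>k. norm (c k m) \<le> B * real (Suc k) powr - (1 + \<beta> / 2)"]) auto
    show "summable (\<lambda>k. B * real (Suc k) powr - (1 + \<beta> / 2))"
      using \<beta> by (intro summable_mult summable_decay) auto
  qed simp
  have e: "(\<Sum>k. c k m) = (\<Sum>k=1..l m. cov (M m) (V m 1) (V m (1 + k)))" for m
  proof -
    have "(\<Sum>k. c k m) = (\<Sum>k<l m. c k m)" by (rule suminf_finite) (auto simp: c_def)
    also have "\<dots> = (\<Sum>k=1..l m. cov (M m) (V m 1) (V m (1 + k)))"
      by (rule sum.reindex_bij_witness[of _ "\<lambda>k. k - 1" Suc]) (auto simp: c_def)
    finally show ?thesis .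
  qed
  show "(\<lambda>m. \<Sum>k=1..l m. cov (M m) (V m 1) (V m (1 + k))) \<longlonglongrightarrow> (\<Sum>k. g (Suc k))" using T unfolding e by simp
  show "summable (\<lambda>k. \<bar>g (Suc k)\<bar>)" using T by simp
qed

lemma powr_p_lim: "e < 0 \<Longrightarrow> (\<lambda>m. real (p m) powr e) \<longlonglongrightarrow> 0"
  by (rule tendsto_neg_powr) (auto intro: filterlim_compose[OF filterlim_real_sequentially p_lim])

text \<open>
  Truncation level and mixing gap of the central limit theorem. The exponents leave room for
  the two error terms that pull in opposite directions: \<open>Kt ^ 4 * lt = o(sqrt p)\<close>, while the gap is
  still so long that \<open>sqrt p * Kt * al lt\<close> tends to \<open>0\<close>.
\<close>

definition Kt :: "nat \<Rightarrow> real" where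
  "Kt m = real (p m) powr (\<beta> / 64)"

definition lt :: "nat \<Rightarrow> nat" where
  "lt m = nat \<lceil>real (p m) powr (1/2 - \<beta> / 8)\<rceil>"

lemma Kt_ge1: "1 \<le> p m \<Longrightarrow> 1 \<le> Kt m"
  unfolding Kt_def using \<beta> by (intro ge_one_powr_ge_zero) auto

lemma lt_bounds:
  assumes "1 \<le> p m"
  shows "real (p m) powr (1/2 - \<beta> / 8) \<le> real (lt m)" "real (lt m) \<le> 2 * real (p m) powr (1/2 - \<beta> / 8)" "1 \<le> lt m"
proof -
  have 1: "1 \<le> real (p m) powr (1/2 - \<beta> / 8)" using assms \<beta> by (intro ge_one_powr_ge_zero) auto
  show "real (p m) powr (1/2 - \<beta> / 8) \<le> real (lt m)" unfolding lt_def by linarith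
  then show "1 \<le> lt m" using 1 by linarith
  have "real (lt m) \<le> real (p m) powr (1/2 - \<beta> / 8) + 1" unfolding lt_def using 1 by linarith
  then show "real (lt m) \<le> 2 * real (p m) powr (1/2 - \<beta> / 8)" using 1 by linarith
qed

lemma sqrt_powr: "sqrt (real n) = real n powr (1/2)"
  by (simp add: powr_half_sqrt)

text \<open>The exponents of p add up to beta/16 + (1/2 - beta/8) - 1/2 = -beta/16.\<close>

lemma Kt_power_lt_lim: "(\<lambda>m. Kt m ^ 4 * real (lt m) / sqrt (real (p m))) \<longlonglongrightarrow> 0"
proof (rule tendsto_sandwich[OF _ _ tendsto_const])
  show "\<forall>\<^sub>F m in sequentially. 0 \<le> Kt m ^ 4 * real (lt m) / sqrt (real (p m))"
    by (simp add: Kt_def)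
  show "\<forall>\<^sub>F m in sequentially. Kt m ^ 4 * real (lt m) / sqrt (real (p m)) \<le> 2 * real (p m) powr - (\<beta> / 16)"
    using ev_p_ge[of 1]
  proof eventually_elim
    case (elim m)
    have "Kt m ^ 4 * real (lt m) / sqrt (real (p m)) \<le> Kt m ^ 4 * (2 * real (p m) powr (1/2 - \<beta> / 8)) / sqrt (real (p m))"
      using lt_bounds(2)[OF elim] by (intro divide_right_mono mult_left_mono) (auto simp: Kt_def)
    also have "\<dots> = 2 * (real (p m) powr (\<beta> / 16) * real (p m) powr (1/2 - \<beta> / 8) * real (p m) powr - (1/2))"
      using elim unfolding Kt_def sqrt_powr powr_minus divide_inverse[of _ "_ powr _"] by (simp add: powr_power)
    also have "\<dots> = 2 * real (p m) powr - (\<beta> / 16)"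
      unfolding powr_add[symmetric] by (simp add: field_simps)
    finally show ?case .
  qed
  show "(\<lambda>m. 2 * real (p m) powr - (\<beta> / 16)) \<longlonglongrightarrow> 0"
    using tendsto_mult_right_zero[OF powr_p_lim[of "- (\<beta> / 16)"]] \<beta> by simp
qed

lemma lt_Kt_over_sqrt_p_lim: "(\<lambda>m. real (2 * lt m + 1) * Kt m / sqrt (real (p m))) \<longlonglongrightarrow> 0"
proof (rule tendsto_sandwich[OF _ _ tendsto_const])
  show "\<forall>\<^sub>F m in sequentially. 0 \<le> real (2 * lt m + 1) * Kt m / sqrt (real (p m))"
    by (simp add: Kt_def)
  show "\<forall>\<^sub>F m in sequentially. real (2 * lt m + 1) * Kt m / sqrt (real (p m)) \<le> 3 * (Kt m ^ 4 * real (lt m) / sqrt (real (p m)))"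
    using ev_p_ge[of 1]
  proof eventually_elim
    case (elim m)
    have "real (2 * lt m + 1) \<le> 3 * real (lt m)" using lt_bounds(3)[OF elim] by simp
    moreover have "Kt m \<le> Kt m ^ 4" using Kt_ge1[OF elim] power_increasing[of 1 4 "Kt m"] by simp
    ultimately have "real (2 * lt m + 1) * Kt m \<le> (3 * real (lt m)) * Kt m ^ 4"
      by (intro mult_mono) (auto simp: Kt_def)
    then have "real (2 * lt m + 1) * Kt m / sqrt (real (p m)) \<le> (3 * real (lt m)) * Kt m ^ 4 / sqrt (real (p m))"
      by (intro divide_right_mono) auto
    then show ?case by (simp add: mult_ac)
  qed
  show "(\<lambda>m. 3 * (Kt m ^ 4 * real (lt m) / sqrt (real (p m)))) \<longlonglongrightarrow> 0"
    using tendsto_mult_right_zero[OF Kt_power_lt_lim] by simp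
qed

text \<open>The weight e takes the values 0 and 1 below: the linear mixing error carries no factor
  of the gap, the quadratic one carries a factor \<open>lt\<close>.\<close>

lemma al_lt:
  assumes "1 \<le> p m" "0 \<le> e" "e \<le> 1 + \<beta>"
  shows "real (lt m) powr e * al (lt m + 1) \<le> Ca * real (p m) powr - ((1/2 - \<beta> / 8) * (1 + \<beta> - e))"
proof -
  have l1: "1 \<le> real (lt m)" using lt_bounds(3)[OF assms(1)] by simp
  have "al (lt m + 1) \<le> Ca * real (lt m + 1) powr - (1 + \<beta>)" by (rule al_bound) simp
  also have "\<dots> \<le> Ca * real (lt m) powr - (1 + \<beta>)"
    using Ca_nonneg l1 \<beta> by (intro mult_left_mono powr_mono2') auto
  finally have "real (lt m) powr e * al (lt m + 1) \<le> real (lt m) powr e * (Ca * real (lt m) powr - (1 + \<beta>))"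
    by (intro mult_left_mono) auto
  also have "\<dots> = Ca * real (lt m) powr - (1 + \<beta> - e)"
  proof -
    have "real (lt m) powr e * real (lt m) powr - (1 + \<beta>) = real (lt m) powr - (1 + \<beta> - e)"
      unfolding powr_add[symmetric] by (simp add: algebra_simps)
    then show ?thesis by (metis mult.left_commute)
  qed
  also have "\<dots> \<le> Ca * (real (p m) powr (1/2 - \<beta> / 8)) powr - (1 + \<beta> - e)"
    using Ca_nonneg lt_bounds(1)[OF assms(1)] assms by (intro mult_left_mono powr_mono2') auto
  also have "\<dots> = Ca * real (p m) powr - ((1/2 - \<beta> / 8) * (1 + \<beta> - e))"
    by (simp only: powr_powr mult_minus_right)
  finally show ?thesis .
qed

lemma sqrt_p_Kt_al_lim: "(\<lambda>m. sqrt (real (p m)) * Kt m * al (lt m + 1)) \<longlonglongrightarrow> 0"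
proof (rule tendsto_sandwich[OF _ _ tendsto_const])
  show "\<forall>\<^sub>F m in sequentially. 0 \<le> sqrt (real (p m)) * Kt m * al (lt m + 1)"
    by (simp add: Kt_def al_nonneg)
  \<comment> \<open>The total exponent of p. As beta^2 is at most beta, it is at most beta/64 -
    beta/4.\<close>
  define e where "e = 1/2 + \<beta> / 64 + - ((1/2 - \<beta> / 8) * (1 + \<beta> - 0))"
  have "\<beta> * \<beta> \<le> \<beta> * 1" using \<beta> by (intro mult_left_mono) auto
  moreover have "(1/2 - \<beta> / 8) * (1 + \<beta> - 0) = 1/2 + \<beta> / 2 - \<beta> / 8 - (\<beta> * \<beta>) / 8" by (simp add: field_simps)
  ultimately have e: "e < 0" using \<beta> unfolding e_def by linarith
  show "\<forall>\<^sub>F m in sequentially. sqrt (real (p m)) * Kt m * al (lt m + 1) \<le> Ca * real (p m) powr e"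
    using ev_p_ge[of 1]
  proof eventually_elim
    case (elim m)
    have l0: "real (lt m) powr 0 = 1" using lt_bounds(3)[OF elim] by simp
    have "sqrt (real (p m)) * Kt m * al (lt m + 1) \<le> sqrt (real (p m)) * Kt m * (Ca * real (p m) powr - ((1/2 - \<beta> / 8) * (1 + \<beta> - 0)))"
      using al_lt[OF elim, of 0] \<beta> unfolding l0 by (intro mult_left_mono) (auto simp: Kt_def)
    also have "\<dots> = Ca * (real (p m) powr (1/2) * real (p m) powr (\<beta> / 64) * real (p m) powr - ((1/2 - \<beta> / 8) * (1 + \<beta> - 0)))"
      unfolding Kt_def sqrt_powr by (simp only: mult_ac)
    also have "\<dots> = Ca * real (p m) powr e"
      unfolding powr_add[symmetric] e_def ..
    finally show ?case .
  qed
  show "(\<lambda>m. Ca * real (p m) powr e) \<longlonglongrightarrow> 0"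
    using tendsto_mult_right_zero[OF powr_p_lim[OF e]] by simp
qed

lemma lt_Kt_sq_al_lim: "(\<lambda>m. real (lt m) * (Kt m)\<^sup>2 * al (lt m + 1)) \<longlonglongrightarrow> 0"
proof (rule tendsto_sandwich[OF _ _ tendsto_const])
  show "\<forall>\<^sub>F m in sequentially. 0 \<le> real (lt m) * (Kt m)\<^sup>2 * al (lt m + 1)"
    by (simp add: Kt_def al_nonneg)
  \<comment> \<open>By the same estimate of beta^2 this exponent is at most beta/32 - 3
    beta/8.\<close>
  define e where "e = \<beta> / 32 + - ((1/2 - \<beta> / 8) * (1 + \<beta> - 1))"
  have "\<beta> * \<beta> \<le> \<beta> * 1" using \<beta> by (intro mult_left_mono) auto
  moreover have "(1/2 - \<beta> / 8) * (1 + \<beta> - 1) = \<beta> / 2 - (\<beta> * \<beta>) / 8" by (simp add: algebra_simps)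
  ultimately have e: "e < 0" using \<beta> unfolding e_def by linarith
  show "\<forall>\<^sub>F m in sequentially. real (lt m) * (Kt m)\<^sup>2 * al (lt m + 1) \<le> Ca * real (p m) powr e"
    using ev_p_ge[of 1]
  proof eventually_elim
    case (elim m)
    have l1: "real (lt m) powr 1 = real (lt m)" by simp
    have "real (lt m) * (Kt m)\<^sup>2 * al (lt m + 1) = (Kt m)\<^sup>2 * (real (lt m) * al (lt m + 1))" by simp
    also have "\<dots> \<le> (Kt m)\<^sup>2 * (Ca * real (p m) powr - ((1/2 - \<beta> / 8) * (1 + \<beta> - 1)))"
      using al_lt[OF elim, of 1] \<beta> unfolding l1 by (intro mult_left_mono) auto
    also have "\<dots> = Ca * (real (p m) powr (\<beta> / 32) * real (p m) powr - ((1/2 - \<beta> / 8) * (1 + \<beta> - 1)))"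
      using elim unfolding Kt_def by (simp add: powr_power)
    also have "\<dots> = Ca * real (p m) powr e"
      unfolding powr_add[symmetric] e_def ..
    finally show ?case .
  qed
  show "(\<lambda>m. Ca * real (p m) powr e) \<longlonglongrightarrow> 0"
    using tendsto_mult_right_zero[OF powr_p_lim[OF e]] by simp
qed

lemma lt_at_top: "filterlim lt at_top sequentially"
proof -
  have "filterlim (\<lambda>m. real (p m) powr (1/2 - \<beta> / 8)) at_top sequentially"
    using \<beta> by (intro filterlim_compose[OF real_powr_at_top] filterlim_compose[OF filterlim_real_sequentially p_lim]) auto
  then have "filterlim (\<lambda>m. real (lt m)) at_top sequentially"
    by (rule filterlim_at_top_mono) (use ev_p_ge[of 1] lt_bounds(1) in \<open>auto elim: eventually_mono\<close>)
  then show ?thesis by (simp add: filterlim_sequentially_iff_filterlim_real)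
qed

lemma ev_lt_less_p: "\<forall>\<^sub>F m in sequentially. 2 * lt m + 1 \<le> p m"
proof -
  have "\<forall>\<^sub>F m in sequentially. real (2 * lt m + 1) * Kt m / sqrt (real (p m)) < 1"
    using lt_Kt_over_sqrt_p_lim by (rule order_tendstoD) simp
  then show ?thesis using ev_p_ge[of 1]
  proof eventually_elim
    case (elim m)
    have "real (2 * lt m + 1) * 1 \<le> real (2 * lt m + 1) * Kt m" using Kt_ge1[OF elim(2)] by (intro mult_left_mono) auto
    also have "\<dots> \<le> sqrt (real (p m))" using elim by (simp add: divide_less_eq)
    also have "\<dots> \<le> real (p m)" using elim(2) by (simp add: real_sqrt_le_iff' power2_eq_square real_le_lsqrt)
    finally show ?case unfolding mult_1_right of_nat_le_iff .
  qed
qed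

lemma lt_over_p: "(\<lambda>m. real (2 * lt m + 1) / real (p m)) \<longlonglongrightarrow> 0"
proof (rule tendsto_sandwich[OF _ _ tendsto_const lt_Kt_over_sqrt_p_lim])
  show "\<forall>\<^sub>F m in sequentially. real (2 * lt m + 1) / real (p m) \<le> real (2 * lt m + 1) * Kt m / sqrt (real (p m))"
    using ev_p_ge[of 1]
  proof eventually_elim
    case (elim m)
    have "sqrt (real (p m)) \<le> real (p m)" using elim by (simp add: real_sqrt_le_iff' power2_eq_square real_le_lsqrt)
    moreover have "real (2 * lt m + 1) * 1 \<le> real (2 * lt m + 1) * Kt m" using Kt_ge1[OF elim] by (intro mult_left_mono) auto
    ultimately show ?case using elim by (intro frac_le) auto
  qed
qed simp

text \<open>Three comparisons: the sum with its truncation, the truncation with the exponential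
  supplied by \<open>char_sum_approx\<close>, and that exponential with its limit. The frequency
  \<open>lam\<close> is a convergent sequence because the later normalization by tau varies with the
  row.\<close>

lemma char_clt:
  assumes lam: "lam \<longlonglongrightarrow> lam0" and pos: "0 < g 0 + 2 * (\<Sum>k. g (Suc k))"
  shows "(\<lambda>m. P.expectation m (\<lambda>\<omega>. iexp (lam m / sqrt (real (p m)) * ((\<Sum>j=1..p m. V m j \<omega>) - (\<Sum>j=1..p m. P.expectation m (V m j))))))
     \<longlonglongrightarrow> complex_of_real (exp (- (lam0\<^sup>2 * (g 0 + 2 * (\<Sum>k. g (Suc k))) / 2)))"
proof -
  define \<sigma> where "\<sigma> = g 0 + 2 * (\<Sum>k. g (Suc k))"
  \<comment> \<open>Chosen so that the power q of the truncation level p^(beta/64) is at least p^2;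
    the errors of p truncated summands then still total O(1/p).\<close>
  define q where "q = nat \<lceil>128 / \<beta>\<rceil>"
  have q: "\<beta> / 64 * real q \<ge> 2"
  proof -
    have "128 / \<beta> \<le> real q" unfolding q_def by linarith
    then show ?thesis using \<beta> by (simp add: divide_le_eq mult.commute)
  qed
  obtain C where C: "C \<ge> 0" and ev: "\<forall>\<^sub>F m in sequentially. (\<forall>j\<in>{1..p m}. \<forall>\<omega>\<in>space (M m). 0 \<le> V m j \<omega>) \<and>
     (\<forall>j\<in>{1..p m}. \<forall>n\<in>{1, 2, Suc q, 2 * Suc q}. integrable (M m) (\<lambda>\<omega>. V m j \<omega> ^ n) \<and> (\<integral>\<omega>. V m j \<omega> ^ n \<partial>M m) \<le> C)"
    using good_moments[of q] by blast
  define A where "A = 2 * C + 2 * C\<^sup>2"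
  have A0: "A \<ge> 0" using C by (simp add: A_def)
  define S where "S = (\<Sum>k. real (Suc k) powr - (1 + \<beta>))"
  have S0: "0 \<le> S" unfolding S_def by (intro suminf_nonneg summable_decay) (use \<beta> in auto)
  define Cc where "Cc = 1 + 8 * (Ca * S)"
  have Cc: "1 \<le> Cc" using Ca_nonneg S0 by (simp add: Cc_def)
  have alS: "1 + 8 * (\<Sum>k=1..n. al k) \<le> Cc" for n
  proof -
    have "(\<Sum>k=1..n. al k) \<le> (\<Sum>k=1..n. Ca * real k powr - (1 + \<beta>))" by (intro sum_mono al_bound) auto
    also have "\<dots> \<le> Ca * S" unfolding S_def sum_distrib_left[symmetric]
      using Ca_nonneg \<beta> by (intro mult_left_mono sum_decay_le) auto
    finally show ?thesis by (simp add: Cc_def)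
  qed
  define u where "u m = lam m / sqrt (real (p m))" for m
  define s where "s m = tc m (Kt m) 0 + 2 * (\<Sum>k=1..lt m. tc m (Kt m) k)" for m
  define c where "c m k = cov (M m) (V m 1) (V m (1 + k))" for m k
  have Kq: "Kt m ^ q \<ge> (real (p m))\<^sup>2" if "1 \<le> p m" for m
  proof -
    have "Kt m ^ q = real (p m) powr (\<beta> / 64 * real q)" unfolding Kt_def using that by (simp add: powr_power mult.commute)
    also have "\<dots> \<ge> real (p m) powr 2" using that q by (intro powr_mono) auto
    finally show ?thesis using that by simp
  qed
  have ev1: "\<forall>\<^sub>F m in sequentially. 1 \<le> p m \<and> 2 * lt m + 1 \<le> p m \<and> (\<forall>j\<in>{1..p m}. \<forall>\<omega>\<in>space (M m). 0 \<le> V m j \<omega>) \<and>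
     (\<forall>j\<in>{1..p m}. \<forall>n\<in>{1, 2, Suc q, 2 * Suc q}. integrable (M m) (\<lambda>\<omega>. V m j \<omega> ^ n) \<and> (\<integral>\<omega>. V m j \<omega> ^ n \<partial>M m) \<le> C)"
    using ev ev_p_ge[of 1] ev_lt_less_p by eventually_elim blast
  have inv_p: "(\<lambda>m. B / real (p m)) \<longlonglongrightarrow> 0" for B
    by (rule tendsto_divide_0[OF tendsto_const]) (intro filterlim_at_top_imp_at_infinity filterlim_compose[OF filterlim_real_sequentially p_lim])
  \<comment> \<open>Each truncated covariance is off by O(p^-2); with total weight 2 l + 1, at most
    p, the truncated long-run variance is off by O(1/p).\<close>
  have s_lim: "s \<longlonglongrightarrow> \<sigma>"
  proof -
    have "\<forall>\<^sub>F m in sequentially. lt m < p m" using ev_lt_less_p by eventually_elim simp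
    from partial_cov_sum_lim(1)[OF lt_at_top this]
    have 1: "(\<lambda>m. c m 0 + 2 * (\<Sum>k=1..lt m. c m k)) \<longlonglongrightarrow> \<sigma>"
      unfolding \<sigma>_def c_def using cov_lim[of 0] by (intro tendsto_intros) auto
    have "(\<lambda>m. s m - (c m 0 + 2 * (\<Sum>k=1..lt m. c m k))) \<longlonglongrightarrow> 0"
    proof (rule Lim_null_comparison[OF _ inv_p[of A]])
      show "\<forall>\<^sub>F m in sequentially. norm (s m - (c m 0 + 2 * (\<Sum>k=1..lt m. c m k))) \<le> A / real (p m)"
        using ev1
      proof eventually_elim
        case (elim m)
        then have p1: "1 \<le> p m" by simp
        have d: "\<bar>c m k - tc m (Kt m) k\<bar> \<le> A / (real (p m))\<^sup>2" if "k < p m" for k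
        proof -
          have "\<bar>c m k - tc m (Kt m) k\<bar> \<le> A / Kt m ^ q"
            unfolding c_def A_def by (rule tc_error) (use elim Kt_ge1[OF p1] that in auto)
          also have "\<dots> \<le> A / (real (p m))\<^sup>2" using Kq[OF p1] A0 p1 by (intro divide_left_mono mult_pos_pos) (auto simp: Kt_def)
          finally show ?thesis .
        qed
        have "s m - (c m 0 + 2 * (\<Sum>k=1..lt m. c m k)) = (tc m (Kt m) 0 - c m 0) + 2 * (\<Sum>k=1..lt m. tc m (Kt m) k - c m k)"
          by (simp add: s_def sum_subtractf)
        moreover have "\<bar>\<Sum>k=1..lt m. tc m (Kt m) k - c m k\<bar> \<le> (\<Sum>k=1..lt m. A / (real (p m))\<^sup>2)"
          using d elim by (intro order_trans[OF sum_abs] sum_mono) (auto simp: abs_minus_commute)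
        moreover have "\<bar>tc m (Kt m) 0 - c m 0\<bar> \<le> A / (real (p m))\<^sup>2" using d[of 0] p1 by (simp add: abs_minus_commute)
        ultimately have "\<bar>s m - (c m 0 + 2 * (\<Sum>k=1..lt m. c m k))\<bar> \<le> A / (real (p m))\<^sup>2 + 2 * (real (lt m) * (A / (real (p m))\<^sup>2))"
          by simp
        also have "\<dots> = real (2 * lt m + 1) * (A / (real (p m))\<^sup>2)" by (simp add: algebra_simps)
        also have "\<dots> \<le> real (p m) * (A / (real (p m))\<^sup>2)" using elim A0 by (intro mult_right_mono) auto
        also have "\<dots> = A / real (p m)" using p1 by (simp add: power2_eq_square)
        finally show ?case by simp
      qed
    qed
    from tendsto_add[OF this 1] show ?thesis by simp
  qed
  define E where "E m = real (p m) * (7 * \<bar>u m\<bar> ^ 3 * Kt m ^ 4 * Cc\<^sup>2 * real (lt m) + (8 * \<bar>u m\<bar> * Kt m + 16 * (u m)\<^sup>2 * real (lt m) * (Kt m)\<^sup>2) * al (lt m + 1) + ((u m)\<^sup>2 * s m / 2)\<^sup>2)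
      + \<bar>u m\<bar> * real (2 * lt m + 1) * Kt m" for m
  have E_lim: "E \<longlonglongrightarrow> 0"
  proof -
    \<comment> \<open>The error bound \<open>E\<close> rearranged, with u = lam / sqrt p, so that
      each term is a convergent factor times one of the quantities already shown to vanish.\<close>
    define F where "F m = 7 * Cc\<^sup>2 * \<bar>lam m\<bar> ^ 3 * (Kt m ^ 4 * real (lt m) / sqrt (real (p m)))
      + 8 * \<bar>lam m\<bar> * (sqrt (real (p m)) * Kt m * al (lt m + 1))
      + 16 * (lam m)\<^sup>2 * (real (lt m) * (Kt m)\<^sup>2 * al (lt m + 1))
      + (lam m) ^ 4 * (s m)\<^sup>2 * (1/4 / real (p m)) + \<bar>lam m\<bar> * (real (2 * lt m + 1) * Kt m / sqrt (real (p m)))" for m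
    have "F \<longlonglongrightarrow> 7 * Cc\<^sup>2 * \<bar>lam0\<bar> ^ 3 * 0 + 8 * \<bar>lam0\<bar> * 0 + 16 * lam0\<^sup>2 * 0 + lam0 ^ 4 * \<sigma>\<^sup>2 * 0 + \<bar>lam0\<bar> * 0"
      unfolding F_def
      by (intro tendsto_intros lam s_lim Kt_power_lt_lim sqrt_p_Kt_al_lim lt_Kt_sq_al_lim lt_Kt_over_sqrt_p_lim inv_p)
    then have "F \<longlonglongrightarrow> 0" by simp
    moreover have "\<forall>\<^sub>F m in sequentially. F m = E m"
      using ev_p_ge[of 1]
    proof eventually_elim
      case (elim m)
      define r where "r = sqrt (real (p m))"
      have r: "r > 0" using elim by (simp add: r_def)
      have rr: "real (p m) = r * r" by (simp add: r_def)
      have u: "\<bar>u m\<bar> = \<bar>lam m\<bar> / r" "(u m)\<^sup>2 = (lam m)\<^sup>2 / (r * r)"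
        using r by (simp_all add: u_def r_def power_divide)
      have t1: "(r * r) * (7 * (\<bar>lam m\<bar> / r) ^ 3 * a * b * l) = 7 * b * \<bar>lam m\<bar> ^ 3 * (a * l / r)" for a b l
        using r by (simp add: power_divide power3_eq_cube field_simps)
      have t2: "(r * r) * ((8 * (\<bar>lam m\<bar> / r) * k + 16 * ((lam m)\<^sup>2 / (r * r)) * l * k2) * a) = 8 * \<bar>lam m\<bar> * (r * k * a) + 16 * (lam m)\<^sup>2 * (l * k2 * a)" for k l k2 a
        using r by (simp add: field_simps)
      have t3: "(r * r) * ((lam m)\<^sup>2 / (r * r) * x / 2)\<^sup>2 = (lam m) ^ 4 * x\<^sup>2 * (1/4 / (r * r))" for x
        using r by (simp add: power2_eq_square power4_eq_xxxx field_simps)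
      show ?case unfolding E_def F_def r_def[symmetric] u rr distrib_left t1 t2 t3 using r by (simp add: mult.assoc)
    qed
    ultimately show ?thesis by (rule Lim_transform_eventually)
  qed
  define Z where "Z m \<omega> = (\<Sum>j=1..p m. V m j \<omega>) - (\<Sum>j=1..p m. P.expectation m (V m j))" for m \<omega>
  define T where "T m \<omega> = (\<Sum>j=1..p m. tX m (Kt m) j \<omega>)" for m \<omega>
  define x where "x m = (u m)\<^sup>2 * s m / 2 * real (p m - (2 * lt m + 1))" for m
  have "\<forall>\<^sub>F m in sequentially. 0 < s m" using s_lim pos unfolding \<sigma>_def[symmetric] by (rule order_tendstoD)
  then have b1: "\<forall>\<^sub>F m in sequentially. cmod (P.expectation m (\<lambda>\<omega>. iexp (u m * T m \<omega>)) - exp (- x m)) \<le> E m"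
    using ev1
  proof eventually_elim
    case (elim m)
    then have p1: "1 \<le> p m" by simp
    interpret B: bounded_mixing "M m" "tX m (Kt m)" "p m" al "Kt m" "tc m (Kt m)"
      by (rule tX_bounded_mixing) (use elim Kt_ge1[OF p1] in auto)
    have "cmod (P.expectation m (\<lambda>\<omega>. iexp (u m * B.T (p m) \<omega>)) - exp (- ((u m)\<^sup>2 * s m / 2) * real (p m - (2 * lt m + 1)))) \<le> E m"
      unfolding E_def s_def
      by (rule B.char_sum_approx[OF lt_bounds(3)[OF p1] _ Cc alS al_nonneg]) (use elim in \<open>auto simp: s_def\<close>)
    then show ?case unfolding B.T_def T_def x_def by simp
  qed
  have x_lim: "x \<longlonglongrightarrow> lam0\<^sup>2 * \<sigma> / 2"
  proof -
    have "(\<lambda>m. (lam m)\<^sup>2 * s m / 2 * (1 - real (2 * lt m + 1) / real (p m))) \<longlonglongrightarrow> lam0\<^sup>2 * \<sigma> / 2 * (1 - 0)"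
      by (intro tendsto_intros lam s_lim lt_over_p) simp
    moreover have "\<forall>\<^sub>F m in sequentially. (lam m)\<^sup>2 * s m / 2 * (1 - real (2 * lt m + 1) / real (p m)) = x m"
      using ev1
    proof eventually_elim
      case (elim m)
      then have "real (p m - (2 * lt m + 1)) = real (p m) - real (2 * lt m + 1)" by (simp add: of_nat_diff)
      moreover have "1 - real (2 * lt m + 1) / real (p m) = (real (p m) - real (2 * lt m + 1)) / real (p m)"
        using elim by (simp add: diff_divide_distrib)
      ultimately show ?case unfolding x_def u_def by (simp add: power_divide)
    qed
    ultimately show ?thesis by (simp add: Lim_transform_eventually)
  qed
  have l1: "(\<lambda>m. P.expectation m (\<lambda>\<omega>. iexp (u m * T m \<omega>)) - exp (- x m)) \<longlonglongrightarrow> 0"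
    by (rule Lim_null_comparison[OF b1 E_lim])
  have l2: "(\<lambda>m. P.expectation m (\<lambda>\<omega>. iexp (u m * Z m \<omega>)) - P.expectation m (\<lambda>\<omega>. iexp (u m * T m \<omega>))) \<longlonglongrightarrow> 0"
  proof (rule Lim_null_comparison)
    have "(\<lambda>m. \<bar>lam m\<bar> * (2 * C / real (p m))) \<longlonglongrightarrow> \<bar>lam0\<bar> * 0"
      by (intro tendsto_intros lam inv_p)
    then show "(\<lambda>m. \<bar>lam m\<bar> * (2 * C / real (p m))) \<longlonglongrightarrow> 0" by simp
    show "\<forall>\<^sub>F m in sequentially. norm (P.expectation m (\<lambda>\<omega>. iexp (u m * Z m \<omega>)) - P.expectation m (\<lambda>\<omega>. iexp (u m * T m \<omega>))) \<le> \<bar>lam m\<bar> * (2 * C / real (p m))"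
      using ev1
    proof eventually_elim
      case (elim m)
      then have p1: "1 \<le> p m" by simp
      note K1 = Kt_ge1[OF p1]
      define d where "d j \<omega> = V m j \<omega> - min (V m j \<omega>) (Kt m)" for j \<omega>
      have iV: "integrable (M m) (V m j)" if "j \<in> {1..p m}" for j using elim that by (auto dest!: bspec)
      have im: "integrable (M m) (\<lambda>\<omega>. min (V m j \<omega>) (Kt m))" if "j \<in> {1..p m}" for j
        using V_meas[OF that] elim that K1 by (intro P.integrable_const_bound[where B="Kt m"]) (auto simp: min_def)
      have id: "integrable (M m) (d j)" if "j \<in> {1..p m}" for j using iV[OF that] im[OF that] by (simp add: d_def[abs_def])
      have d0: "0 \<le> d j \<omega>" for j \<omega> by (simp add: d_def)
      have Ed: "0 \<le> P.expectation m (d j) \<and> P.expectation m (d j) \<le> C / (real (p m))\<^sup>2" if j: "j \<in> {1..p m}" for j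
      proof
        show "0 \<le> P.expectation m (d j)" using d0 by (intro integral_nonneg_AE) auto
        have iq: "integrable (M m) (\<lambda>\<omega>. V m j \<omega> ^ Suc q)" "P.expectation m (\<lambda>\<omega>. V m j \<omega> ^ Suc q) \<le> C" using elim j by blast+
        have "P.expectation m (d j) \<le> P.expectation m (\<lambda>\<omega>. V m j \<omega> ^ Suc q / Kt m ^ q)"
          using id[OF j] iq(1) elim j trunc_error(2)[OF _ K1, of "V m j _" q] by (intro integral_mono) (auto simp: d_def)
        also have "\<dots> = P.expectation m (\<lambda>\<omega>. V m j \<omega> ^ Suc q) / Kt m ^ q" by simp
        also have "\<dots> \<le> C / (real (p m))\<^sup>2"
          using Kq[OF p1] iq(2) C p1 by (intro frac_le) auto
        finally show "P.expectation m (d j) \<le> C / (real (p m))\<^sup>2" .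
      qed
      have ZT: "Z m \<omega> - T m \<omega> = (\<Sum>j=1..p m. d j \<omega> - P.expectation m (d j))" for \<omega>
      proof -
        have "(\<Sum>j=1..p m. d j \<omega> - P.expectation m (d j)) = (\<Sum>j=1..p m. (V m j \<omega> - P.expectation m (V m j)) - tX m (Kt m) j \<omega>)"
          by (rule sum.cong) (use iV im in \<open>auto simp: d_def[abs_def] tX_def\<close>)
        then show ?thesis by (simp add: Z_def T_def sum_subtractf)
      qed
      have Zm: "Z m \<in> borel_measurable (M m)" unfolding Z_def[abs_def] by (intro borel_measurable_diff borel_measurable_sum V_meas borel_measurable_const) auto
      have Tm: "T m \<in> borel_measurable (M m)" unfolding T_def[abs_def] tX_def
        by (intro borel_measurable_diff borel_measurable_sum borel_measurable_min V_meas borel_measurable_const) auto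
      have ii: "integrable (M m) (\<lambda>\<omega>. iexp (u m * f \<omega>))" if "f \<in> borel_measurable (M m)" for f
        using that by (intro P.integrable_const_bound[where B=1]) (auto simp del: of_real_mult)
      have "P.expectation m (\<lambda>\<omega>. iexp (u m * Z m \<omega>)) - P.expectation m (\<lambda>\<omega>. iexp (u m * T m \<omega>))
         = P.expectation m (\<lambda>\<omega>. iexp (u m * Z m \<omega>) - iexp (u m * T m \<omega>))"
        using ii[OF Zm] ii[OF Tm] by simp
      also have "cmod \<dots> \<le> P.expectation m (\<lambda>\<omega>. cmod (iexp (u m * Z m \<omega>) - iexp (u m * T m \<omega>)))" by (rule integral_norm_bound)
      also have "\<dots> \<le> P.expectation m (\<lambda>\<omega>. \<bar>u m\<bar> * (\<Sum>j=1..p m. d j \<omega> + P.expectation m (d j)))"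
      proof (rule integral_mono)
        show "integrable (M m) (\<lambda>\<omega>. cmod (iexp (u m * Z m \<omega>) - iexp (u m * T m \<omega>)))"
          by (intro integrable_norm Bochner_Integration.integrable_diff ii Zm Tm)
        show "integrable (M m) (\<lambda>\<omega>. \<bar>u m\<bar> * (\<Sum>j=1..p m. d j \<omega> + P.expectation m (d j)))"
          by (intro integrable_mult_right Bochner_Integration.integrable_sum Bochner_Integration.integrable_add id) auto
        fix \<omega>
        have "iexp (u m * Z m \<omega>) - iexp (u m * T m \<omega>) = iexp (u m * T m \<omega>) * (iexp (u m * (Z m \<omega> - T m \<omega>)) - 1)"
          by (simp add: algebra_simps exp_add[symmetric])
        then have "cmod (iexp (u m * Z m \<omega>) - iexp (u m * T m \<omega>)) = cmod (iexp (u m * (Z m \<omega> - T m \<omega>)) - 1)"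
          by (simp only: norm_mult norm_exp_i_times mult_1)
        also have "\<dots> \<le> \<bar>u m\<bar> * \<bar>Z m \<omega> - T m \<omega>\<bar>" using iexp_bound1[of "u m * (Z m \<omega> - T m \<omega>)"] unfolding abs_mult .
        also have "\<dots> \<le> \<bar>u m\<bar> * (\<Sum>j=1..p m. d j \<omega> + P.expectation m (d j))"
          unfolding ZT using d0 Ed
          by (intro mult_left_mono order_trans[OF sum_abs] sum_mono) (auto simp: abs_le_iff intro: order_trans[of _ 0] add_nonneg_nonneg)
        finally show "cmod (iexp (u m * Z m \<omega>) - iexp (u m * T m \<omega>)) \<le> \<bar>u m\<bar> * (\<Sum>j=1..p m. d j \<omega> + P.expectation m (d j))" .
      qed
      also have "\<dots> = \<bar>u m\<bar> * (\<Sum>j=1..p m. 2 * P.expectation m (d j))"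
      proof -
        have "P.expectation m (\<lambda>\<omega>. \<Sum>j=1..p m. d j \<omega> + P.expectation m (d j)) = (\<Sum>j=1..p m. P.expectation m (\<lambda>\<omega>. d j \<omega> + P.expectation m (d j)))"
          by (rule Bochner_Integration.integral_sum) (use id in auto)
        also have "\<dots> = (\<Sum>j=1..p m. 2 * P.expectation m (d j))"
          by (rule sum.cong) (use id P.prob_space in auto)
        finally show ?thesis by simp
      qed
      also have "\<dots> \<le> \<bar>u m\<bar> * (\<Sum>j=1..p m. 2 * (C / (real (p m))\<^sup>2))"
        using Ed by (intro mult_left_mono sum_mono) auto
      also have "\<dots> = \<bar>u m\<bar> * (2 * C / real (p m))" using p1 by (simp add: power2_eq_square)
      also have "\<dots> \<le> \<bar>lam m\<bar> * (2 * C / real (p m))"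
      proof (rule mult_right_mono)
        have "1 \<le> sqrt (real (p m))" using p1 by simp
        then show "\<bar>u m\<bar> \<le> \<bar>lam m\<bar>" unfolding u_def by (simp add: abs_divide divide_le_eq mult_le_cancel_left1)
      qed (use C in simp)
      finally show ?case .
    qed
  qed
  have l3: "(\<lambda>m. complex_of_real (exp (- x m))) \<longlonglongrightarrow> complex_of_real (exp (- (lam0\<^sup>2 * \<sigma> / 2)))"
    by (intro tendsto_intros x_lim)
  from tendsto_add[OF tendsto_add[OF l2 l1] l3]
  show ?thesis unfolding Z_def u_def \<sigma>_def by simp
qed

end

section \<open>Digamma differences and the normal distribution function\<close>

definition Dfun' :: "real \<Rightarrow> real" where
  "Dfun' x = (Polygamma 1 ((x + 1) / 2) - Polygamma 1 (x / 2)) / 2"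

lemma Polygamma_deriv_real:
  fixes f :: "real \<Rightarrow> real"
  assumes "(f has_real_derivative f') (at x)" "f x > 0"
  shows "((\<lambda>x. Polygamma n (f x)) has_real_derivative Polygamma (Suc n) (f x) * f') (at x)"
proof (rule DERIV_chain2[where g=f])
  have "f x \<notin> \<int>\<^sub>\<le>\<^sub>0" using assms(2) by (meson nonpos_Ints_nonpos not_le)
  then show "(Polygamma n has_real_derivative Polygamma (Suc n) (f x)) (at (f x))"
    by (rule has_field_derivative_Polygamma)
qed fact

lemma Dfun_deriv:
  assumes "x > 0"
  shows "(Dfun has_real_derivative Dfun' x) (at x)"
proof -
  have "((\<lambda>x. Digamma ((x + 1) / 2) - Digamma (x / 2)) has_real_derivative
      Polygamma (Suc 0) ((x + 1) / 2) * (1/2) - Polygamma (Suc 0) (x / 2) * (1/2)) (at x)"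
    using assms by (intro DERIV_diff Polygamma_deriv_real) (auto intro!: derivative_eq_intros)
  then show ?thesis by (simp add: Dfun_def[abs_def] Dfun'_def diff_divide_distrib)
qed

lemma Dfun'_deriv:
  assumes "x > 0"
  shows "(Dfun' has_real_derivative (Polygamma 2 ((x + 1) / 2) - Polygamma 2 (x / 2)) / 4) (at x)"
proof -
  have "((\<lambda>x. (Polygamma 1 ((x + 1) / 2) - Polygamma 1 (x / 2)) / 2) has_real_derivative
      (Polygamma (Suc 1) ((x + 1) / 2) * (1/2) - Polygamma (Suc 1) (x / 2) * (1/2)) / 2) (at x)"
    using assms by (intro DERIV_cdivide DERIV_diff Polygamma_deriv_real) (auto intro!: derivative_eq_intros)
  then show ?thesis by (simp add: Dfun'_def[abs_def] diff_divide_distrib numeral_2_eq_2)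
qed

lemma Dfun_recurrence: "x > 0 \<Longrightarrow> Dfun x + Dfun (x + 1) = 2 / x"
  using Digamma_plus1[of "x / 2"] by (simp add: Dfun_def add_divide_distrib add.commute)

lemma Dfun'_recurrence:
  assumes "x > 0"
  shows "Dfun' x + Dfun' (x + 1) = - (2 / x\<^sup>2)"
proof -
  have "(x + 1 + 1) / 2 = x / 2 + 1" by simp
  moreover have "Polygamma 1 (x / 2 + 1) = Polygamma 1 (x / 2) - 4 / x\<^sup>2"
    using Polygamma_plus1[of "x / 2" 1] assms by (simp add: power2_eq_square)
  ultimately show ?thesis unfolding Dfun'_def by (simp add: field_simps)
qed

lemma Dfun_antimono:
  assumes "0 < x" "x \<le> y"
  shows "Dfun y \<le> Dfun x"
proof (rule DERIV_nonpos_imp_nonincreasing[OF assms(2)])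
  fix t assume "x \<le> t" "t \<le> y"
  then have t: "t > 0" using assms by simp
  have "Polygamma 1 ((t + 1) / 2) < Polygamma 1 (t / 2)"
    by (rule Polygamma_real_strict_antimono) (use t in auto)
  then show "\<exists>d. (Dfun has_real_derivative d) (at t) \<and> d \<le> 0"
    using Dfun_deriv[OF t] unfolding Dfun'_def by (intro exI conjI) auto
qed

lemma Dfun'_mono:
  assumes "0 < x" "x \<le> y"
  shows "Dfun' x \<le> Dfun' y"
proof (rule DERIV_nonneg_imp_nondecreasing[OF assms(2)])
  fix t assume "x \<le> t" "t \<le> y"
  then have t: "t > 0" using assms by simp
  have "Polygamma 2 (t / 2) < Polygamma 2 ((t + 1) / 2)"
    by (rule Polygamma_real_strict_mono) (use t in auto)
  then show "\<exists>d. (Dfun' has_real_derivative d) (at t) \<and> 0 \<le> d"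
    using Dfun'_deriv[OF t] by (intro exI conjI) auto
qed

text \<open>\<open>Dfun\<close> decreases and two values at distance 1 add up to 2 / x, so each is
  compared with half of the sum at x and at x - 1. The derivative is bounded in the same way
  below.\<close>

lemma Dfun_bounds:
  assumes "x > 1"
  shows "1 / x \<le> Dfun x" "Dfun x \<le> 1 / (x - 1)"
proof -
  have "Dfun x \<le> Dfun (x - 1)" "Dfun (x - 1) + Dfun x = 2 / (x - 1)"
    using Dfun_antimono[of "x - 1" x] Dfun_recurrence[of "x - 1"] assms by auto
  moreover have "2 / (x - 1) = 1 / (x - 1) + 1 / (x - 1)" by simp
  ultimately show "Dfun x \<le> 1 / (x - 1)" by linarith
  have "Dfun (x + 1) \<le> Dfun x" "Dfun x + Dfun (x + 1) = 2 / x"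
    using Dfun_antimono[of x "x + 1"] Dfun_recurrence[of x] assms by auto
  moreover have "2 / x = 1 / x + 1 / x" by simp
  ultimately show "1 / x \<le> Dfun x" by linarith
qed

lemma Dfun'_bounds:
  assumes "x > 1"
  shows "- (1 / (x - 1)\<^sup>2) \<le> Dfun' x" "Dfun' x \<le> - (1 / x\<^sup>2)"
proof -
  have "Dfun' x \<ge> Dfun' (x - 1)" "Dfun' (x - 1) + Dfun' x = - (2 / (x - 1)\<^sup>2)"
    using Dfun'_mono[of "x - 1" x] Dfun'_recurrence[of "x - 1"] assms by auto
  then show "- (1 / (x - 1)\<^sup>2) \<le> Dfun' x" by linarith
  have "Dfun' x \<le> Dfun' (x + 1)" "Dfun' x + Dfun' (x + 1) = - (2 / x\<^sup>2)"
    using Dfun'_mono[of x "x + 1"] Dfun'_recurrence[of x] assms by auto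
  then show "Dfun' x \<le> - (1 / x\<^sup>2)" by linarith
qed

lemma deriv_Dfun: "x > 0 \<Longrightarrow> deriv Dfun x = Dfun' x"
  by (rule DERIV_imp_deriv[OF Dfun_deriv])

text \<open>Since \<open>G2 - G1^2\<close> equals -2 N^2 times this derivative, its limit is 2, the
  variance of the square of a standard normal variable.\<close>

lemma Dfun'_asymp:
  assumes N: "filterlim N at_top F"
  shows "((\<lambda>m. (N m)\<^sup>2 * Dfun' (N m - 2)) \<longlongrightarrow> -1) F"
proof (rule tendsto_sandwich)
  have ev: "\<forall>\<^sub>F m in F. 4 < N m" using N by (simp add: filterlim_at_top_dense)
  show "\<forall>\<^sub>F m in F. - ((N m)\<^sup>2 / (N m - 3)\<^sup>2) \<le> (N m)\<^sup>2 * Dfun' (N m - 2)"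
    using ev
  proof eventually_elim
    case (elim m)
    have "(N m)\<^sup>2 * (- (1 / (N m - 2 - 1)\<^sup>2)) \<le> (N m)\<^sup>2 * Dfun' (N m - 2)"
      using elim by (intro mult_left_mono Dfun'_bounds) auto
    then show ?case by simp
  qed
  show "\<forall>\<^sub>F m in F. (N m)\<^sup>2 * Dfun' (N m - 2) \<le> - ((N m)\<^sup>2 / (N m - 2)\<^sup>2)"
    using ev
  proof eventually_elim
    case (elim m)
    have "(N m)\<^sup>2 * Dfun' (N m - 2) \<le> (N m)\<^sup>2 * (- (1 / (N m - 2)\<^sup>2))"
      using elim by (intro mult_left_mono Dfun'_bounds) auto
    then show ?case by simp
  qed
  have "((\<lambda>x::real. - (x\<^sup>2 / (x - 3)\<^sup>2)) \<longlongrightarrow> -1) at_top" by real_asymp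
  from filterlim_compose[OF this N] show "((\<lambda>m. - ((N m)\<^sup>2 / (N m - 3)\<^sup>2)) \<longlongrightarrow> -1) F" .
  have "((\<lambda>x::real. - (x\<^sup>2 / (x - 2)\<^sup>2)) \<longlongrightarrow> -1) at_top" by real_asymp
  from filterlim_compose[OF this N] show "((\<lambda>m. - ((N m)\<^sup>2 / (N m - 2)\<^sup>2)) \<longlongrightarrow> -1) F" .
qed

text \<open>The centering \<open>G1\<close> differs from 1, the mean of a squared standard normal
  variable, by O(1/N); this is the order of the bias that p = o(N^2) tolerates.\<close>

lemma N_Dfun_bound:
  assumes "N \<ge> (6::real)"
  shows "\<bar>N * Dfun (N - 2) - 1\<bar> \<le> 6 / N"
proof -
  have "N * (1 / (N - 2)) \<le> N * Dfun (N - 2)" "N * Dfun (N - 2) \<le> N * (1 / (N - 2 - 1))"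
    using assms by (intro mult_left_mono Dfun_bounds; simp)+
  moreover have "N * (1 / (N - 2)) \<ge> 1" using assms by simp
  moreover have "N * (1 / (N - 2 - 1)) \<le> 1 + 6 / N" using assms by (simp add: field_simps)
  moreover have "0 \<le> 6 / N" using assms by simp
  ultimately show ?thesis by (intro abs_leI) linarith+
qed

section \<open>The standard normal distribution function and its quantiles\<close>

lemma Phi_cdf: "Phi = cdf std_normal"
  by (simp add: Phi_def[abs_def] cdf_def[abs_def])

interpretation std_normal: real_distribution std_normal
  by (rule real_dist_normal_dist)

lemma Phi_diff: "x \<le> y \<Longrightarrow> Phi y - Phi x = measure std_normal {x<..y}"
  unfolding Phi_cdf using std_normal.cdf_diff_eq[of x y] by (cases "x = y") auto

lemma Phi_mono: "x \<le> y \<Longrightarrow> Phi x \<le> Phi y"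
  unfolding Phi_cdf by (rule std_normal.cdf_nondecreasing)

lemma Phi_nonneg: "0 \<le> Phi x" and Phi_le_1: "Phi x \<le> 1"
  unfolding Phi_cdf by (rule std_normal.cdf_nonneg, rule std_normal.cdf_bounded_prob)

lemma Phi_lim: "(Phi \<longlongrightarrow> 1) at_top" "(Phi \<longlongrightarrow> 0) at_bot"
  unfolding Phi_cdf by (rule std_normal.cdf_lim_at_top_prob, rule std_normal.cdf_lim_at_bot)

text \<open>The normal density is at most 1. The estimate later absorbs a vanishing perturbation of
  a threshold that need not converge.\<close>

lemma Phi_lipschitz: "\<bar>Phi x - Phi y\<bar> \<le> \<bar>x - y\<bar>"
proof -
  have *: "Phi y - Phi x \<le> y - x" if "x \<le> y" for x y
  proof -
    have d1: "std_normal_density t \<le> 1" for t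
    proof -
      have "exp (- t\<^sup>2 / 2) \<le> 1" by simp
      moreover have "1 / sqrt (2 * pi) \<le> 1" using pi_gt3 by (simp add: real_le_rsqrt)
      ultimately have "1 / sqrt (2 * pi) * exp (- t\<^sup>2 / 2) \<le> 1 * 1" by (intro mult_mono) auto
      then show ?thesis by (simp add: std_normal_density_def)
    qed
    have "emeasure std_normal {x<..y} = (\<integral>\<^sup>+t. ennreal (std_normal_density t) * indicator {x<..y} t \<partial>lborel)"
      by (rule emeasure_density) auto
    also have "\<dots> \<le> (\<integral>\<^sup>+t. indicator {x<..y} t \<partial>lborel)"
      using d1 by (intro nn_integral_mono) (auto simp: indicator_def)
    also have "\<dots> = ennreal (y - x)" using that by simp
    finally show ?thesis
      using that unfolding Phi_diff[OF that] by (simp add: std_normal.emeasure_eq_measure)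
  qed
  show ?thesis using *[of x y] *[of y x] Phi_mono[of x y] Phi_mono[of y x] by linarith
qed

lemma Phi_isCont: "isCont Phi x"
  unfolding continuous_at_eps_delta
proof (intro allI impI)
  fix e :: real assume "e > 0"
  then show "\<exists>d>0. \<forall>x'. dist x' x < d \<longrightarrow> dist (Phi x') (Phi x) < e"
    using Phi_lipschitz by (intro exI[of _ e]) (auto simp: dist_real_def intro: le_less_trans)
qed

lemma Phi_strict_mono: "x < y \<Longrightarrow> Phi x < Phi y"
proof -
  assume xy: "x < y"
  define b where "b = \<bar>x\<bar> + \<bar>y\<bar>"
  define d where "d = std_normal_density b"
  have d: "d > 0" unfolding d_def by (rule normal_density_pos) simp
  have dt: "d \<le> std_normal_density t" if "t \<in> {x<..y}" for t
  proof -
    have "\<bar>t\<bar> \<le> \<bar>b\<bar>" using that by (auto simp: b_def)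
    then have "t\<^sup>2 \<le> b\<^sup>2" by (simp add: abs_le_square_iff)
    then show ?thesis unfolding d_def std_normal_density_def by (intro mult_left_mono) auto
  qed
  have "ennreal (d * (y - x)) = (\<integral>\<^sup>+t. ennreal d * indicator {x<..y} t \<partial>lborel)"
    using xy d by (simp add: nn_integral_cmult ennreal_mult)
  also have "\<dots> \<le> (\<integral>\<^sup>+t. ennreal (std_normal_density t) * indicator {x<..y} t \<partial>lborel)"
    using dt by (intro nn_integral_mono) (auto simp: indicator_def intro: ennreal_leI)
  also have "\<dots> = emeasure std_normal {x<..y}" by (rule emeasure_density[symmetric]) auto
  finally have "d * (y - x) \<le> Phi y - Phi x"
    using xy d by (simp add: Phi_diff std_normal.emeasure_eq_measure)
  moreover have "0 < d * (y - x)" using d xy by simp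
  ultimately show ?thesis by linarith
qed

lemma Phi_surj:
  assumes "0 < a" "a < 1"
  shows "\<exists>z. Phi z = a"
proof -
  obtain u where u: "Phi u < a"
    using order_tendstoD(2)[OF Phi_lim(2) assms(1)] by (auto simp: eventually_at_bot_linorder)
  obtain v where v: "a < Phi v"
    using order_tendstoD(1)[OF Phi_lim(1) assms(2)] by (auto simp: eventually_at_top_linorder)
  have "u \<le> v" using u v Phi_mono[of v u] by (rule_tac ccontr) simp
  then show ?thesis using IVT[of Phi u a v] u v Phi_isCont by auto
qed

text \<open>Continuity gives existence and strict monotonicity uniqueness, so the description in
  \<open>z_quant\<close> denotes.\<close>

lemma Phi_z_quant:
  assumes "0 < a" "a < 1"
  shows "Phi (z_quant a) = 1 - a"
  unfolding z_quant_def
proof (rule theI')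
  obtain z where z: "Phi z = 1 - a" using Phi_surj[of "1 - a"] assms by auto
  show "\<exists>!z. Phi z = 1 - a"
  proof (rule ex1I[of _ z])
    show "y = z" if "Phi y = 1 - a" for y
      using that z Phi_strict_mono[of y z] Phi_strict_mono[of z y] by (cases y z rule: linorder_cases) auto
  qed fact
qed

text \<open>Polya's theorem: the quantiles \<open>t i\<close> of order \<open>i / n\<close> serve as the grid.\<close>

lemma cdf_uniform_convergence:
  assumes D: "\<And>m. real_distribution (D m)" and conv: "weak_conv_m D std_normal"
  shows "(\<lambda>m. cdf (D m) (a m) - Phi (a m)) \<longlonglongrightarrow> 0"
proof (rule LIMSEQ_I)
  fix r :: real assume "r > 0"
  then obtain n :: nat where n: "2 / r < real n" "n > 0"
    by (metis reals_Archimedean2 divide_pos_pos gr0I of_nat_0 order_less_asym zero_less_numeral)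
  have cv: "(\<lambda>m. cdf (D m) x) \<longlonglongrightarrow> Phi x" for x
    using conv Phi_isCont[of x] unfolding weak_conv_m_def weak_conv_def Phi_cdf by blast
  have "\<forall>i\<in>{1..<n}. \<exists>t. Phi t = real i / real n"
    by (intro ballI Phi_surj) auto
  then obtain t where t: "\<And>i. i \<in> {1..<n} \<Longrightarrow> Phi (t i) = real i / real n" by metis
  have "\<forall>\<^sub>F m in sequentially. \<forall>i\<in>{1..<n}. \<bar>cdf (D m) (t i) - Phi (t i)\<bar> < 1 / real n"
  proof (intro eventually_ball_finite ballI)
    fix i
    have "(\<lambda>m. cdf (D m) (t i) - Phi (t i)) \<longlonglongrightarrow> 0" using cv[of "t i"] by (simp add: LIM_zero)
    from tendstoD[OF this, of "1 / real n"] n show "\<forall>\<^sub>F m in sequentially. \<bar>cdf (D m) (t i) - Phi (t i)\<bar> < 1 / real n"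
      by simp
  qed simp
  then obtain m0 where m0: "\<And>m i. m \<ge> m0 \<Longrightarrow> i \<in> {1..<n} \<Longrightarrow> \<bar>cdf (D m) (t i) - Phi (t i)\<bar> < 1 / real n"
    unfolding eventually_sequentially by blast
  have "\<bar>cdf (D m) x - Phi x\<bar> \<le> 2 / real n" if m: "m \<ge> m0" for m x
  proof -
    interpret Dm: real_distribution "D m" by (rule D)
    \<comment> \<open>The value \<open>Phi x\<close> lies in the grid cell from i / n to (i + 1) /
      n.\<close>
    define i where "i = nat \<lfloor>real n * Phi x\<rfloor>"
    have i: "real i \<le> real n * Phi x" "real n * Phi x < real i + 1"
      using Phi_nonneg[of x] n(2) unfolding i_def by (auto simp: mult_nonneg_nonneg)
    then have i': "real i / real n \<le> Phi x" "Phi x < real (i + 1) / real n"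
      using n(2) by (simp_all add: field_simps)
    have sp: "real (i + 1) / real n = real i / real n + 1 / real n" "2 / real n = 1 / real n + 1 / real n"
      by (simp_all add: add_divide_distrib)
    have F: "0 \<le> cdf (D m) x" "cdf (D m) x \<le> 1" by (rule Dm.cdf_nonneg, rule Dm.cdf_bounded_prob)
    have n0: "0 < 1 / real n" using n by simp
    have lower: "Phi x - 2 / real n \<le> cdf (D m) x"
    proof (cases "i \<in> {1..<n}")
      case True
      then have "t i \<le> x" using t[OF True] i'(1) Phi_strict_mono[of x "t i"] by (rule_tac ccontr) simp
      then have "cdf (D m) (t i) \<le> cdf (D m) x" by (rule Dm.cdf_nondecreasing)
      then show ?thesis using m0[OF m True] t[OF True] i' sp by linarith
    next
      case False
      show ?thesis
      proof (cases "i = 0")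
        case True then show ?thesis using i' sp F n0 by simp
      next
        case False
        with \<open>i \<notin> {1..<n}\<close> have "n \<le> i" by auto
        then have "1 \<le> real i / real n" using n by simp
        \<comment> \<open>An index i of at least n would force \<open>Phi\<close> to attain its
          supremum at x, which strict monotonicity excludes.\<close>
        then have "Phi x = 1" using i'(1) Phi_le_1[of x] by linarith
        then have "Phi x < Phi (x + 1)" by (intro Phi_strict_mono) simp
        then show ?thesis using Phi_le_1[of "x + 1"] \<open>Phi x = 1\<close> by simp
      qed
    qed
    have upper: "cdf (D m) x \<le> Phi x + 2 / real n"
    proof (cases "i + 1 \<in> {1..<n}")
      case True
      then have "x \<le> t (i + 1)" using t[OF True] i'(2) Phi_mono[of "t (i + 1)" x] by (rule_tac ccontr) simp
      then have "cdf (D m) x \<le> cdf (D m) (t (i + 1))" by (rule Dm.cdf_nondecreasing)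
      then show ?thesis using m0[OF m True] t[OF True] i' sp by linarith
    next
      case False
      then have "1 \<le> real (i + 1) / real n" using n by simp
      then show ?thesis using i' sp F n0 by linarith
    qed
    show ?thesis using lower upper by linarith
  qed
  moreover have "2 / real n < r" using n \<open>r > 0\<close> by (simp add: field_simps)
  ultimately show "\<exists>no. \<forall>m\<ge>no. norm (cdf (D m) (a m) - Phi (a m) - 0) < r"
    by (intro exI[of _ m0]) (auto intro: le_less_trans)
qed

text \<open>The threshold \<open>a m\<close> is an arbitrary sequence, because the noncentral shift
  can diverge; uniform convergence of distribution functions allows this. The varying
  \<open>tau\<close> is moved into the frequency of the characteristic function.\<close>

lemma (in mixing_array) tail_clt:
  assumes tau: "tau \<longlonglongrightarrow> sqrt (g 0 + 2 * (\<Sum>k. g (Suc k)))" and pos: "0 < g 0 + 2 * (\<Sum>k. g (Suc k))"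
  shows "(\<lambda>m. P.prob m {\<omega>\<in>space (M m). ((\<Sum>j=1..p m. V m j \<omega>) - (\<Sum>j=1..p m. P.expectation m (V m j))) / (tau m * sqrt (real (p m))) > a m}
     - (1 - Phi (a m))) \<longlonglongrightarrow> 0"
proof -
  define \<sigma> where "\<sigma> = g 0 + 2 * (\<Sum>k. g (Suc k))"
  define Z where "Z m \<omega> = (\<Sum>j=1..p m. V m j \<omega>) - (\<Sum>j=1..p m. P.expectation m (V m j))" for m \<omega>
  define U where "U m \<omega> = Z m \<omega> / (tau m * sqrt (real (p m)))" for m \<omega>
  define D where "D m = distr (M m) borel (U m)" for m
  have Um: "U m \<in> borel_measurable (M m)" for m
    unfolding U_def[abs_def] Z_def
    by (intro borel_measurable_divide borel_measurable_diff borel_measurable_sum V_meas borel_measurable_const) auto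
  have D: "real_distribution (D m)" for m
    unfolding D_def by (rule P.real_distribution_distr) (rule Um)
  have conv: "weak_conv_m D std_normal"
  proof (rule levy_continuity[OF D real_dist_normal_dist])
    fix t
    have "sqrt \<sigma> > 0" using pos by (simp add: \<sigma>_def)
    then have "(\<lambda>m. t / tau m) \<longlonglongrightarrow> t / sqrt \<sigma>" using tau unfolding \<sigma>_def by (intro tendsto_intros) auto
    from char_clt[OF this pos]
    have "(\<lambda>m. P.expectation m (\<lambda>\<omega>. iexp (t / tau m / sqrt (real (p m)) * Z m \<omega>))) \<longlonglongrightarrow> complex_of_real (exp (- ((t / sqrt \<sigma>)\<^sup>2 * \<sigma> / 2)))"
      unfolding Z_def \<sigma>_def .
    moreover have "(t / sqrt \<sigma>)\<^sup>2 * \<sigma> / 2 = t\<^sup>2 / 2" using pos by (simp add: power_divide \<sigma>_def)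
    moreover have "P.expectation m (\<lambda>\<omega>. iexp (t / tau m / sqrt (real (p m)) * Z m \<omega>)) = char (D m) t" for m
    proof -
      have "char (D m) t = P.expectation m (\<lambda>\<omega>. iexp (t * U m \<omega>))"
        unfolding char_def D_def by (rule integral_distr[OF Um]) measurable
      moreover have "t / tau m / sqrt (real (p m)) * Z m \<omega> = t * U m \<omega>" for \<omega> by (simp add: U_def)
      ultimately show ?thesis by simp
    qed
    ultimately show "(\<lambda>m. char (D m) t) \<longlonglongrightarrow> char std_normal t"
      by (simp add: char_std_normal_distribution)
  qed
  have "P.prob m {\<omega>\<in>space (M m). U m \<omega> > a m} = 1 - cdf (D m) (a m)" for m
  proof -
    have "cdf (D m) (a m) = P.prob m {\<omega>\<in>space (M m). U m \<omega> \<le> a m}"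
      unfolding cdf_def D_def by (subst measure_distr[OF Um]) (auto intro!: arg_cong[where f="measure (M m)"])
    moreover have "P.prob m (space (M m) - {\<omega>\<in>space (M m). U m \<omega> \<le> a m}) = 1 - P.prob m {\<omega>\<in>space (M m). U m \<omega> \<le> a m}"
      using Um[of m] by (intro P.prob_compl) measurable
    moreover have "space (M m) - {\<omega>\<in>space (M m). U m \<omega> \<le> a m} = {\<omega>\<in>space (M m). U m \<omega> > a m}" by auto
    ultimately show ?thesis by simp
  qed
  then have "(\<lambda>m. P.prob m {\<omega>\<in>space (M m). U m \<omega> > a m} - (1 - Phi (a m))) = (\<lambda>m. - (cdf (D m) (a m) - Phi (a m)))"
    by auto
  then show ?thesis
    using tendsto_minus[OF cdf_uniform_convergence[OF D conv, of a]] unfolding U_def Z_def by simp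
qed

section \<open>The two-sample statistics\<close>

text \<open>A weighted arithmetic-geometric mean inequality in place of Cauchy-Schwarz. The weight t
  is later sqrt nu or its inverse, which balances a second moment of order 1 / nu against a bounded
  one.\<close>

lemma (in prob_space) cov_bound_weighted:
  fixes f g :: "'a \<Rightarrow> real"
  assumes m[measurable]: "f \<in> borel_measurable M" "g \<in> borel_measurable M"
    and i: "integrable M (\<lambda>x. (f x)\<^sup>2)" "integrable M (\<lambda>x. (g x)\<^sup>2)" and t: "t > 0"
  shows "\<bar>cov M f g\<bar> \<le> (t * expectation (\<lambda>x. (f x)\<^sup>2) + expectation (\<lambda>x. (g x)\<^sup>2) / t) / 2"
proof -
  have i1: "integrable M f" "integrable M g"
    using square_integrable_imp_integrable[OF m(1) i(1)] square_integrable_imp_integrable[OF m(2) i(2)] by auto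
  have c: "integrable M (\<lambda>x. (h x - expectation h)\<^sup>2)" "expectation (\<lambda>x. (h x - expectation h)\<^sup>2) \<le> expectation (\<lambda>x. (h x)\<^sup>2)"
    if "integrable M h" "integrable M (\<lambda>x. (h x)\<^sup>2)" for h :: "'a \<Rightarrow> real"
  proof -
    have "(h x - expectation h)\<^sup>2 = (h x)\<^sup>2 - 2 * expectation h * h x + (expectation h)\<^sup>2" for x
      by (simp add: power2_eq_square algebra_simps)
    then show "integrable M (\<lambda>x. (h x - expectation h)\<^sup>2)" using that by simp
    show "expectation (\<lambda>x. (h x - expectation h)\<^sup>2) \<le> expectation (\<lambda>x. (h x)\<^sup>2)"
      using variance_eq[OF that] by simp
  qed
  note cf = c[OF i1(1) i(1)] and cg = c[OF i1(2) i(2)]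
  have b: "\<bar>(f x - expectation f) * (g x - expectation g)\<bar> \<le> (t * (f x - expectation f)\<^sup>2 + (g x - expectation g)\<^sup>2 / t) / 2" for x
  proof -
    define y where "y = \<bar>f x - expectation f\<bar>"
    define z where "z = \<bar>g x - expectation g\<bar>"
    have "0 \<le> (t * y - z)\<^sup>2 / t" using t by simp
    also have "(t * y - z)\<^sup>2 / t = t * y\<^sup>2 - 2 * (y * z) + z\<^sup>2 / t" using t by (simp add: field_simps power2_eq_square)
    finally have "y * z \<le> (t * y\<^sup>2 + z\<^sup>2 / t) / 2" by (simp add: field_simps)
    then show ?thesis unfolding y_def z_def by (simp add: abs_mult)
  qed
  have "\<bar>cov M f g\<bar> \<le> expectation (\<lambda>x. \<bar>(f x - expectation f) * (g x - expectation g)\<bar>)"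
    unfolding cov_def by (rule integral_abs_bound)
  also have "\<dots> \<le> expectation (\<lambda>x. (t * (f x - expectation f)\<^sup>2 + (g x - expectation g)\<^sup>2 / t) / 2)"
  proof (rule integral_mono_AE)
    have "integrable M (\<lambda>x. (t * (f x - expectation f)\<^sup>2 + (g x - expectation g)\<^sup>2 / t) / 2)" using cf cg by simp
    then show "integrable M (\<lambda>x. \<bar>(f x - expectation f) * (g x - expectation g)\<bar>)"
      by (rule Bochner_Integration.integrable_bound) (use b in \<open>auto intro: order_trans[OF _ abs_ge_self]\<close>)
  qed (use cf cg b in auto)
  also have "\<dots> = (t * expectation (\<lambda>x. (f x - expectation f)\<^sup>2) + expectation (\<lambda>x. (g x - expectation g)\<^sup>2) / t) / 2"
    using cf cg by simp
  also have "\<dots> \<le> (t * expectation (\<lambda>x. (f x)\<^sup>2) + expectation (\<lambda>x. (g x)\<^sup>2) / t) / 2"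
    using cf cg t by (intro divide_right_mono add_mono mult_left_mono) auto
  finally show ?thesis .
qed

locale two_sample = prob_space +
  fixes n1 n2 p :: nat and X Y :: "'a \<Rightarrow> nat \<Rightarrow> nat \<Rightarrow> real" and mu1 mu2 :: "nat \<Rightarrow> real"
    and S :: "nat \<Rightarrow> nat \<Rightarrow> real"
  assumes n: "1 \<le> n1" "1 \<le> n2" "2 < n1 + n2"
    and S_pos: "\<And>j. j \<in> {1..p} \<Longrightarrow> S j j > 0"
    and X_gauss: "\<And>i. i \<in> {1..n1} \<Longrightarrow> gaussian_vec M p (\<lambda>\<omega>. X \<omega> i) mu1 S"
    and Y_gauss: "\<And>k. k \<in> {1..n2} \<Longrightarrow> gaussian_vec M p (\<lambda>\<omega>. Y \<omega> k) mu2 S"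
    and indep: "indep_vars (\<lambda>_. PiM {1..p} (\<lambda>_. borel))
                   (\<lambda>r \<omega>. case r of Inl i \<Rightarrow> restrict (X \<omega> i) {1..p} | Inr k \<Rightarrow> restrict (Y \<omega> k) {1..p})
                   ({1..n1} <+> {1..n2})"
begin

definition lin :: "(nat \<Rightarrow> real) \<Rightarrow> (nat \<Rightarrow> real) \<Rightarrow> real" where
  "lin a x = (\<Sum>j=1..p. a j * x j)"

definition qvar :: "(nat \<Rightarrow> real) \<Rightarrow> real" where
  "qvar a = (\<Sum>i=1..p. \<Sum>j=1..p. a i * S i j * a j)"

definition diffmean :: "('a \<Rightarrow> nat \<Rightarrow> real) \<Rightarrow> ('a \<Rightarrow> nat \<Rightarrow> real) \<Rightarrow> 'a \<Rightarrow> real" where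
  "diffmean u v \<omega> = sqrt (real n1 * real n2 / (real n1 + real n2)) *
     ((\<Sum>i=1..n1. u \<omega> i) / real n1 - (\<Sum>k=1..n2. v \<omega> k) / real n2)"

lemma X_distr: "i \<in> {1..n1} \<Longrightarrow> distr M borel (\<lambda>\<omega>. lin a (X \<omega> i)) = normal_meas (lin a mu1) (qvar a)"
  using X_gauss[of i] by (simp add: gaussian_vec_def lin_def qvar_def)

lemma Y_distr: "k \<in> {1..n2} \<Longrightarrow> distr M borel (\<lambda>\<omega>. lin a (Y \<omega> k)) = normal_meas (lin a mu2) (qvar a)"
  using Y_gauss[of k] by (simp add: gaussian_vec_def lin_def qvar_def)

lemma X_meas: "i \<in> {1..n1} \<Longrightarrow> j \<in> {1..p} \<Longrightarrow> (\<lambda>\<omega>. X \<omega> i j) \<in> borel_measurable M"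
  using X_gauss[of i] by (simp add: gaussian_vec_def)

lemma Y_meas: "i \<in> {1..n2} \<Longrightarrow> j \<in> {1..p} \<Longrightarrow> (\<lambda>\<omega>. Y \<omega> i j) \<in> borel_measurable M"
  using Y_gauss[of i] by (simp add: gaussian_vec_def)

lemma lin_meas:
  "i \<in> {1..n1} \<Longrightarrow> (\<lambda>\<omega>. lin a (X \<omega> i)) \<in> borel_measurable M"
  "k \<in> {1..n2} \<Longrightarrow> (\<lambda>\<omega>. lin a (Y \<omega> k)) \<in> borel_measurable M"
  unfolding lin_def by (intro borel_measurable_sum borel_measurable_times borel_measurable_const X_meas Y_meas; simp)+

lemma standardize:
  assumes v: "v > 0" and L[measurable]: "L \<in> borel_measurable M" and D: "distr M borel L = normal_meas l v"
  shows "distr M borel (\<lambda>\<omega>. (L \<omega> - l) / sqrt v) = std_normal"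
proof -
  have "distr M lborel L = distr M borel L" by (rule distr_cong) auto
  then have "distributed M lborel L (normal_density l (sqrt v))"
    using D v by (simp add: distributed_def normal_meas_def)
  then have "distributed M lborel (\<lambda>\<omega>. (L \<omega> - l) / sqrt v) std_normal_density"
    using v by (subst normal_standard_normal_convert[symmetric]) auto
  then have "distr M lborel (\<lambda>\<omega>. (L \<omega> - l) / sqrt v) = std_normal" by (simp add: distributed_def)
  moreover have "distr M lborel (\<lambda>\<omega>. (L \<omega> - l) / sqrt v) = distr M borel (\<lambda>\<omega>. (L \<omega> - l) / sqrt v)" by (rule distr_cong) auto
  ultimately show ?thesis by simp
qed

text \<open>A linear functional turns the two vector samples into n1 + n2 independent scalar
  normals. They are indexed by a disjoint sum, so the two samples appear as the disjoint index sets
  \<open>Inl\<close> and \<open>Inr\<close> of the Helmert lemma.\<close>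

lemma normal_chisq_lin:
  assumes v: "qvar a > 0"
  shows "normal_chisq M
    (diffmean (\<lambda>\<omega> i. (lin a (X \<omega> i) - lin a mu1) / sqrt (qvar a)) (\<lambda>\<omega> k. (lin a (Y \<omega> k) - lin a mu2) / sqrt (qvar a)))
    (\<lambda>\<omega>. sqdev {1..n1} (\<lambda>i. (lin a (X \<omega> i) - lin a mu1) / sqrt (qvar a)) + sqdev {1..n2} (\<lambda>k. (lin a (Y \<omega> k) - lin a mu2) / sqrt (qvar a)))
    (real n1 + real n2 - 2)"
proof -
  define h where "h r x = (lin a x - lin a (case r of Inl (i::nat) \<Rightarrow> mu1 | Inr (k::nat) \<Rightarrow> mu2)) / sqrt (qvar a)" for r and x :: "nat \<Rightarrow> real"
  define \<xi> where "\<xi> r \<omega> = h r (case r of Inl i \<Rightarrow> restrict (X \<omega> i) {1..p} | Inr k \<Rightarrow> restrict (Y \<omega> k) {1..p})" for r \<omega>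
  have hm: "h r \<in> borel_measurable (PiM {1..p} (\<lambda>_. borel))" for r
    unfolding h_def lin_def
    by (intro borel_measurable_divide borel_measurable_diff borel_measurable_sum borel_measurable_times borel_measurable_const measurable_component_singleton)
  have ind: "indep_vars (\<lambda>_. borel) \<xi> (Inl ` {1..n1} \<union> Inr ` {1..n2})"
    unfolding \<xi>_def[abs_def]
    using indep_vars_compose2[OF indep, of h "\<lambda>_. borel"] hm by (simp add: Plus_def)
  have lr: "lin a (restrict x {1..p}) = lin a x" for x by (simp add: lin_def)
  have xi: "\<xi> (Inl i) = (\<lambda>\<omega>. (lin a (X \<omega> i) - lin a mu1) / sqrt (qvar a))" "\<xi> (Inr i) = (\<lambda>\<omega>. (lin a (Y \<omega> i) - lin a mu2) / sqrt (qvar a))" for i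
    by (simp_all only: fun_eq_iff \<xi>_def h_def sum.case lr simp_thms)
  have D: "distr M borel (\<xi> r) = std_normal" if "r \<in> Inl ` {1..n1} \<union> Inr ` {1..n2}" for r
    using that by (auto simp: xi intro!: standardize v lin_meas X_distr Y_distr)
  have "normal_chisq M
      (\<lambda>\<omega>. sqrt (real (card (Inl ` {1..n1} :: (nat + nat) set)) * real (card (Inr ` {1..n2} :: (nat + nat) set)) / (real (card (Inl ` {1..n1} :: (nat + nat) set)) + real (card (Inr ` {1..n2} :: (nat + nat) set)))) *
           ((\<Sum>i\<in>Inl ` {1..n1}. \<xi> i \<omega>) / real (card (Inl ` {1..n1} :: (nat + nat) set)) - (\<Sum>i\<in>Inr ` {1..n2}. \<xi> i \<omega>) / real (card (Inr ` {1..n2} :: (nat + nat) set))))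
      (\<lambda>\<omega>. sqdev (Inl ` {1..n1}) (\<lambda>i. \<xi> i \<omega>) + sqdev (Inr ` {1..n2}) (\<lambda>i. \<xi> i \<omega>)) (real (card (Inl ` {1..n1} :: (nat + nat) set)) + real (card (Inr ` {1..n2} :: (nat + nat) set)) - 2)"
    by (rule normal_chisq_two_sample) (use n ind D in \<open>auto simp: card_image\<close>)
  moreover have "card (Inl ` {1..n1} :: (nat + nat) set) = n1" "card (Inr ` {1..n2} :: (nat + nat) set) = n2"
    by (simp_all add: card_image)
  moreover have "(\<Sum>i\<in>Inl ` {1..n1}. \<xi> i \<omega>) = (\<Sum>i=1..n1. \<xi> (Inl i) \<omega>)" "(\<Sum>i\<in>Inr ` {1..n2}. \<xi> i \<omega>) = (\<Sum>i=1..n2. \<xi> (Inr i) \<omega>)" for \<omega>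
    by (simp_all add: sum.reindex)
  moreover have "sqdev (Inl ` {1..n1}) (\<lambda>i. \<xi> i \<omega>) = sqdev {1..n1} (\<lambda>i. \<xi> (Inl i) \<omega>)" "sqdev (Inr ` {1..n2}) (\<lambda>i. \<xi> i \<omega>) = sqdev {1..n2} (\<lambda>i. \<xi> (Inr i) \<omega>)" for \<omega>
    by (simp_all add: sqdev_def sum.reindex card_image)
  ultimately show ?thesis by (simp only: xi diffmean_def[abs_def])
qed

lemma diffmean_affine:
  assumes "s \<noteq> 0"
  shows "diffmean (\<lambda>\<omega> i. (u \<omega> i - l1) / s) (\<lambda>\<omega> k. (w \<omega> k - l2) / s) \<omega>
    = (diffmean u w \<omega> - sqrt (real n1 * real n2 / (real n1 + real n2)) * (l1 - l2)) / s"
proof -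
  have 1: "(\<Sum>i=1..n1. (u \<omega> i - l1) / s) / real n1 = ((\<Sum>i=1..n1. u \<omega> i) / real n1 - l1) / s"
    unfolding sum_divide_distrib[symmetric] sum_subtractf using n by (simp add: field_simps)
  have 2: "(\<Sum>i=1..n2. (w \<omega> i - l2) / s) / real n2 = ((\<Sum>i=1..n2. w \<omega> i) / real n2 - l2) / s"
    unfolding sum_divide_distrib[symmetric] sum_subtractf using n by (simp add: field_simps)
  show ?thesis
  proof -
    have "c * ((A - l1) / s - (B - l2) / s) = (c * (A - B) - c * (l1 - l2)) / s" for c A B
    proof -
      have "(A - l1) / s - (B - l2) / s = ((A - B) - (l1 - l2)) / s" by (simp add: diff_divide_distrib)
      then show ?thesis by (simp only: right_diff_distrib times_divide_eq_right)
    qed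
    then show ?thesis unfolding diffmean_def 1 2 .
  qed
qed

definition Zl :: "(nat \<Rightarrow> real) \<Rightarrow> 'a \<Rightarrow> real" where
  "Zl a = diffmean (\<lambda>\<omega> i. lin a (X \<omega> i)) (\<lambda>\<omega> k. lin a (Y \<omega> k))"

definition dl :: "(nat \<Rightarrow> real) \<Rightarrow> real" where
  "dl a = sqrt (real n1 * real n2 / (real n1 + real n2)) * (lin a mu1 - lin a mu2)"

lemma Zl_meas[measurable]: "Zl a \<in> borel_measurable M"
  unfolding Zl_def diffmean_def[abs_def]
  by (intro borel_measurable_times borel_measurable_diff borel_measurable_divide borel_measurable_sum borel_measurable_const lin_meas)

text \<open>The degenerate case cannot be avoided: the difference of two coordinates is constant if
  they coincide or are perfectly correlated. There every observation is almost surely constant and s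
  = 0 represents the point mass.\<close>

lemma Zl_distr: "\<exists>s\<ge>0. distr M borel (Zl a) = distr std_normal borel (\<lambda>x. dl a + s * x)"
proof (cases "qvar a > 0")
  case True
  interpret N: normal_chisq M "diffmean (\<lambda>\<omega> i. (lin a (X \<omega> i) - lin a mu1) / sqrt (qvar a)) (\<lambda>\<omega> k. (lin a (Y \<omega> k) - lin a mu2) / sqrt (qvar a))"
    "\<lambda>\<omega>. sqdev {1..n1} (\<lambda>i. (lin a (X \<omega> i) - lin a mu1) / sqrt (qvar a)) + sqdev {1..n2} (\<lambda>k. (lin a (Y \<omega> k) - lin a mu2) / sqrt (qvar a))"
    "real n1 + real n2 - 2"
    by (rule normal_chisq_lin[OF True])
  let ?H = "diffmean (\<lambda>\<omega> i. (lin a (X \<omega> i) - lin a mu1) / sqrt (qvar a)) (\<lambda>\<omega> k. (lin a (Y \<omega> k) - lin a mu2) / sqrt (qvar a))"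
  have "Zl a = (\<lambda>\<omega>. dl a + sqrt (qvar a) * ?H \<omega>)"
    using True by (simp add: fun_eq_iff diffmean_affine Zl_def dl_def)
  then have "distr M borel (Zl a) = distr (distr M borel ?H) borel (\<lambda>x. dl a + sqrt (qvar a) * x)"
    by (simp add: distr_distr comp_def)
  then show ?thesis unfolding N.distr_H using True by (intro exI[of _ "sqrt (qvar a)"]) auto
next
  case False
  have const: "AE \<omega> in M. L \<omega> = l" if [measurable]: "L \<in> borel_measurable M" and D: "distr M borel L = normal_meas l (qvar a)" for L l
  proof -
    have nm: "normal_meas l (qvar a) = return borel l" using False by (simp add: normal_meas_def)
    have "AE x in distr M borel L. x = l" unfolding D nm by (subst AE_return) auto
    then show ?thesis by (subst (asm) AE_distr_iff) auto
  qed
  have "AE \<omega> in M. \<forall>i\<in>{1..n1}. lin a (X \<omega> i) = lin a mu1"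
    by (rule AE_finite_allI) (auto intro!: const lin_meas X_distr)
  moreover have "AE \<omega> in M. \<forall>i\<in>{1..n2}. lin a (Y \<omega> i) = lin a mu2"
    by (rule AE_finite_allI) (auto intro!: const lin_meas Y_distr)
  ultimately have AE: "AE \<omega> in M. Zl a \<omega> = dl a"
  proof eventually_elim
    case (elim \<omega>)
    then have "(\<Sum>i=1..n1. lin a (X \<omega> i)) = real n1 * lin a mu1" "(\<Sum>i=1..n2. lin a (Y \<omega> i)) = real n2 * lin a mu2" by simp_all
    then show ?case using n by (simp add: Zl_def dl_def diffmean_def)
  qed
  have "distr M borel (Zl a) = distr M borel (\<lambda>_. dl a)"
    by (rule distr_cong_AE[OF refl refl AE]) auto
  also have "\<dots> = return borel (dl a)" by (rule distr_const) simp
  also have "\<dots> = distr std_normal borel (\<lambda>_. dl a)"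
    by (rule std_normal.distr_const[symmetric]) simp
  finally show ?thesis by (intro exI[of _ 0]) simp
qed

text \<open>The standard deviation s stays anonymous, but one s serves both moments: it can be read
  off from the second moment and then fixes the fourth.\<close>

lemma Zl_moments:
  "\<exists>s\<ge>0. integrable M (\<lambda>\<omega>. Zl a \<omega> ^ k) \<and> expectation (\<lambda>\<omega>. (Zl a \<omega>)\<^sup>2) = (dl a)\<^sup>2 + s\<^sup>2
    \<and> expectation (\<lambda>\<omega>. Zl a \<omega> ^ 4) = dl a ^ 4 + 6 * (dl a)\<^sup>2 * s\<^sup>2 + 3 * s ^ 4"
proof -
  obtain s where s: "s \<ge> 0" "distr M borel (Zl a) = distr std_normal borel (\<lambda>x. dl a + s * x)" using Zl_distr by blast
  have e: "expectation (\<lambda>\<omega>. Zl a \<omega> ^ k) = (\<integral>x. (dl a + s * x) ^ k \<partial>std_normal)" for k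
  proof -
    have "expectation (\<lambda>\<omega>. Zl a \<omega> ^ k) = (\<integral>x. x ^ k \<partial>distr M borel (Zl a))" by (rule integral_distr[symmetric]) auto
    also have "\<dots> = (\<integral>x. (dl a + s * x) ^ k \<partial>std_normal)" unfolding s by (rule integral_distr) auto
    finally show ?thesis .
  qed
  have "integrable std_normal (\<lambda>x. (s * x + dl a) ^ k)"
    unfolding binomial_ring power_mult_distrib
    by (intro Bochner_Integration.integrable_sum integrable_mult_left integrable_mult_right integrable_std_normal_distribution_moment)
  then have "integrable (distr std_normal borel (\<lambda>x. dl a + s * x)) (\<lambda>x. x ^ k)"
    by (subst integrable_distr_eq) (auto simp: add.commute)
  then have "integrable M (\<lambda>\<omega>. Zl a \<omega> ^ k)" unfolding s(2)[symmetric] by (rule integrable_distr[rotated]) auto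
  then show ?thesis using s(1) e[of 2] e[of 4] affine_normal_sq affine_normal_fourth by auto
qed

definition sd :: "nat \<Rightarrow> real" where
  "sd j = sqrt (S j j)"

definition coord :: "nat \<Rightarrow> nat \<Rightarrow> real" where
  "coord j = (\<lambda>r. if r = j then 1 / sd j else 0)"

lemma lin_coord: "j \<in> {1..p} \<Longrightarrow> lin (coord j) x = x j / sd j"
  unfolding lin_def coord_def by (simp add: if_distrib[of "\<lambda>x. x * _"] cong: if_cong)

lemma qvar_coord: "j \<in> {1..p} \<Longrightarrow> qvar (coord j) = 1"
proof -
  assume j: "j \<in> {1..p}"
  have "qvar (coord j) = (\<Sum>i=1..p. lin (\<lambda>r. coord j i * S i r) (coord j))" by (simp add: qvar_def lin_def)
  also have "\<dots> = (\<Sum>i=1..p. (if i = j then 1 / sd j * S j j * (1 / sd j) else 0))"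
    using j by (intro sum.cong refl) (auto simp: lin_def coord_def if_distrib[of "\<lambda>x. _ * x"] cong: if_cong)
  also have "\<dots> = 1" using j S_pos[OF j] by (simp add: sd_def)
  finally show ?thesis .
qed

definition Zc :: "nat \<Rightarrow> 'a \<Rightarrow> real" where "Zc j = Zl (coord j)"
definition dc :: "nat \<Rightarrow> real" where "dc j = dl (coord j)"
definition Wc :: "nat \<Rightarrow> 'a \<Rightarrow> real" where
  "Wc j \<omega> = sqdev {1..n1} (\<lambda>i. (lin (coord j) (X \<omega> i) - lin (coord j) mu1)) + sqdev {1..n2} (\<lambda>k. (lin (coord j) (Y \<omega> k) - lin (coord j) mu2))"

lemma normal_chisq_component:
  assumes "j \<in> {1..p}"
  shows "normal_chisq M (\<lambda>\<omega>. Zc j \<omega> - dc j) (Wc j) (real n1 + real n2 - 2)"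
proof -
  have D: "diffmean (\<lambda>\<omega> i. (lin (coord j) (X \<omega> i) - lin (coord j) mu1) / 1) (\<lambda>\<omega> k. (lin (coord j) (Y \<omega> k) - lin (coord j) mu2) / 1)
      = (\<lambda>\<omega>. Zc j \<omega> - dc j)"
    by (rule ext, subst diffmean_affine) (simp_all add: Zc_def dc_def Zl_def dl_def)
  have "0 < qvar (coord j)" by (simp add: qvar_coord[OF assms])
  from normal_chisq_lin[OF this, unfolded qvar_coord[OF assms] real_sqrt_one D] show ?thesis
    unfolding Wc_def[abs_def] div_by_1 .
qed

text \<open>Polarization reduces the mixed fourth moment to fourth moments of univariate normals.\<close>

lemma cov_Zc_sq:
  assumes j: "j \<in> {1..p}" and k: "k \<in> {1..p}"
  shows "\<exists>r. \<bar>r\<bar> \<le> 1 \<and> (j = k \<longrightarrow> r = 1) \<and>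
    cov M (\<lambda>\<omega>. (Zc j \<omega>)\<^sup>2) (\<lambda>\<omega>. (Zc k \<omega>)\<^sup>2) = 2 * r\<^sup>2 + 4 * r * dc j * dc k"
proof -
  have linear: "Zl (\<lambda>r. coord j r + c * coord k r) \<omega> = Zc j \<omega> + c * Zc k \<omega>" "dl (\<lambda>r. coord j r + c * coord k r) = dc j + c * dc k" for c \<omega>
  proof -
    have l: "lin (\<lambda>r. coord j r + c * coord k r) x = lin (coord j) x + c * lin (coord k) x" for x
      by (simp add: lin_def algebra_simps sum.distrib sum_distrib_left)
    show "Zl (\<lambda>r. coord j r + c * coord k r) \<omega> = Zc j \<omega> + c * Zc k \<omega>"
      unfolding Zl_def Zc_def diffmean_def l by (simp add: sum.distrib add_divide_distrib algebra_simps flip: sum_distrib_left)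
    show "dl (\<lambda>r. coord j r + c * coord k r) = dc j + c * dc k"
      unfolding dl_def dc_def l by (simp add: algebra_simps)
  qed
  define D1 where "D1 = dc j"
  define D2 where "D2 = dc k"
  have one: "expectation (\<lambda>\<omega>. (Zc i \<omega>)\<^sup>2) = (dc i)\<^sup>2 + 1 \<and> expectation (\<lambda>\<omega>. Zc i \<omega> ^ 4) = dc i ^ 4 + 6 * (dc i)\<^sup>2 + 3" if "i \<in> {1..p}" for i
  proof -
    interpret N: normal_chisq M "\<lambda>\<omega>. Zc i \<omega> - dc i" "Wc i" "real n1 + real n2 - 2" by (rule normal_chisq_component[OF that])
    have e: "expectation (\<lambda>\<omega>. Zc i \<omega> ^ q) = (\<integral>x. (dc i + 1 * x) ^ q \<partial>std_normal)" for q
    proof -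
      have "(\<integral>x. (dc i + 1 * x) ^ q \<partial>distr M borel (\<lambda>\<omega>. Zc i \<omega> - dc i)) = expectation (\<lambda>\<omega>. (dc i + 1 * (Zc i \<omega> - dc i)) ^ q)"
        by (rule integral_distr) auto
      then show ?thesis unfolding N.distr_H by simp
    qed
    show ?thesis unfolding e affine_normal_sq affine_normal_fourth by simp
  qed
  obtain s where s: "s \<ge> 0" "expectation (\<lambda>\<omega>. (Zc j \<omega> + 1 * Zc k \<omega>)\<^sup>2) = (D1 + 1 * D2)\<^sup>2 + s\<^sup>2"
    "expectation (\<lambda>\<omega>. (Zc j \<omega> + 1 * Zc k \<omega>) ^ 4) = (D1 + 1 * D2) ^ 4 + 6 * (D1 + 1 * D2)\<^sup>2 * s\<^sup>2 + 3 * s ^ 4"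
    using Zl_moments[of "\<lambda>r. coord j r + 1 * coord k r"] unfolding linear D1_def D2_def by blast
  obtain t where t: "t \<ge> 0" "expectation (\<lambda>\<omega>. (Zc j \<omega> + (-1) * Zc k \<omega>)\<^sup>2) = (D1 + (-1) * D2)\<^sup>2 + t\<^sup>2"
    "expectation (\<lambda>\<omega>. (Zc j \<omega> + (-1) * Zc k \<omega>) ^ 4) = (D1 + (-1) * D2) ^ 4 + 6 * (D1 + (-1) * D2)\<^sup>2 * t\<^sup>2 + 3 * t ^ 4"
    using Zl_moments[of "\<lambda>r. coord j r + (-1) * coord k r"] unfolding linear D1_def D2_def by blast
  have iZ: "integrable M (\<lambda>\<omega>. (Zc j \<omega> + c * Zc k \<omega>) ^ q)" for c q
    using Zl_moments[of "\<lambda>r. coord j r + c * coord k r" q] unfolding linear by blast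
  have iZ1: "integrable M (\<lambda>\<omega>. Zc i \<omega> ^ q)" for i q using Zl_moments[of "coord i" q] unfolding Zc_def by blast
  \<comment> \<open>The parallelogram law: s and t are the standard deviations of the sum and the
    difference of two variables of variance 1.\<close>
  have st: "s\<^sup>2 + t\<^sup>2 = 4"
  proof -
    have "expectation (\<lambda>\<omega>. (Zc j \<omega> + 1 * Zc k \<omega>)\<^sup>2) + expectation (\<lambda>\<omega>. (Zc j \<omega> + (-1) * Zc k \<omega>)\<^sup>2)
       = expectation (\<lambda>\<omega>. (Zc j \<omega> + 1 * Zc k \<omega>)\<^sup>2 + (Zc j \<omega> + (-1) * Zc k \<omega>)\<^sup>2)"
      by (rule Bochner_Integration.integral_add[symmetric]) (rule iZ)+
    also have "\<dots> = expectation (\<lambda>\<omega>. 2 * (Zc j \<omega>)\<^sup>2 + 2 * (Zc k \<omega>)\<^sup>2)"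
      by (intro Bochner_Integration.integral_cong refl) (simp add: power2_eq_square algebra_simps)
    also have "\<dots> = 2 * (D1\<^sup>2 + 1) + 2 * (D2\<^sup>2 + 1)" using one[OF j] one[OF k] iZ1 by (simp add: D1_def D2_def)
    finally show ?thesis unfolding s t by (simp add: power2_eq_square algebra_simps)
  qed
  \<comment> \<open>The correlation, since the variance of the sum is 2 + 2 r. That s^2 and t^2 = 2
    - 2 r are nonnegative gives |r| at most 1.\<close>
  define r where "r = s\<^sup>2 / 2 - 1"
  have sr: "s\<^sup>2 = 2 + 2 * r" "t\<^sup>2 = 2 - 2 * r" using st by (simp_all add: r_def)
  have r1: "\<bar>r\<bar> \<le> 1" using sr zero_le_power2[of s] zero_le_power2[of t] by linarith
  have s4: "s ^ 4 = (2 + 2 * r)\<^sup>2" "t ^ 4 = (2 - 2 * r)\<^sup>2" unfolding sr[symmetric] by simp_all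
  \<comment> \<open>The identity (x+y)^4 + (x-y)^4 - 2 x^4 - 2 y^4 = 12 x^2 y^2.\<close>
  have "12 * expectation (\<lambda>\<omega>. (Zc j \<omega>)\<^sup>2 * (Zc k \<omega>)\<^sup>2)
     = expectation (\<lambda>\<omega>. (Zc j \<omega> + 1 * Zc k \<omega>) ^ 4 + (Zc j \<omega> + (-1) * Zc k \<omega>) ^ 4 - 2 * Zc j \<omega> ^ 4 - 2 * Zc k \<omega> ^ 4)"
    unfolding integral_mult_right_zero[symmetric]
    by (intro Bochner_Integration.integral_cong refl) (simp add: power2_eq_square power4_eq_xxxx algebra_simps)
  also have "\<dots> = expectation (\<lambda>\<omega>. (Zc j \<omega> + 1 * Zc k \<omega>) ^ 4) + expectation (\<lambda>\<omega>. (Zc j \<omega> + (-1) * Zc k \<omega>) ^ 4)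
      - 2 * expectation (\<lambda>\<omega>. Zc j \<omega> ^ 4) - 2 * expectation (\<lambda>\<omega>. Zc k \<omega> ^ 4)"
    by (intro has_bochner_integral_integral_eq has_bochner_integral_diff has_bochner_integral_add
        has_bochner_integral_mult_right has_bochner_integral_integrable iZ iZ1)
  also have "\<dots> = 12 * ((D1\<^sup>2 + 1) * (D2\<^sup>2 + 1) + 2 * r\<^sup>2 + 4 * r * D1 * D2)"
    unfolding s t using one[OF j] one[OF k] unfolding D1_def[symmetric] D2_def[symmetric] s4 sr
    by (simp add: power2_eq_square power4_eq_xxxx algebra_simps)
  finally have E: "expectation (\<lambda>\<omega>. (Zc j \<omega>)\<^sup>2 * (Zc k \<omega>)\<^sup>2) = (D1\<^sup>2 + 1) * (D2\<^sup>2 + 1) + 2 * r\<^sup>2 + 4 * r * D1 * D2" by simp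
  have i4: "integrable M (\<lambda>\<omega>. ((Zc i \<omega>)\<^sup>2) ^ 2)" for i using iZ1[of i 4] by (simp add: power_mult[symmetric])
  have mz: "Zc i \<in> borel_measurable M" for i unfolding Zc_def by measurable
  have m2: "(\<lambda>\<omega>. (Zc i \<omega>)\<^sup>2) \<in> borel_measurable M" for i using mz by measurable
  have cov: "cov M (\<lambda>\<omega>. (Zc j \<omega>)\<^sup>2) (\<lambda>\<omega>. (Zc k \<omega>)\<^sup>2) = 2 * r\<^sup>2 + 4 * r * dc j * dc k"
    by (subst cov_eq[OF iZ1 iZ1 integrable_mult_powers(1)[OF m2 m2 i4 i4]])
       (use E one[OF j] one[OF k] in \<open>simp add: D1_def D2_def\<close>)
  show ?thesis
  proof (intro exI[of _ r] conjI impI)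
    \<comment> \<open>The difference of the two coordinates is identically 0, so its variance t^2
      vanishes.\<close>
    assume "j = k"
    then have "(D1 + (-1) * D2)\<^sup>2 + t\<^sup>2 = 0" unfolding t(2)[symmetric] by simp
    then have "t\<^sup>2 = 0" using zero_le_power2[of "D1 + (-1) * D2"] zero_le_power2[of t] by linarith
    then show "r = 1" using sr by simp
  qed (use r1 cov in auto)
qed

definition Vc :: "nat \<Rightarrow> 'a \<Rightarrow> real" where
  "Vc j \<omega> = (real n1 + real n2) * ln (1 + (Zc j \<omega>)\<^sup>2 / Wc j \<omega>)"

lemma Vc_facts:
  assumes j: "j \<in> {1..p}" and d: "\<bar>dc j\<bar> \<le> b"
  defines "nu \<equiv> real n1 + real n2 - 2"
  shows "nu > 4 * real q \<Longrightarrow> nu \<ge> 2 \<Longrightarrow> integrable M (\<lambda>\<omega>. Vc j \<omega> ^ q) \<and> expectation (\<lambda>\<omega>. Vc j \<omega> ^ q) \<le> 4 ^ q * abs_mom b (2 * q)"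
    and "nu \<ge> 16 \<Longrightarrow> \<bar>expectation (Vc j) - (1 + (dc j)\<^sup>2)\<bar> \<le> (8 * (1 + b\<^sup>2) + 8 * abs_mom b 4) / nu"
    and "nu > 16 \<Longrightarrow> integrable M (\<lambda>\<omega>. (Vc j \<omega> - (Zc j \<omega>)\<^sup>2)\<^sup>2) \<and>
       expectation (\<lambda>\<omega>. (Vc j \<omega> - (Zc j \<omega>)\<^sup>2)\<^sup>2) \<le> (128 * abs_mom b 8 + 48 * abs_mom b 4) / nu"
    and "\<And>\<omega>. 0 \<le> Vc j \<omega>" and "Vc j \<in> borel_measurable M"
    and "integrable M (\<lambda>\<omega>. Zc j \<omega> ^ q)" and "expectation (\<lambda>\<omega>. Zc j \<omega> ^ 4) \<le> abs_mom b 4"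
proof -
  interpret N: normal_chisq M "\<lambda>\<omega>. Zc j \<omega> - dc j" "Wc j" nu unfolding nu_def by (rule normal_chisq_component[OF j])
  have V: "N.V (dc j) = Vc j" unfolding fun_eq_iff N.V_def Vc_def by (simp add: nu_def)
  show "integrable M (\<lambda>\<omega>. Vc j \<omega> ^ q) \<and> expectation (\<lambda>\<omega>. Vc j \<omega> ^ q) \<le> 4 ^ q * abs_mom b (2 * q)" if "nu > 4 * real q" "nu \<ge> 2"
    using N.V_moment[OF that d] unfolding V by simp
  show "\<bar>expectation (Vc j) - (1 + (dc j)\<^sup>2)\<bar> \<le> (8 * (1 + b\<^sup>2) + 8 * abs_mom b 4) / nu" if "nu \<ge> 16"
    using N.V_mean[OF that d] unfolding V .
  show "integrable M (\<lambda>\<omega>. (Vc j \<omega> - (Zc j \<omega>)\<^sup>2)\<^sup>2) \<and>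
       expectation (\<lambda>\<omega>. (Vc j \<omega> - (Zc j \<omega>)\<^sup>2)\<^sup>2) \<le> (128 * abs_mom b 8 + 48 * abs_mom b 4) / nu" if "nu > 16"
    using N.V_minus_square[OF that d] unfolding V by simp
  show "0 \<le> Vc j \<omega>" for \<omega> using N.V_nonneg[of "dc j" \<omega>] unfolding V .
  show "Vc j \<in> borel_measurable M" using N.V_measurable[of "dc j"] unfolding V .
  show "integrable M (\<lambda>\<omega>. Zc j \<omega> ^ q)" using N.integrable_H_poly[of "dc j" q] by simp
  have "(\<integral>x. (x + dc j) ^ 4 \<partial>distr M borel (\<lambda>\<omega>. Zc j \<omega> - dc j)) = expectation (\<lambda>\<omega>. (Zc j \<omega> - dc j + dc j) ^ 4)"
    by (rule integral_distr) auto
  then show "expectation (\<lambda>\<omega>. Zc j \<omega> ^ 4) \<le> abs_mom b 4"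
    using shift_power_le_abs_mom[OF d, of 4] unfolding N.distr_H by simp
qed

text \<open>Write V = Z^2 + D with the second moment of D of order 1 / nu. Expanding first in j and
  then in k leaves only two error covariances, each pairing D with a variable of bounded second
  moment, hence of order 1 / sqrt nu.\<close>

lemma cov_Vc:
  assumes j: "j \<in> {1..p}" and k: "k \<in> {1..p}" and d: "\<bar>dc j\<bar> \<le> b" "\<bar>dc k\<bar> \<le> b" and nu: "real n1 + real n2 - 2 > 16"
  shows "\<exists>r. \<bar>r\<bar> \<le> 1 \<and> (j = k \<longrightarrow> r = 1) \<and>
    \<bar>cov M (Vc j) (Vc k) - (2 * r\<^sup>2 + 4 * r * dc j * dc k)\<bar> \<le> (128 * abs_mom b 8 + 65 * abs_mom b 4) / sqrt (real n1 + real n2 - 2)"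
proof -
  define nu where "nu = real n1 + real n2 - 2"
  define t where "t = sqrt nu"
  have nu': "nu > 16" using nu by (simp add: nu_def)
  have t: "t > 0" "t * t = nu" using nu' by (auto simp: t_def)
  define D where "D i \<omega> = Vc i \<omega> - (Zc i \<omega>)\<^sup>2" for i \<omega>
  define K where "K = 128 * abs_mom b 8 + 48 * abs_mom b 4"
  note fj = Vc_facts[OF j d(1), folded nu_def] and fk = Vc_facts[OF k d(2), folded nu_def]
  have f: "integrable M (\<lambda>\<omega>. (Vc i \<omega>)\<^sup>2) \<and> expectation (\<lambda>\<omega>. (Vc i \<omega>)\<^sup>2) \<le> 16 * abs_mom b 4"
    "integrable M (Vc i)" "integrable M (\<lambda>\<omega>. (D i \<omega>)\<^sup>2) \<and> expectation (\<lambda>\<omega>. (D i \<omega>)\<^sup>2) \<le> K / nu"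
    "Vc i \<in> borel_measurable M" "D i \<in> borel_measurable M" "(\<lambda>\<omega>. (Zc i \<omega>)\<^sup>2) \<in> borel_measurable M"
    "integrable M (\<lambda>\<omega>. (Zc i \<omega>)\<^sup>2)" "integrable M (\<lambda>\<omega>. ((Zc i \<omega>)\<^sup>2)\<^sup>2)" "expectation (\<lambda>\<omega>. ((Zc i \<omega>)\<^sup>2)\<^sup>2) \<le> abs_mom b 4"
    if i: "i = j \<or> i = k" for i
  proof -
    have ii: "i \<in> {1..p}" "\<bar>dc i\<bar> \<le> b" using i j k d by auto
    note fi = Vc_facts[OF ii, folded nu_def]
    show "integrable M (\<lambda>\<omega>. (Vc i \<omega>)\<^sup>2) \<and> expectation (\<lambda>\<omega>. (Vc i \<omega>)\<^sup>2) \<le> 16 * abs_mom b 4" using fi(1)[of 2] nu' by simp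
    show "integrable M (Vc i)" using fi(1)[of 1] nu' by simp
    show "integrable M (\<lambda>\<omega>. (D i \<omega>)\<^sup>2) \<and> expectation (\<lambda>\<omega>. (D i \<omega>)\<^sup>2) \<le> K / nu" using fi(3) nu' by (simp add: D_def K_def)
    show mV: "Vc i \<in> borel_measurable M" by (rule fi(5))
    show mZ: "(\<lambda>\<omega>. (Zc i \<omega>)\<^sup>2) \<in> borel_measurable M" unfolding Zc_def by measurable
    show "D i \<in> borel_measurable M" unfolding D_def[abs_def] using mV mZ by measurable
    show "integrable M (\<lambda>\<omega>. (Zc i \<omega>)\<^sup>2)" by (rule fi(6))
    show "integrable M (\<lambda>\<omega>. ((Zc i \<omega>)\<^sup>2)\<^sup>2)" using fi(6)[of 4] by (simp add: power_mult[symmetric])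
    show "expectation (\<lambda>\<omega>. ((Zc i \<omega>)\<^sup>2)\<^sup>2) \<le> abs_mom b 4" using fi(7) by (simp add: power_mult[symmetric])
  qed
  have iD: "integrable M (D i)" if "i = j \<or> i = k" for i using f(2,7)[OF that] by (simp add: D_def[abs_def])
  have dec: "cov M (Vc j) (Vc k) = cov M (\<lambda>\<omega>. (Zc j \<omega>)\<^sup>2) (\<lambda>\<omega>. (Zc k \<omega>)\<^sup>2) + cov M (D j) (Vc k) + cov M (\<lambda>\<omega>. (Zc j \<omega>)\<^sup>2) (D k)"
  proof -
    have ip: "integrable M (\<lambda>\<omega>. D j \<omega> * Vc k \<omega>)" "integrable M (\<lambda>\<omega>. (Zc j \<omega>)\<^sup>2 * D k \<omega>)" "integrable M (\<lambda>\<omega>. (Zc j \<omega>)\<^sup>2 * (Zc k \<omega>)\<^sup>2)" "integrable M (\<lambda>\<omega>. Vc j \<omega> * Vc k \<omega>)"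
      by (rule integrable_mult_powers(1); use f[of j] f[of k] in simp)+
    have 1: "expectation (\<lambda>\<omega>. Vc j \<omega> * Vc k \<omega>) = expectation (\<lambda>\<omega>. (Zc j \<omega>)\<^sup>2 * (Zc k \<omega>)\<^sup>2) + expectation (\<lambda>\<omega>. D j \<omega> * Vc k \<omega>) + expectation (\<lambda>\<omega>. (Zc j \<omega>)\<^sup>2 * D k \<omega>)"
    proof -
      have "expectation (\<lambda>\<omega>. Vc j \<omega> * Vc k \<omega>) = expectation (\<lambda>\<omega>. (Zc j \<omega>)\<^sup>2 * (Zc k \<omega>)\<^sup>2 + D j \<omega> * Vc k \<omega> + (Zc j \<omega>)\<^sup>2 * D k \<omega>)"
        by (intro Bochner_Integration.integral_cong refl) (simp add: D_def algebra_simps)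
      then show ?thesis using ip by simp
    qed
    have 2: "expectation (Vc i) = expectation (\<lambda>\<omega>. (Zc i \<omega>)\<^sup>2) + expectation (D i)" if "i = j \<or> i = k" for i
      using f(2,7)[OF that] by (simp add: D_def[abs_def])
    have c: "cov M (Vc j) (Vc k) = expectation (\<lambda>\<omega>. Vc j \<omega> * Vc k \<omega>) - expectation (Vc j) * expectation (Vc k)"
      "cov M (\<lambda>\<omega>. (Zc j \<omega>)\<^sup>2) (\<lambda>\<omega>. (Zc k \<omega>)\<^sup>2) = expectation (\<lambda>\<omega>. (Zc j \<omega>)\<^sup>2 * (Zc k \<omega>)\<^sup>2) - expectation (\<lambda>\<omega>. (Zc j \<omega>)\<^sup>2) * expectation (\<lambda>\<omega>. (Zc k \<omega>)\<^sup>2)"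
      "cov M (D j) (Vc k) = expectation (\<lambda>\<omega>. D j \<omega> * Vc k \<omega>) - expectation (D j) * expectation (Vc k)"
      "cov M (\<lambda>\<omega>. (Zc j \<omega>)\<^sup>2) (D k) = expectation (\<lambda>\<omega>. (Zc j \<omega>)\<^sup>2 * D k \<omega>) - expectation (\<lambda>\<omega>. (Zc j \<omega>)\<^sup>2) * expectation (D k)"
      by (rule cov_eq; use f(2)[of j] f(2)[of k] f(7)[of j] f(7)[of k] iD ip in simp)+
    show ?thesis unfolding c 1 using 2[of j] 2[of k] by (simp add: algebra_simps)
  qed
  have c1: "\<bar>cov M (D j) (Vc k)\<bar> \<le> (K / t + 16 * abs_mom b 4 / t) / 2"
  proof -
    have "\<bar>cov M (D j) (Vc k)\<bar> \<le> (t * expectation (\<lambda>\<omega>. (D j \<omega>)\<^sup>2) + expectation (\<lambda>\<omega>. (Vc k \<omega>)\<^sup>2) / t) / 2"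
      by (rule cov_bound_weighted) (use f[of j] f[of k] t in auto)
    also have "\<dots> \<le> (t * (K / nu) + 16 * abs_mom b 4 / t) / 2"
      using f[of j] f[of k] t by (intro divide_right_mono add_mono mult_left_mono) auto
    also have "t * (K / nu) = K / t" using t(1) unfolding t(2)[symmetric] by simp
    finally show ?thesis .
  qed
  have c2: "\<bar>cov M (\<lambda>\<omega>. (Zc j \<omega>)\<^sup>2) (D k)\<bar> \<le> (K / t + abs_mom b 4 / t) / 2"
  proof -
    have "\<bar>cov M (\<lambda>\<omega>. (Zc j \<omega>)\<^sup>2) (D k)\<bar> \<le> (1/t * expectation (\<lambda>\<omega>. ((Zc j \<omega>)\<^sup>2)\<^sup>2) + expectation (\<lambda>\<omega>. (D k \<omega>)\<^sup>2) / (1/t)) / 2"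
      by (rule cov_bound_weighted) (use f[of j] f[of k] t in auto)
    also have "\<dots> \<le> (1/t * abs_mom b 4 + (K / nu) / (1/t)) / 2"
      using f[of j] f[of k] t by (intro divide_right_mono add_mono mult_left_mono) auto
    also have "(K / nu) / (1/t) = K / t" using t(1) unfolding t(2)[symmetric] by simp
    finally show ?thesis by simp
  qed
  have "0 \<le> abs_mom b 4" using d by (intro abs_mom_nonneg) auto
  then have fin: "(K / t + 16 * abs_mom b 4 / t) / 2 + (K / t + abs_mom b 4 / t) / 2 \<le> (128 * abs_mom b 8 + 65 * abs_mom b 4) / t"
  proof -
    assume A: "0 \<le> abs_mom b 4"
    have "(K / t + 16 * abs_mom b 4 / t) / 2 + (K / t + abs_mom b 4 / t) / 2 = (128 * abs_mom b 8 + 56.5 * abs_mom b 4) / t"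
      using t(1) by (simp add: K_def field_simps)
    also have "\<dots> \<le> (128 * abs_mom b 8 + 65 * abs_mom b 4) / t"
      using A t(1) by (intro divide_right_mono) auto
    finally show ?thesis .
  qed
  obtain r where r: "\<bar>r\<bar> \<le> 1" "j = k \<longrightarrow> r = 1" "cov M (\<lambda>\<omega>. (Zc j \<omega>)\<^sup>2) (\<lambda>\<omega>. (Zc k \<omega>)\<^sup>2) = 2 * r\<^sup>2 + 4 * r * dc j * dc k"
    using cov_Zc_sq[OF j k] by blast
  have "\<bar>cov M (Vc j) (Vc k) - (2 * r\<^sup>2 + 4 * r * dc j * dc k)\<bar> \<le> (128 * abs_mom b 8 + 65 * abs_mom b 4) / t"
    unfolding dec r(3) using c1 c2 fin by linarith
  then show ?thesis using r unfolding t_def nu_def by blast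
qed

end

section \<open>Asymptotic power for an abstract array\<close>

context mixing_array
begin

lemma mean_stationary: "j \<in> {1..p m} \<Longrightarrow> P.expectation m (V m j) = P.expectation m (V m 1)"
  using stationary_expectation_single[OF stat V_meas, where f="\<lambda>x. x" and j=j] by simp

text \<open>The variance of the row sum is O(p), so a deviation of R sqrt p has probability
  O(1/R^2). Only the lower tail matters, since the alternative shifts the sum upwards.\<close>

lemma chebyshev_sum:
  assumes R: "filterlim R at_top sequentially"
  shows "(\<lambda>m. P.prob m {\<omega>\<in>space (M m). (\<Sum>j=1..p m. V m j \<omega>) - (\<Sum>j=1..p m. P.expectation m (V m j)) \<le> - (R m * sqrt (real (p m)))}) \<longlonglongrightarrow> 0"
proof -
  obtain B where B: "B \<ge> 0" and ev: "\<forall>\<^sub>F m in sequentially.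
     integrable (M m) (\<lambda>\<omega>. ((\<Sum>j=1..p m. V m j \<omega>) - (\<Sum>j=1..p m. P.expectation m (V m j)))\<^sup>2) \<and>
     P.expectation m (\<lambda>\<omega>. ((\<Sum>j=1..p m. V m j \<omega>) - (\<Sum>j=1..p m. P.expectation m (V m j)))\<^sup>2) \<le> B * real (p m)"
    using variance_bound by blast
  define Z where "Z m \<omega> = (\<Sum>j=1..p m. V m j \<omega>) - (\<Sum>j=1..p m. P.expectation m (V m j))" for m \<omega>
  have Zm: "Z m \<in> borel_measurable (M m)" for m
    unfolding Z_def[abs_def] by (intro borel_measurable_diff borel_measurable_sum V_meas borel_measurable_const) auto
  have evR: "\<forall>\<^sub>F m in sequentially. 1 \<le> R m" using R by (simp add: filterlim_at_top)
  show ?thesis unfolding Z_def[symmetric]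
  proof (rule tendsto_sandwich[OF _ _ tendsto_const])
    show "\<forall>\<^sub>F m in sequentially. P.prob m {\<omega>\<in>space (M m). Z m \<omega> \<le> - (R m * sqrt (real (p m)))} \<le> B * inverse ((R m)\<^sup>2)"
      using ev[folded Z_def] evR ev_p_ge[of 1]
    proof eventually_elim
      case (elim m)
      define c where "c = R m * sqrt (real (p m))"
      have c: "c > 0" using elim by (simp add: c_def)
      have c2: "c\<^sup>2 = (R m)\<^sup>2 * real (p m)" by (simp add: c_def power_mult_distrib)
      have "P.prob m {\<omega>\<in>space (M m). Z m \<omega> \<le> - c} \<le> P.prob m {\<omega>\<in>space (M m). c\<^sup>2 \<le> (Z m \<omega>)\<^sup>2}"
      proof (rule P.finite_measure_mono)
        show "{\<omega>\<in>space (M m). Z m \<omega> \<le> - c} \<subseteq> {\<omega>\<in>space (M m). c\<^sup>2 \<le> (Z m \<omega>)\<^sup>2}"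
          using c by (auto simp: abs_le_square_iff[symmetric])
        show "{\<omega>\<in>space (M m). c\<^sup>2 \<le> (Z m \<omega>)\<^sup>2} \<in> sets (M m)" using Zm[of m] by measurable
      qed
      also have "\<dots> \<le> P.expectation m (\<lambda>\<omega>. (Z m \<omega>)\<^sup>2) / c\<^sup>2"
        using elim c by (intro integral_Markov_inequality_measure[where A="{}"]) auto
      also have "\<dots> \<le> B * real (p m) / c\<^sup>2" using elim by (intro divide_right_mono) auto
      also have "\<dots> = B * inverse ((R m)\<^sup>2)" unfolding c2 using elim by (simp add: field_simps)
      finally show ?case unfolding c_def .
    qed
    have "filterlim (\<lambda>m. (R m)\<^sup>2) at_top sequentially"
      unfolding power2_eq_square by (rule filterlim_at_top_mult_at_top[OF R R])
    from tendsto_inverse_0_at_top[OF this] show "(\<lambda>m. B * inverse ((R m)\<^sup>2)) \<longlonglongrightarrow> 0"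
      by (rule tendsto_mult_right_zero)
  qed simp
qed

text \<open>
  If the common noncentrality \<open>(d m j)\<^sup>2\<close> has a positive limit, both the power and the claimed
  approximation tend to \<open>1\<close>. If the limit is \<open>0\<close>, the autocovariances are asymptotically those
  of the null hypothesis, hence nonnegative: the limit of \<open>tau2\<close> is the long-run variance of the
  array and is at least \<open>2\<close>, so that the central limit theorem applies.
\<close>

lemma power_asymptotics:
  fixes d :: "nat \<Rightarrow> nat \<Rightarrow> real" and G tau2 \<eta> \<kappa> :: "nat \<Rightarrow> real" and z B :: real
  assumes tau_pos: "\<And>m. tau2 m > 0" and tau_lim: "tau2 \<longlonglongrightarrow> 2 + 2 * (\<Sum>k. g (Suc k))" and sg: "summable (\<lambda>k. g (Suc k))"
    and \<eta>: "\<eta> \<longlonglongrightarrow> 0" "(\<lambda>m. sqrt (real (p m)) * \<eta> m) \<longlonglongrightarrow> 0"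
    and mean: "\<forall>\<^sub>F m in sequentially. \<forall>j\<in>{1..p m}. \<bar>P.expectation m (V m j) - (1 + (d m j)\<^sup>2)\<bar> \<le> \<eta> m"
    and G: "\<forall>\<^sub>F m in sequentially. \<bar>G m - 1\<bar> \<le> \<eta> m"
    and \<kappa>: "\<kappa> \<longlonglongrightarrow> 0"
    and cov: "\<forall>\<^sub>F m in sequentially. \<forall>j\<in>{1..p m}. \<forall>k\<in>{1..p m}. \<exists>r. \<bar>r\<bar> \<le> 1 \<and> (j = k \<longrightarrow> r = 1) \<and>
      \<bar>cov (M m) (V m j) (V m k) - (2 * r\<^sup>2 + 4 * r * d m j * d m k)\<bar> \<le> \<kappa> m"
  defines "pow \<equiv> \<lambda>m. P.prob m {\<omega>\<in>space (M m). ((\<Sum>j=1..p m. V m j \<omega>) - real (p m) * G m) / (sqrt (tau2 m) * sqrt (real (p m))) > z}"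
    and "D \<equiv> \<lambda>m. (\<Sum>j=1..p m. (d m j)\<^sup>2) / sqrt (real (p m))"
  shows "(\<lambda>m. pow m - (1 - Phi (z - D m / sqrt (tau2 m)))) \<longlonglongrightarrow> 0"
    and "filterlim D at_top sequentially \<Longrightarrow> pow \<longlonglongrightarrow> 1"
    and "D \<longlonglongrightarrow> 0 \<Longrightarrow> pow \<longlonglongrightarrow> 1 - Phi z"
proof -
  define e where "e m = P.expectation m (V m 1)" for m
  \<comment> \<open>The true shift of the standardized statistic, before division by tau;
    \<open>D\<close> is the shift that the claim uses in its place.\<close>
  define R where "R m = sqrt (real (p m)) * (e m - G m)" for m
  define Z where "Z m \<omega> = (\<Sum>j=1..p m. V m j \<omega>) - (\<Sum>j=1..p m. P.expectation m (V m j))" for m \<omega>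
  \<comment> \<open>The limit of the common squared noncentrality, solved from the limiting variance
    g 0 = 2 + 4 L.\<close>
  define L where "L = (g 0 - 2) / 4"
  define \<tau> where "\<tau> = 2 + 2 * (\<Sum>k. g (Suc k))"
  have Zm: "Z m \<in> borel_measurable (M m)" for m
    unfolding Z_def[abs_def] by (intro borel_measurable_diff borel_measurable_sum V_meas borel_measurable_const) auto
  have mean_e: "P.expectation m (V m j) = e m" if "j \<in> {1..p m}" for m j
    unfolding e_def by (rule mean_stationary[OF that])
  have mean': "\<forall>\<^sub>F m in sequentially. \<forall>j\<in>{1..p m}. \<bar>e m - (1 + (d m j)\<^sup>2)\<bar> \<le> \<eta> m"
    using mean by eventually_elim (metis mean_e)
  \<comment> \<open>Summing p biases of order eta and dividing by sqrt p leaves sqrt p * eta. This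
    is where the growth condition on p takes effect.\<close>
  have RD: "(\<lambda>m. R m - D m) \<longlonglongrightarrow> 0"
  proof (rule Lim_null_comparison)
    show "\<forall>\<^sub>F m in sequentially. norm (R m - D m) \<le> 2 * (sqrt (real (p m)) * \<eta> m)"
      using mean' G ev_p_ge[of 1]
    proof eventually_elim
      case (elim m)
      have sp: "sqrt (real (p m)) > 0" using elim by simp
      define X where "X = real (p m) * (e m - G m) - (\<Sum>j=1..p m. (d m j)\<^sup>2)"
      have "X = (\<Sum>j=1..p m. (e m - G m) - (d m j)\<^sup>2)" unfolding sum_subtractf X_def by (simp add: right_diff_distrib)
      also have "\<bar>\<dots>\<bar> \<le> (\<Sum>j=1..p m. 2 * \<eta> m)"
      proof (intro order_trans[OF sum_abs] sum_mono)
        fix j assume "j \<in> {1..p m}"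
        with elim(1) have "\<bar>e m - (1 + (d m j)\<^sup>2)\<bar> \<le> \<eta> m" by blast
        then show "\<bar>(e m - G m) - (d m j)\<^sup>2\<bar> \<le> 2 * \<eta> m" using elim(2) by linarith
      qed
      also have "\<dots> = real (p m) * (2 * \<eta> m)" by simp
      finally have 1: "\<bar>X\<bar> \<le> real (p m) * (2 * \<eta> m)" .
      have 2: "real (p m) * y / sqrt (real (p m)) = sqrt (real (p m)) * y" for y
      proof -
        have "real (p m) / sqrt (real (p m)) = sqrt (real (p m))" by (rule real_div_sqrt) simp
        then show ?thesis by (metis times_divide_eq_left)
      qed
      have "R m - D m = X / sqrt (real (p m))"
        unfolding R_def D_def X_def diff_divide_distrib 2 ..
      then have "\<bar>R m - D m\<bar> = \<bar>X\<bar> / sqrt (real (p m))" using sp by (simp only: abs_divide abs_of_pos)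
      also have "\<dots> \<le> real (p m) * (2 * \<eta> m) / sqrt (real (p m))"
        by (rule divide_right_mono[OF 1]) (use sp in simp)
      also have "\<dots> = sqrt (real (p m)) * (2 * \<eta> m)" by (rule 2)
      finally show ?case by (simp only: real_norm_def mult.left_commute)
    qed
    show "(\<lambda>m. 2 * (sqrt (real (p m)) * \<eta> m)) \<longlonglongrightarrow> 0" using tendsto_mult_right_zero[OF \<eta>(2)] by simp
  qed
  have e_lim: "(\<lambda>m. e m - 1) \<longlonglongrightarrow> L"
  proof -
    have c0: "(\<lambda>m. (cov (M m) (V m 1) (V m 1) - 2) / 4) \<longlonglongrightarrow> L"
      unfolding L_def using cov_lim[of 0] by (intro tendsto_intros) auto
    have "(\<lambda>m. (e m - 1) - (cov (M m) (V m 1) (V m 1) - 2) / 4) \<longlonglongrightarrow> 0"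
    proof (rule Lim_null_comparison)
      show "\<forall>\<^sub>F m in sequentially. norm ((e m - 1) - (cov (M m) (V m 1) (V m 1) - 2) / 4) \<le> \<eta> m + \<kappa> m / 4"
        using mean' cov ev_p_ge[of 1]
      proof eventually_elim
        case (elim m)
        then have 1: "1 \<in> {1..p m}" by simp
        then have "\<bar>e m - (1 + (d m 1)\<^sup>2)\<bar> \<le> \<eta> m" using elim(1) by blast
        moreover have "\<bar>cov (M m) (V m 1) (V m 1) - (2 + 4 * (d m 1)\<^sup>2)\<bar> \<le> \<kappa> m"
        proof -
          obtain r where "r = 1" "\<bar>cov (M m) (V m 1) (V m 1) - (2 * r\<^sup>2 + 4 * r * d m 1 * d m 1)\<bar> \<le> \<kappa> m"
            using elim(2) 1 by blast
          then show ?thesis by (simp add: power2_eq_square)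
        qed
        ultimately show ?case unfolding real_norm_def by (simp add: abs_le_iff field_simps)
      qed
      show "(\<lambda>m. \<eta> m + \<kappa> m / 4) \<longlonglongrightarrow> 0" using tendsto_add[OF \<eta>(1) tendsto_divide[OF \<kappa> tendsto_const[of 4]]] by simp
    qed
    from tendsto_add[OF this c0] show ?thesis by simp
  qed
  have L0: "L \<ge> 0"
  proof (rule tendsto_lowerbound)
    show "(\<lambda>m. (e m - 1) + \<eta> m) \<longlonglongrightarrow> L" using tendsto_add[OF e_lim \<eta>(1)] by simp
    show "\<forall>\<^sub>F m in sequentially. 0 \<le> (e m - 1) + \<eta> m"
      using mean' ev_p_ge[of 1]
    proof eventually_elim
      case (elim m)
      then have "\<bar>e m - (1 + (d m 1)\<^sup>2)\<bar> \<le> \<eta> m" by auto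
      then show ?case using zero_le_power2[of "d m 1"] by linarith
    qed
  qed simp
  have stau: "(\<lambda>m. sqrt (tau2 m)) \<longlonglongrightarrow> sqrt \<tau>" unfolding \<tau>_def by (intro tendsto_intros tau_lim)
  have st0: "sqrt (tau2 m) > 0" for m using tau_pos[of m] by simp
  have pow_eq: "\<forall>\<^sub>F m in sequentially. pow m = P.prob m {\<omega>\<in>space (M m). Z m \<omega> / (sqrt (tau2 m) * sqrt (real (p m))) > z - R m / sqrt (tau2 m)}"
    using ev_p_ge[of 1]
  proof eventually_elim
    case (elim m)
    have sp: "sqrt (real (p m)) > 0" using elim by simp
    have "(\<Sum>j=1..p m. P.expectation m (V m j)) = (\<Sum>j=1..p m. e m)" by (intro sum.cong refl mean_e)
    then have "(\<Sum>j=1..p m. P.expectation m (V m j)) = real (p m) * e m" by simp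
    then have "(\<Sum>j=1..p m. V m j \<omega>) - real (p m) * G m = Z m \<omega> + real (p m) * (e m - G m)" for \<omega>
      by (simp add: Z_def algebra_simps)
    moreover have "real (p m) * (e m - G m) / (sqrt (tau2 m) * sqrt (real (p m))) = R m / sqrt (tau2 m)"
    proof -
      have "real (p m) / sqrt (real (p m)) = sqrt (real (p m))" by (rule real_div_sqrt) simp
      moreover have "real (p m) * (e m - G m) / (sqrt (tau2 m) * sqrt (real (p m))) = real (p m) / sqrt (real (p m)) * (e m - G m) / sqrt (tau2 m)"
        by simp
      ultimately show ?thesis unfolding R_def by simp
    qed
    ultimately have "((\<Sum>j=1..p m. V m j \<omega>) - real (p m) * G m) / (sqrt (tau2 m) * sqrt (real (p m))) > z \<longleftrightarrow>
        Z m \<omega> / (sqrt (tau2 m) * sqrt (real (p m))) > z - R m / sqrt (tau2 m)" for \<omega>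
      unfolding add_divide_distrib by (simp add: add_divide_distrib) linarith
    then show ?case unfolding pow_def by simp
  qed
  \<comment> \<open>At this point the limit of \<open>tau2\<close> may be 0, so only an eventual
    upper bound T for its square root enters: a smaller tau merely accelerates the
    divergence.\<close>
  have Phi_D: "(\<lambda>m. Phi (z - D m / sqrt (tau2 m))) \<longlonglongrightarrow> 0" if "filterlim D at_top sequentially"
  proof -
    define T where "T = sqrt \<tau> + 1"
    have T: "\<forall>\<^sub>F m in sequentially. sqrt (tau2 m) < T" using stau by (rule order_tendstoD) (simp add: T_def)
    have "sqrt \<tau> \<ge> 0" by (rule tendsto_lowerbound[OF stau]) (use st0 in \<open>auto intro: less_imp_le always_eventually\<close>)
    then have T0: "T > 0" unfolding T_def by linarith
    have "filterlim (\<lambda>m. (1/T) * D m) at_top sequentially"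
      by (rule filterlim_tendsto_pos_mult_at_top[OF tendsto_const _ that]) (use T0 in simp)
    then have "filterlim (\<lambda>m. D m / sqrt (tau2 m)) at_top sequentially"
    proof (rule filterlim_at_top_mono)
      have "\<forall>\<^sub>F m in sequentially. 0 \<le> D m" using that by (simp add: filterlim_at_top)
      then show "\<forall>\<^sub>F m in sequentially. 1/T * D m \<le> D m / sqrt (tau2 m)" using T
      proof eventually_elim
        case (elim m)
        have "D m / T \<le> D m / sqrt (tau2 m)" using elim st0[of m] T0 by (intro divide_left_mono) auto
        then show ?case by simp
      qed
    qed
    then have "filterlim (\<lambda>m. - z + D m / sqrt (tau2 m)) at_top sequentially"
      by (rule filterlim_tendsto_add_at_top[OF tendsto_const])
    then have "filterlim (\<lambda>m. z - D m / sqrt (tau2 m)) at_bot sequentially"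
      unfolding filterlim_uminus_at_top by simp
    from filterlim_compose[OF Phi_lim(2) this] show ?thesis .
  qed
  have sqrt_p: "filterlim (\<lambda>m. sqrt (real (p m))) at_top sequentially"
    by (intro filterlim_compose[OF sqrt_at_top] filterlim_compose[OF filterlim_real_sequentially p_lim])
  have eG: "(\<lambda>m. e m - G m) \<longlonglongrightarrow> L"
  proof -
    have "(\<lambda>m. G m - 1) \<longlonglongrightarrow> 0" by (rule Lim_null_comparison[OF _ \<eta>(1)]) (use G in simp)
    from tendsto_diff[OF e_lim this] show ?thesis by simp
  qed
  have big: "filterlim R at_top sequentially \<and> filterlim D at_top sequentially" if "L > 0"
  proof -
    have R: "filterlim R at_top sequentially"
      unfolding R_def using filterlim_tendsto_pos_mult_at_top[OF eG that sqrt_p] by (simp add: mult.commute)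
    have "(\<lambda>m. D m - R m) \<longlonglongrightarrow> 0" using tendsto_minus[OF RD] by simp
    from filterlim_tendsto_add_at_top[OF this R] show ?thesis using R by simp
  qed
  have main0: "(\<lambda>m. pow m - (1 - Phi (z - D m / sqrt (tau2 m)))) \<longlonglongrightarrow> 0 \<and> 0 < \<tau>" if "L = 0"
  proof -
    have g0: "g 0 = 2" using that by (simp add: L_def)
    \<comment> \<open>The covariance is close to 2 r^2 plus a cross term bounded by four times the
      vanishing noncentrality, so its limit cannot be negative.\<close>
    have gk: "g (Suc k) \<ge> 0" for k
    proof (rule tendsto_lowerbound)
      have "(\<lambda>m. cov (M m) (V m 1) (V m (1 + Suc k)) + (4 * (\<bar>e m - 1\<bar> + \<eta> m) + \<kappa> m)) \<longlonglongrightarrow> g (Suc k) + (4 * (\<bar>L\<bar> + 0) + 0)"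
        by (intro tendsto_intros cov_lim e_lim \<eta> \<kappa>)
      then show "(\<lambda>m. cov (M m) (V m 1) (V m (1 + Suc k)) + (4 * (\<bar>e m - 1\<bar> + \<eta> m) + \<kappa> m)) \<longlonglongrightarrow> g (Suc k)"
        using that by simp
      show "\<forall>\<^sub>F m in sequentially. 0 \<le> cov (M m) (V m 1) (V m (1 + Suc k)) + (4 * (\<bar>e m - 1\<bar> + \<eta> m) + \<kappa> m)"
        using mean' cov ev_p_ge[of "Suc (Suc k)"]
      proof eventually_elim
        case (elim m)
        have in1: "1 \<in> {1..p m}" "1 + Suc k \<in> {1..p m}" using elim(3) by auto
        obtain r where r: "\<bar>r\<bar> \<le> 1" "\<bar>cov (M m) (V m 1) (V m (1 + Suc k)) - (2 * r\<^sup>2 + 4 * r * d m 1 * d m (1 + Suc k))\<bar> \<le> \<kappa> m"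
          using elim(2) in1 by blast
        define x where "x = d m 1"
        define y where "y = d m (1 + Suc k)"
        have xy: "x\<^sup>2 \<le> \<bar>e m - 1\<bar> + \<eta> m" "y\<^sup>2 \<le> \<bar>e m - 1\<bar> + \<eta> m"
          using elim(1)[rule_format, OF in1(1)] elim(1)[rule_format, OF in1(2)] by (auto simp: x_def y_def)
        have "0 \<le> (\<bar>x\<bar> - \<bar>y\<bar>)\<^sup>2" by simp
        then have "2 * (\<bar>x\<bar> * \<bar>y\<bar>) \<le> x\<^sup>2 + y\<^sup>2" by (simp add: power2_diff)
        then have "\<bar>x\<bar> * \<bar>y\<bar> \<le> \<bar>e m - 1\<bar> + \<eta> m" using xy by linarith
        moreover have "\<bar>r * (x * y)\<bar> \<le> 1 * (\<bar>x\<bar> * \<bar>y\<bar>)" unfolding abs_mult using r(1) by (intro mult_right_mono) auto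
        ultimately have "- (\<bar>e m - 1\<bar> + \<eta> m) \<le> r * (x * y)" by linarith
        moreover have "\<bar>cov (M m) (V m 1) (V m (1 + Suc k)) - (2 * r\<^sup>2 + 4 * (r * (x * y)))\<bar> \<le> \<kappa> m"
          using r(2) by (simp add: x_def y_def mult.assoc)
        moreover have "0 \<le> c + (4 * E + k)" if "- E \<le> w" "\<bar>c - (2 * s + 4 * w)\<bar> \<le> k" "0 \<le> s" for E w c s k :: real
          using that by linarith
        ultimately show ?case using zero_le_power2[of r] by blast
      qed
    qed simp
    have "0 \<le> (\<Sum>k. g (Suc k))" by (rule suminf_nonneg[OF sg gk])
    then have \<tau>: "0 < \<tau>" by (simp add: \<tau>_def)
    \<comment> \<open>Because g 0 = 2, the limit of \<open>tau2\<close> coincides with the long-run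
      variance of the central limit theorem.\<close>
    have \<tau>': "g 0 + 2 * (\<Sum>k. g (Suc k)) = \<tau>" using g0 by (simp add: \<tau>_def)
    have "(\<lambda>m. P.prob m {\<omega>\<in>space (M m). Z m \<omega> / (sqrt (tau2 m) * sqrt (real (p m))) > z - R m / sqrt (tau2 m)}
       - (1 - Phi (z - R m / sqrt (tau2 m)))) \<longlonglongrightarrow> 0"
      using tail_clt[of "\<lambda>m. sqrt (tau2 m)" "\<lambda>m. z - R m / sqrt (tau2 m)"] stau \<tau> unfolding \<tau>' Z_def by simp
    moreover have "\<forall>\<^sub>F m in sequentially. P.prob m {\<omega>\<in>space (M m). Z m \<omega> / (sqrt (tau2 m) * sqrt (real (p m))) > z - R m / sqrt (tau2 m)}
       - (1 - Phi (z - R m / sqrt (tau2 m))) = pow m - (1 - Phi (z - R m / sqrt (tau2 m)))"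
      using pow_eq by eventually_elim simp
    ultimately have 1: "(\<lambda>m. pow m - (1 - Phi (z - R m / sqrt (tau2 m)))) \<longlonglongrightarrow> 0" by (rule Lim_transform_eventually)
    \<comment> \<open>The central limit theorem is stated at the threshold with the true shift
      \<open>R\<close>; Lipschitz continuity replaces it by the claimed shift
      \<open>D\<close>.\<close>
    have 2: "(\<lambda>m. Phi (z - D m / sqrt (tau2 m)) - Phi (z - R m / sqrt (tau2 m))) \<longlonglongrightarrow> 0"
    proof (rule Lim_null_comparison)
      have "(\<lambda>m. \<bar>(R m - D m) / sqrt (tau2 m)\<bar>) \<longlonglongrightarrow> \<bar>0 / sqrt \<tau>\<bar>"
        using \<tau> by (intro tendsto_intros RD stau) auto
      then show "(\<lambda>m. \<bar>(R m - D m) / sqrt (tau2 m)\<bar>) \<longlonglongrightarrow> 0" by simp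
      have "\<bar>Phi (z - D m / sqrt (tau2 m)) - Phi (z - R m / sqrt (tau2 m))\<bar> \<le> \<bar>(R m - D m) / sqrt (tau2 m)\<bar>" for m
        using Phi_lipschitz[of "z - D m / sqrt (tau2 m)" "z - R m / sqrt (tau2 m)"] by (simp add: diff_divide_distrib)
      then show "\<forall>\<^sub>F m in sequentially. norm (Phi (z - D m / sqrt (tau2 m)) - Phi (z - R m / sqrt (tau2 m))) \<le> \<bar>(R m - D m) / sqrt (tau2 m)\<bar>"
        by simp
    qed
    have "(\<lambda>m. pow m - (1 - Phi (z - D m / sqrt (tau2 m)))) \<longlonglongrightarrow> 0"
      using tendsto_add[OF 1 2] by (simp add: algebra_simps)
    then show ?thesis using \<tau> by simp
  qed
  \<comment> \<open>The complement of the rejection event is a downward deviation by R - z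
    sqrt(tau2) in units of sqrt p, and this multiple diverges.\<close>
  have pow1: "pow \<longlonglongrightarrow> 1" if "L > 0"
  proof -
    have R: "filterlim R at_top sequentially" using big[OF that] by simp
    have "(\<lambda>m. - (z * sqrt (tau2 m))) \<longlonglongrightarrow> - (z * sqrt \<tau>)" by (intro tendsto_intros stau)
    from filterlim_tendsto_add_at_top[OF this R]
    have R': "filterlim (\<lambda>m. R m - z * sqrt (tau2 m)) at_top sequentially" by simp
    have "(\<lambda>m. 1 - P.prob m {\<omega>\<in>space (M m). Z m \<omega> \<le> - ((R m - z * sqrt (tau2 m)) * sqrt (real (p m)))}) \<longlonglongrightarrow> 1 - 0"
      unfolding Z_def by (intro tendsto_intros chebyshev_sum R')
    moreover have "\<forall>\<^sub>F m in sequentially. 1 - P.prob m {\<omega>\<in>space (M m). Z m \<omega> \<le> - ((R m - z * sqrt (tau2 m)) * sqrt (real (p m)))} = pow m"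
      using pow_eq ev_p_ge[of 1]
    proof eventually_elim
      case (elim m)
      have sp: "sqrt (tau2 m) * sqrt (real (p m)) > 0" using elim st0[of m] by simp
      have eq: "z - R m / sqrt (tau2 m) < Z m \<omega> / (sqrt (tau2 m) * sqrt (real (p m))) \<longleftrightarrow> \<not> (Z m \<omega> \<le> - ((R m - z * sqrt (tau2 m)) * sqrt (real (p m))))" for \<omega>
      proof -
        have "z - R m / sqrt (tau2 m) < Z m \<omega> / (sqrt (tau2 m) * sqrt (real (p m))) \<longleftrightarrow> (z - R m / sqrt (tau2 m)) * (sqrt (tau2 m) * sqrt (real (p m))) < Z m \<omega>"
          by (rule pos_less_divide_eq[OF sp])
        moreover have "(z - R m / sqrt (tau2 m)) * (sqrt (tau2 m) * sqrt (real (p m))) = - ((R m - z * sqrt (tau2 m)) * sqrt (real (p m)))"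
          using st0[of m] by (simp add: algebra_simps)
        ultimately show ?thesis by (simp add: not_le)
      qed
      have "{\<omega>\<in>space (M m). z - R m / sqrt (tau2 m) < Z m \<omega> / (sqrt (tau2 m) * sqrt (real (p m)))}
         = space (M m) - {\<omega>\<in>space (M m). Z m \<omega> \<le> - ((R m - z * sqrt (tau2 m)) * sqrt (real (p m)))}"
        unfolding eq by auto
      moreover have "{\<omega>\<in>space (M m). Z m \<omega> \<le> - ((R m - z * sqrt (tau2 m)) * sqrt (real (p m)))} \<in> sets (M m)"
        using Zm[of m] by measurable
      ultimately show ?case using elim(1) P.prob_compl by simp
    qed
    ultimately show ?thesis by (simp add: Lim_transform_eventually)
  qed
  show A: "(\<lambda>m. pow m - (1 - Phi (z - D m / sqrt (tau2 m)))) \<longlonglongrightarrow> 0"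
  proof (cases "L = 0")
    case True then show ?thesis using main0 by simp
  next
    case False
    then have L: "L > 0" using L0 by simp
    from tendsto_diff[OF pow1[OF L] tendsto_diff[OF tendsto_const[of 1] Phi_D[OF conjunct2[OF big[OF L]]]]]
    show ?thesis by simp
  qed
  show "pow \<longlonglongrightarrow> 1" if "filterlim D at_top sequentially"
    using tendsto_add[OF A tendsto_diff[OF tendsto_const[of 1] Phi_D[OF that]]] by simp
  show "pow \<longlonglongrightarrow> 1 - Phi z" if D0: "D \<longlonglongrightarrow> 0"
  proof -
    \<comment> \<open>A positive limit would make \<open>D\<close> diverge, contrary to its
      convergence to 0.\<close>
    have "L = 0"
    proof (rule ccontr)
      assume "L \<noteq> 0"
      then have "filterlim D at_top sequentially" using big L0 by simp
      then show False using not_tendsto_and_filterlim_at_infinity[OF _ D0 filterlim_at_top_imp_at_infinity] by simp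
    qed
    then have "0 < \<tau>" using main0 by simp
    then have "(\<lambda>m. z - D m / sqrt (tau2 m)) \<longlonglongrightarrow> z - 0 / sqrt \<tau>" by (intro tendsto_intros D0 stau) auto
    then have "(\<lambda>m. Phi (z - D m / sqrt (tau2 m))) \<longlonglongrightarrow> Phi z"
      using isCont_tendsto_compose[OF Phi_isCont] by simp
    from tendsto_add[OF A tendsto_diff[OF tendsto_const[of 1] this]] show ?thesis by simp
  qed
qed

end

section \<open>Mixing coefficients and their decay\<close>

lemma (in prob_space) alpha_coef_bounds:
  assumes "A \<in> F" "B \<in> G"
  shows "\<bar>prob (A \<inter> B) - prob A * prob B\<bar> \<le> alpha_coef M F G" "0 \<le> alpha_coef M F G" "alpha_coef M F G \<le> 1"
proof -
  let ?S = "{\<bar>prob (A \<inter> B) - prob A * prob B\<bar> | A B. A \<in> F \<and> B \<in> G}"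
  have le1: "x \<le> 1" if x_in: "x \<in> ?S" for x
  proof -
    obtain A B where x: "x = \<bar>prob (A \<inter> B) - prob A * prob B\<bar>" using x_in by blast
    have "0 \<le> prob A * prob B" "prob A * prob B \<le> 1" "0 \<le> prob (A \<inter> B)" "prob (A \<inter> B) \<le> 1"
      by (auto intro: mult_le_one)
    then show ?thesis unfolding x by linarith
  qed
  then have bdd: "bdd_above ?S" by (intro bdd_aboveI)
  show 1: "\<bar>prob (A \<inter> B) - prob A * prob B\<bar> \<le> alpha_coef M F G"
    unfolding alpha_coef_def by (rule cSup_upper[OF _ bdd]) (use assms in auto)
  then show "0 \<le> alpha_coef M F G" by (rule order_trans[OF abs_ge_zero])
  show "alpha_coef M F G \<le> 1"
    unfolding alpha_coef_def by (rule cSup_least) (use assms le1 in auto)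
qed

lemma empty_in_gen_sigma: "{} \<in> gen_sigma M V a b"
  unfolding gen_sigma_def by (rule sigma_sets.Empty)

text \<open>A real \<open>Sup\<close> carries information only for a nonempty set with an upper
  bound: the lag condition supplies an admissible k, and 1 bounds every coefficient. The bound also
  makes the supremum over all rows meaningful.\<close>

lemma (in prob_space) mix_alpha_le_1: "mix_alpha M V p r \<le> 1"
proof (cases "r < p")
  case True
  then have "{alpha_coef M (gen_sigma M V 1 k) (gen_sigma M V (k + r) p) | k. 1 \<le> k \<and> k + r \<le> p} \<noteq> {}"
    by (auto intro!: exI[of _ "1::nat"])
  then have "Sup {alpha_coef M (gen_sigma M V 1 k) (gen_sigma M V (k + r) p) | k. 1 \<le> k \<and> k + r \<le> p} \<le> 1"
    by (rule cSup_least) (use alpha_coef_bounds(3)[OF empty_in_gen_sigma empty_in_gen_sigma] in auto)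
  then show ?thesis using True by (simp add: mix_alpha_def)
qed (simp add: mix_alpha_def)

lemma (in prob_space) alpha_coef_le_mix_alpha:
  assumes "1 \<le> k" "k + r \<le> p"
  shows "alpha_coef M (gen_sigma M V 1 k) (gen_sigma M V (k + r) p) \<le> mix_alpha M V p r"
proof -
  have "alpha_coef M (gen_sigma M V 1 k) (gen_sigma M V (k + r) p) \<le> Sup {alpha_coef M (gen_sigma M V 1 k) (gen_sigma M V (k + r) p) | k. 1 \<le> k \<and> k + r \<le> p}"
    by (rule cSup_upper)
      (use assms alpha_coef_bounds(3)[OF empty_in_gen_sigma empty_in_gen_sigma] in \<open>auto intro!: bdd_aboveI[where M=1]\<close>)
  then show ?thesis using assms by (simp add: mix_alpha_def)
qed

lemma (in prob_space) mix_alpha_nonneg: "0 \<le> mix_alpha M V p r"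
proof (cases "r < p")
  case True
  then have "1 + r \<le> p" by simp
  then have "alpha_coef M (gen_sigma M V 1 1) (gen_sigma M V (1 + r) p) \<le> mix_alpha M V p r"
    by (intro alpha_coef_le_mix_alpha) auto
  moreover have "0 \<le> alpha_coef M (gen_sigma M V 1 1) (gen_sigma M V (1 + r) p)"
    by (rule alpha_coef_bounds(2)[OF empty_in_gen_sigma empty_in_gen_sigma])
  ultimately show ?thesis by linarith
qed (simp add: mix_alpha_def)

text \<open>By monotonicity, r times the theta-th power of al r is at most the sum of the first r
  terms, hence at most the total S. So al r is at most (S / r)^(1/theta), and 1/theta = 1 + 2/delta.
  The excess is capped at 1 to match the exponent arithmetic of the central limit theorem.\<close>

lemma polynomial_rate:
  fixes al :: "nat \<Rightarrow> real"
  assumes nonneg: "\<And>r. 0 \<le> al r" and mono: "\<And>r. 1 \<le> r \<Longrightarrow> al (Suc r) \<le> al r"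
    and \<delta>: "\<delta> > 0" and sum: "summable (\<lambda>r. al (Suc r) powr (\<delta> / (2 + \<delta>)))"
  shows "\<exists>\<beta> C. 0 < \<beta> \<and> \<beta> \<le> 1 \<and> (\<forall>r\<ge>1. al r \<le> C * real r powr - (1 + \<beta>))"
proof -
  define \<theta> where "\<theta> = \<delta> / (2 + \<delta>)"
  define S where "S = (\<Sum>r. al (Suc r) powr \<theta>)"
  define \<beta> where "\<beta> = min 1 (2 / \<delta>)"
  have \<theta>: "\<theta> > 0" "1 / \<theta> = 1 + 2 / \<delta>" using \<delta> by (simp_all add: \<theta>_def field_simps)
  have dec: "al j \<le> al i" if "1 \<le> i" "i \<le> j" for i j
    using that(2,1) by (induction rule: dec_induct) (auto intro: order_trans[OF mono])
  have "al r \<le> S powr (1 / \<theta>) * real r powr - (1 + \<beta>)" if r: "1 \<le> r" for r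
  proof -
    have "real r * al r powr \<theta> = (\<Sum>i<r. al r powr \<theta>)" by simp
    also have "\<dots> \<le> (\<Sum>i<r. al (Suc i) powr \<theta>)" using dec nonneg \<theta> by (intro sum_mono powr_mono2) auto
    also have "\<dots> \<le> S" unfolding S_def by (rule sum_le_suminf) (use sum in \<open>auto simp: \<theta>_def\<close>)
    finally have 1: "al r powr \<theta> \<le> S / real r" using r by (simp add: field_simps)
    have "0 \<le> S / real r" using powr_ge_zero 1 by (rule order_trans)
    then have S0: "0 \<le> S" using r by (simp add: zero_le_divide_iff)
    have "al r = (al r powr \<theta>) powr (1 / \<theta>)" using \<theta>(1) nonneg[of r] by (simp add: powr_powr)
    also have "\<dots> \<le> (S / real r) powr (1 / \<theta>)" using 1 \<theta>(1) by (intro powr_mono2) auto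
    also have "\<dots> = S powr (1 / \<theta>) * real r powr - (1 / \<theta>)" 
      unfolding powr_divide powr_minus by (rule divide_inverse)
    also have "\<dots> \<le> S powr (1 / \<theta>) * real r powr - (1 + \<beta>)"
      using r unfolding \<theta>(2) \<beta>_def by (intro mult_left_mono powr_mono) auto
    finally show ?thesis .
  qed
  moreover have "0 < \<beta>" "\<beta> \<le> 1" using \<delta> by (auto simp: \<beta>_def)
  ultimately show ?thesis by blast
qed

section \<open>Identification of the pooled t-statistic\<close>

context two_sample
begin

lemma dc_eq: "j \<in> {1..p} \<Longrightarrow> dc j = sqrt (real n1 * real n2 / real (n1 + n2)) * (mu1 j - mu2 j) / sqrt (S j j)"
  by (simp add: dc_def dl_def lin_coord sd_def flip: diff_divide_distrib)

text \<open>The factor nu in the pooled variance and the scaling by the standard deviation of the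
  coordinate cancel. If the pooled sum of squares is 0, both sides are 0 by the convention for
  division.\<close>

lemma t_statistic:
  assumes j: "j \<in> {1..p}"
  defines "xb \<equiv> \<lambda>\<omega>. (\<Sum>i=1..n1. X \<omega> i j) / real n1" and "yb \<equiv> \<lambda>\<omega>. (\<Sum>k=1..n2. Y \<omega> k j) / real n2"
  shows "(sqrt (real n1 * real n2 / real (n1 + n2)) * (xb \<omega> - yb \<omega>) /
      sqrt (((\<Sum>i=1..n1. (X \<omega> i j - xb \<omega>)\<^sup>2) + (\<Sum>k=1..n2. (Y \<omega> k j - yb \<omega>)\<^sup>2)) / (real (n1 + n2) - 2)))\<^sup>2 / (real (n1 + n2) - 2)
    = (Zc j \<omega>)\<^sup>2 / Wc j \<omega>"
proof -
  define s where "s = sd j"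
  have s: "s > 0" using S_pos[OF j] by (simp add: s_def sd_def)
  define nu where "nu = real (n1 + n2) - 2"
  have nu: "nu > 0" using n by (simp add: nu_def)
  define Q where "Q = (\<Sum>i=1..n1. (X \<omega> i j - xb \<omega>)\<^sup>2) + (\<Sum>k=1..n2. (Y \<omega> k j - yb \<omega>)\<^sup>2)"
  have Q0: "Q \<ge> 0" unfolding Q_def by (intro add_nonneg_nonneg sum_nonneg) auto
  have Z: "Zc j \<omega> = sqrt (real n1 * real n2 / real (n1 + n2)) * (xb \<omega> - yb \<omega>) / s"
  proof -
    have "a / s / real n1 - b / s / real n2 = (a / real n1 - b / real n2) / s" for a b
      by (simp add: diff_divide_distrib mult.commute)
    then show ?thesis
      unfolding Zc_def Zl_def diffmean_def lin_coord[OF j] s_def[symmetric] sum_divide_distrib[symmetric] xb_def yb_def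
      by simp
  qed
  have sq: "sqdev {1..k} (\<lambda>i. x i / s - l) = (\<Sum>i=1..k. (x i - (\<Sum>i=1..k. x i) / real k)\<^sup>2) / s\<^sup>2" if "1 \<le> k" for k :: nat and x l
  proof -
    have "(\<Sum>i=1..k. x i / s - l) / real k = (\<Sum>i=1..k. x i) / real k / s - l"
      using that unfolding sum_subtractf sum_divide_distrib[symmetric] by (simp add: diff_divide_distrib)
    then have "sqdev {1..k} (\<lambda>i. x i / s - l) = (\<Sum>i=1..k. (x i / s - l - ((\<Sum>i=1..k. x i) / real k / s - l))\<^sup>2)"
      using sum_sq_dev_mean[of "{1..k}" "\<lambda>i. x i / s - l"] that by simp
    also have "\<dots> = (\<Sum>i=1..k. (x i - (\<Sum>i=1..k. x i) / real k)\<^sup>2 / s\<^sup>2)"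
    proof (intro sum.cong refl)
      fix i
      define m where "m = (\<Sum>i=1..k. x i) / real k"
      have "x i / s - l - (m / s - l) = (x i - m) / s" by (simp add: diff_divide_distrib)
      then show "(x i / s - l - (m / s - l))\<^sup>2 = (x i - m)\<^sup>2 / s\<^sup>2" by (simp add: power_divide)
    qed
    finally show ?thesis by (simp add: sum_divide_distrib)
  qed
  have W: "Wc j \<omega> = Q / s\<^sup>2"
    unfolding Wc_def lin_coord[OF j] s_def[symmetric] sq[OF n(1)] sq[OF n(2)] Q_def xb_def yb_def by (simp add: add_divide_distrib)
  have "(c / sqrt (Q / nu))\<^sup>2 / nu = (c / s)\<^sup>2 / (Q / s\<^sup>2)" for c
    using Q0 nu s by (simp add: power_divide)
  then show ?thesis unfolding Z W Q_def[symmetric] nu_def[symmetric] .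
qed

end

section \<open>Asymptotic power\<close>

theorem theorem4:
  fixes M :: "nat \<Rightarrow> 'a measure"
    and n1 n2 p :: "nat \<Rightarrow> nat"
    and X :: "nat \<Rightarrow> 'a \<Rightarrow> nat \<Rightarrow> nat \<Rightarrow> real"
    and Y :: "nat \<Rightarrow> 'a \<Rightarrow> nat \<Rightarrow> nat \<Rightarrow> real"
    and mu1 mu2 delta2 :: "nat \<Rightarrow> nat \<Rightarrow> real"
    and Sigma :: "nat \<Rightarrow> nat \<Rightarrow> nat \<Rightarrow> real"
    and c lvl :: real
    and gamma :: "nat \<Rightarrow> real"
  defines "N \<equiv> \<lambda>m. n1 m + n2 m"
  defines "nu2 \<equiv> \<lambda>m. real (N m) - 2"
  defines "Xbar \<equiv> \<lambda>m \<omega> j. (\<Sum>i=1..n1 m. X m \<omega> i j) / real (n1 m)"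
  defines "Ybar \<equiv> \<lambda>m \<omega> j. (\<Sum>k=1..n2 m. Y m \<omega> k j) / real (n2 m)"
  defines "s2pool \<equiv> \<lambda>m \<omega> j. ((\<Sum>i=1..n1 m. (X m \<omega> i j - Xbar m \<omega> j)^2)
                                + (\<Sum>k=1..n2 m. (Y m \<omega> k j - Ybar m \<omega> j)^2)) / (real (N m) - 2)"
  defines "tN \<equiv> \<lambda>m \<omega> j. sqrt (real (n1 m) * real (n2 m) / real (N m))
                          * (Xbar m \<omega> j - Ybar m \<omega> j) / sqrt (s2pool m \<omega> j)"
  defines "V \<equiv> \<lambda>m j \<omega>. real (N m) * ln (1 + (tN m \<omega> j)^2 / nu2 m)"
  defines "T2 \<equiv> \<lambda>m \<omega>. \<Sum>j=1..p m. V m j \<omega>"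
  defines "G1 \<equiv> \<lambda>m. real (N m) * Dfun (nu2 m)"
  defines "G2 \<equiv> \<lambda>m. (real (N m))^2 * ((Dfun (nu2 m))^2 - 2 * deriv Dfun (nu2 m))"
  defines "alpha \<equiv> \<lambda>r. (SUP m. mix_alpha (M m) (V m) (p m) r)"
  defines "tau2sq \<equiv> \<lambda>m. G2 m - (G1 m)^2 + 2 * (\<Sum>k. gamma (Suc k))"
  defines "sig \<equiv> \<lambda>m j. sqrt (Sigma m j j)"
  defines "Delta2 \<equiv> \<lambda>m j. delta2 m j / sig m j"
  defines "powT2 \<equiv> \<lambda>m. measure (M m)
             {\<omega> \<in> space (M m). (T2 m \<omega> - real (p m) * G1 m) / (sqrt (tau2sq m) * sqrt (real (p m)))
                                  > z_quant lvl}"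
  assumes prob: "\<And>m. prob_space (M m)"
    and N_lim: "filterlim N at_top sequentially"
    and p_lim: "filterlim p at_top sequentially"
    and c: "0 < c" "c < 1"
    and n1_ratio: "(\<lambda>m. real (n1 m) / real (N m)) \<longlonglongrightarrow> c"
    and p_small: "(\<lambda>m. real (p m)) \<in> o(\<lambda>m. (real (N m))^2)"
    and Sigma_sym: "\<And>m i j. Sigma m i j = Sigma m j i"
    and Sigma_diag_pos: "\<And>m j. j \<in> {1..p m} \<Longrightarrow> Sigma m j j > 0"
    and X_gauss: "\<And>m i. i \<in> {1..n1 m} \<Longrightarrow>
                    gaussian_vec (M m) (p m) (\<lambda>\<omega>. X m \<omega> i) (mu1 m) (Sigma m)"
    and Y_gauss: "\<And>m k. k \<in> {1..n2 m} \<Longrightarrow>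
                    gaussian_vec (M m) (p m) (\<lambda>\<omega>. Y m \<omega> k) (mu2 m) (Sigma m)"
    and indep: "\<And>m. prob_space.indep_vars (M m) (\<lambda>_. PiM {1..p m} (\<lambda>_. borel))
                   (\<lambda>r \<omega>. case r of Inl i \<Rightarrow> restrict (X m \<omega> i) {1..p m}
                                  | Inr k \<Rightarrow> restrict (Y m \<omega> k) {1..p m})
                   ({1..n1 m} <+> {1..n2 m})"
    and stationary: "\<And>m. stationary_fin (M m) (V m) (p m)"
    and C1_mono: "\<And>r. 1 \<le> r \<Longrightarrow> alpha (Suc r) \<le> alpha r"
    and C1_lim: "alpha \<longlonglongrightarrow> 0"
    and C2_sum: "\<exists>\<delta>>0. summable (\<lambda>r. alpha (Suc r) powr (\<delta> / (2 + \<delta>)))"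
    and C2_gamma: "\<And>k. (\<lambda>m. (1 / (real (p m) - real k)) *
                      (\<Sum>j=1..p m - k. cov (M m) (V m j) (V m (j + k)))) \<longlonglongrightarrow> gamma k"
    and gamma_summable: "summable (\<lambda>k. gamma (Suc k))"
    and tau_pos: "\<And>m. tau2sq m > 0"
    and lvl: "0 < lvl" "lvl < 1"
    and local_alt: "\<And>m j. j \<in> {1..p m} \<Longrightarrow>
          mu1 m j - mu2 m j = sqrt (real (N m) / (real (n1 m) * real (n2 m))) * delta2 m j"
    and Delta_bdd: "\<exists>M1. \<forall>m. \<forall>j\<in>{1..p m}. (Delta2 m j)^2 \<le> M1"
  shows "(\<lambda>m. powT2 m - (1 - Phi (z_quant lvl
             - ((\<Sum>j=1..p m. (Delta2 m j)^2) / sqrt (real (p m))) / sqrt (tau2sq m))))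
           \<longlonglongrightarrow> 0
         \<and> ((\<lambda>m. sqrt (real (p m))) \<in> o(\<lambda>m. \<Sum>j=1..p m. (delta2 m j)^2 / Sigma m j j)
              \<longrightarrow> powT2 \<longlonglongrightarrow> 1)
         \<and> ((\<lambda>m. \<Sum>j=1..p m. (delta2 m j)^2 / Sigma m j j) \<in> o(\<lambda>m. sqrt (real (p m)))
              \<longrightarrow> powT2 \<longlonglongrightarrow> lvl)"
proof -
  interpret P: prob_space "M m" for m by (rule prob)
  have real_N: "filterlim (\<lambda>m. real (N m)) at_top sequentially"
    by (rule filterlim_compose[OF filterlim_real_sequentially N_lim])
  have evN: "\<forall>\<^sub>F m in sequentially. x \<le> real (N m)" for x
    using real_N by (simp add: filterlim_at_top)
  \<comment> \<open>Division by zero yields 0, so an empty sample would make the ratio n1 / N equal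
    to 0 or 1, which the limit c excludes eventually.\<close>
  have evn: "\<forall>\<^sub>F m in sequentially. 1 \<le> n1 m \<and> 1 \<le> n2 m"
  proof -
    have "\<forall>\<^sub>F m in sequentially. 0 < real (n1 m) / real (N m)" "\<forall>\<^sub>F m in sequentially. real (n1 m) / real (N m) < 1"
      using n1_ratio c by (auto dest: order_tendstoD)
    then show ?thesis using evN[of 1]
    proof eventually_elim
      case (elim m)
      have "n1 m \<noteq> 0" using elim(1) by (intro notI) simp
      moreover have "n2 m \<noteq> 0" using elim(2,3) by (intro notI) (simp add: N_def)
      ultimately show ?case by simp
    qed
  qed
  obtain M1 where M1: "\<And>m j. j \<in> {1..p m} \<Longrightarrow> (Delta2 m j)\<^sup>2 \<le> M1" using Delta_bdd by blast
  \<comment> \<open>The absolute value guards the square root in case the given \<open>M1\<close> is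
    negative, which can happen when it bounds nothing.\<close>
  define b where "b = sqrt \<bar>M1\<bar>"
  have b: "\<bar>Delta2 m j\<bar> \<le> b" if "j \<in> {1..p m}" for m j
    unfolding b_def by (rule real_le_rsqrt) (use M1[OF that] in simp)
  have ts: "two_sample (M m) (n1 m) (n2 m) (p m) (X m) (Y m) (mu1 m) (mu2 m) (Sigma m)"
    if "1 \<le> n1 m" "1 \<le> n2 m" "3 \<le> real (N m)" for m
  proof
    show "2 < n1 m + n2 m" using that(3) unfolding N_def by simp
  qed (use that Sigma_diag_pos X_gauss Y_gauss indep in auto)
  have dc: "two_sample.dc (n1 m) (n2 m) (p m) (mu1 m) (mu2 m) (Sigma m) j = Delta2 m j"
    if "1 \<le> n1 m" "1 \<le> n2 m" "3 \<le> real (N m)" "j \<in> {1..p m}" for m j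
  proof -
    interpret T: two_sample "M m" "n1 m" "n2 m" "p m" "X m" "Y m" "mu1 m" "mu2 m" "Sigma m" by (rule ts[OF that(1-3)])
    have "sqrt (real (n1 m) * real (n2 m) / real (N m)) * sqrt (real (N m) / (real (n1 m) * real (n2 m))) = 1"
      using that by (simp flip: real_sqrt_mult)
    then have "sqrt (real (n1 m) * real (n2 m) / real (N m)) * (sqrt (real (N m) / (real (n1 m) * real (n2 m))) * delta2 m j) = delta2 m j"
      by (simp only: mult.assoc[symmetric] mult_1)
    then show ?thesis
      unfolding T.dc_eq[OF that(4)] local_alt[OF that(4)] Delta2_def sig_def N_def by simp
  qed
  have Vc: "V m j = two_sample.Vc (n1 m) (n2 m) (p m) (X m) (Y m) (mu1 m) (mu2 m) (Sigma m) j"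
    if "1 \<le> n1 m" "1 \<le> n2 m" "3 \<le> real (N m)" "j \<in> {1..p m}" for m j
  proof -
    interpret T: two_sample "M m" "n1 m" "n2 m" "p m" "X m" "Y m" "mu1 m" "mu2 m" "Sigma m" by (rule ts[OF that(1-3)])
    show ?thesis
      unfolding fun_eq_iff V_def T.Vc_def tN_def s2pool_def Xbar_def Ybar_def nu2_def N_def T.t_statistic[OF that(4)] by simp
  qed
  \<comment> \<open>Derived directly from the components, because the array needs measurability in
    every row, including the early ones with too few observations for
    \<open>two_sample\<close>.\<close>
  have V_meas: "V m j \<in> borel_measurable (M m)" if j: "j \<in> {1..p m}" for m j
  proof -
    have [measurable]: "(\<lambda>\<omega>. X m \<omega> i j) \<in> borel_measurable (M m)" if "i \<in> {1..n1 m}" for i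
      using X_gauss[OF that] j by (simp add: gaussian_vec_def)
    have [measurable]: "(\<lambda>\<omega>. Y m \<omega> i j) \<in> borel_measurable (M m)" if "i \<in> {1..n2 m}" for i
      using Y_gauss[OF that] j by (simp add: gaussian_vec_def)
    show ?thesis unfolding V_def tN_def s2pool_def Xbar_def Ybar_def by measurable
  qed
  have alpha_bdd: "bdd_above (range (\<lambda>m. mix_alpha (M m) (V m) (p m) r))" for r
    using P.mix_alpha_le_1 by (intro bdd_aboveI[where M=1]) auto
  have alpha_ge: "mix_alpha (M m) (V m) (p m) r \<le> alpha r" for m r
    unfolding alpha_def by (rule cSUP_upper[OF UNIV_I alpha_bdd])
  have alpha_nonneg: "0 \<le> alpha r" for r
    using P.mix_alpha_nonneg alpha_ge by (rule order_trans)
  obtain \<delta> where \<delta>: "\<delta> > 0" "summable (\<lambda>r. alpha (Suc r) powr (\<delta> / (2 + \<delta>)))" using C2_sum by blast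
  \<comment> \<open>Here the summability condition on \<open>alpha\<close> is converted into the
    polynomial rate that the array requires.\<close>
  obtain \<beta> Ca where \<beta>: "0 < \<beta>" "\<beta> \<le> 1" "\<And>r. 1 \<le> r \<Longrightarrow> alpha r \<le> Ca * real r powr - (1 + \<beta>)"
    using polynomial_rate[of alpha, OF alpha_nonneg C1_mono \<delta>] by blast
  have ev3: "\<forall>\<^sub>F m in sequentially. 1 \<le> n1 m \<and> 1 \<le> n2 m \<and> 3 \<le> real (N m) \<and> x \<le> real (N m)" for x
    using evn evN[of 3] evN[of x] by eventually_elim blast
  have stat_cov: "cov (M m) (V m j) (V m (j + k)) = cov (M m) (V m 1) (V m (1 + k))" if "1 \<le> j" "j + k \<le> p m" for m j k
    using stationary_cov[OF stationary V_meas, where h="\<lambda>x. x" and j=j and k=k] that by simp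
  interpret A: mixing_array M V p alpha \<beta> Ca gamma
  proof
    show "\<forall>\<^sub>F m in sequentially. \<forall>j\<in>{1..p m}. \<forall>\<omega>\<in>space (M m). 0 \<le> V m j \<omega>"
      using ev3[of 0]
    proof eventually_elim
      case (elim m)
      show ?case
      proof (intro ballI)
        fix j \<omega> assume j: "j \<in> {1..p m}"
        show "0 \<le> V m j \<omega>"
          unfolding Vc[OF conjunct1[OF elim] conjunct1[OF conjunct2[OF elim]] conjunct1[OF conjunct2[OF conjunct2[OF elim]]] j]
          by (rule two_sample.Vc_facts(4)[OF ts j order_refl]) (use elim in auto)
      qed
    qed
    show "\<bar>P.prob m (A \<inter> B) - P.prob m A * P.prob m B\<bar> \<le> alpha r"
      if "1 \<le> k" "1 \<le> r" "k + r \<le> p m" "A \<in> gen_sigma (M m) (V m) 1 k" "B \<in> gen_sigma (M m) (V m) (k + r) (p m)" for m k r A B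
      by (rule order_trans[OF P.alpha_coef_bounds(1)[OF that(4,5)] order_trans[OF P.alpha_coef_le_mix_alpha[OF that(1,3)] alpha_ge]])
    show "\<exists>C. \<forall>\<^sub>F m in sequentially. \<forall>j\<in>{1..p m}. integrable (M m) (\<lambda>\<omega>. V m j \<omega> ^ q) \<and> P.expectation m (\<lambda>\<omega>. V m j \<omega> ^ q) \<le> C" for q
    proof (rule exI[of _ "4 ^ q * abs_mom b (2 * q)"])
      show "\<forall>\<^sub>F m in sequentially. \<forall>j\<in>{1..p m}. integrable (M m) (\<lambda>\<omega>. V m j \<omega> ^ q) \<and> P.expectation m (\<lambda>\<omega>. V m j \<omega> ^ q) \<le> 4 ^ q * abs_mom b (2 * q)"
        using ev3[of "4 * real q + 5"]
      proof eventually_elim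
        case (elim m)
        then have m: "1 \<le> n1 m" "1 \<le> n2 m" "3 \<le> real (N m)" by auto
        show ?case
        proof
          fix j assume j: "j \<in> {1..p m}"
          show "integrable (M m) (\<lambda>\<omega>. V m j \<omega> ^ q) \<and> P.expectation m (\<lambda>\<omega>. V m j \<omega> ^ q) \<le> 4 ^ q * abs_mom b (2 * q)"
            unfolding Vc[OF m j]
            by (rule two_sample.Vc_facts(1)[OF ts[OF m] j]) (use b[OF j] dc[OF m j] elim in \<open>auto simp: N_def\<close>)
        qed
      qed
    qed
    \<comment> \<open>By stationarity all covariances in the average at lag k agree, so the average
      is the covariance of the first pair.\<close>
    show "(\<lambda>m. cov (M m) (V m 1) (V m (1 + k))) \<longlonglongrightarrow> gamma k" for k
    proof (rule Lim_transform_eventually[OF C2_gamma])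
      have "\<forall>\<^sub>F m in sequentially. Suc k \<le> p m" using p_lim by (simp add: filterlim_at_top)
      then show "\<forall>\<^sub>F m in sequentially. 1 / (real (p m) - real k) * (\<Sum>j=1..p m - k. cov (M m) (V m j) (V m (j + k))) = cov (M m) (V m 1) (V m (1 + k))"
      proof eventually_elim
        case (elim m)
        have "(\<Sum>j=1..p m - k. cov (M m) (V m j) (V m (j + k))) = (\<Sum>j=1..p m - k. cov (M m) (V m 1) (V m (1 + k)))"
          by (intro sum.cong refl stat_cov) (use elim in auto)
        then show ?case using elim by (simp add: of_nat_diff)
      qed
    qed
  qed (use V_meas stationary alpha_nonneg \<beta> p_lim in auto)
  define K1 where "K1 = (8 * (1 + b\<^sup>2) + 8 * abs_mom b 4)"
  define K2 where "K2 = (128 * abs_mom b 8 + 65 * abs_mom b 4)"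
  have b0: "0 \<le> b" by (simp add: b_def)
  have K1: "0 \<le> K1" using b0 by (simp add: K1_def abs_mom_nonneg)
  \<comment> \<open>One rate for two biases: K1 / (N - 2), at most 2 K1 / N, for the mean of
    \<open>V\<close>, and 6 / N for \<open>G1\<close>.\<close>
  define \<eta> where "\<eta> m = (2 * K1 + 6) / real (N m)" for m
  define \<kappa> where "\<kappa> m = K2 / sqrt (real (N m) - 2)" for m
  have invN: "(\<lambda>m. x / real (N m)) \<longlonglongrightarrow> 0" for x
    by (rule tendsto_divide_0[OF tendsto_const filterlim_at_top_imp_at_infinity[OF real_N]])
  have \<eta>1: "\<eta> \<longlonglongrightarrow> 0" unfolding \<eta>_def[abs_def] by (rule invN)
  \<comment> \<open>The product equals a constant times the square root of p / N^2, which is exactly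
    what the growth condition controls.\<close>
  have \<eta>2: "(\<lambda>m. sqrt (real (p m)) * \<eta> m) \<longlonglongrightarrow> 0"
  proof -
    have "(\<lambda>m. sqrt (real (p m) / (real (N m))\<^sup>2)) \<longlonglongrightarrow> sqrt 0"
      by (intro tendsto_real_sqrt smalloD_tendsto[OF p_small])
    from tendsto_mult[OF this tendsto_const[of "2 * K1 + 6"]] show ?thesis
      by (simp add: \<eta>_def real_sqrt_divide mult.commute)
  qed
  have \<kappa>1: "\<kappa> \<longlonglongrightarrow> 0"
  proof -
    have "filterlim (\<lambda>m. - 2 + real (N m)) at_top sequentially"
      by (rule filterlim_tendsto_add_at_top[OF tendsto_const real_N])
    then have "filterlim (\<lambda>m. sqrt (real (N m) - 2)) at_top sequentially"
      by (intro filterlim_compose[OF sqrt_at_top]) simp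
    then show ?thesis unfolding \<kappa>_def[abs_def]
      by (intro tendsto_divide_0[OF tendsto_const] filterlim_at_top_imp_at_infinity)
  qed
  have mean: "\<forall>\<^sub>F m in sequentially. \<forall>j\<in>{1..p m}. \<bar>P.expectation m (V m j) - (1 + (Delta2 m j)\<^sup>2)\<bar> \<le> \<eta> m"
    using ev3[of 18]
  proof eventually_elim
    case (elim m)
    then have m: "1 \<le> n1 m" "1 \<le> n2 m" "3 \<le> real (N m)" by auto
    show ?case
    proof
      fix j assume j: "j \<in> {1..p m}"
      have "\<bar>P.expectation m (V m j) - (1 + (Delta2 m j)\<^sup>2)\<bar> \<le> K1 / (real (n1 m) + real (n2 m) - 2)"
        unfolding Vc[OF m j] K1_def dc[OF m j, symmetric]
        by (rule two_sample.Vc_facts(2)[OF ts[OF m] j]) (use b[OF j] dc[OF m j] elim in \<open>auto simp: N_def\<close>)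
      also have "\<dots> = K1 / (real (N m) - 2)" by (simp add: N_def)
      also have "\<dots> \<le> K1 / (real (N m) / 2)" using K1 elim by (intro divide_left_mono) auto
      also have "\<dots> \<le> \<eta> m" using elim by (simp add: \<eta>_def divide_right_mono)
      finally show "\<bar>P.expectation m (V m j) - (1 + (Delta2 m j)\<^sup>2)\<bar> \<le> \<eta> m" .
    qed
  qed
  have G1: "\<forall>\<^sub>F m in sequentially. \<bar>G1 m - 1\<bar> \<le> \<eta> m"
    using evN[of 6]
  proof eventually_elim
    case (elim m)
    have "\<bar>G1 m - 1\<bar> \<le> 6 / real (N m)" unfolding G1_def nu2_def by (rule N_Dfun_bound[OF elim])
    also have "\<dots> \<le> \<eta> m" unfolding \<eta>_def using K1 by (intro divide_right_mono) auto
    finally show ?case .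
  qed
  have covV: "\<forall>\<^sub>F m in sequentially. \<forall>j\<in>{1..p m}. \<forall>k\<in>{1..p m}. \<exists>r. \<bar>r\<bar> \<le> 1 \<and> (j = k \<longrightarrow> r = 1) \<and>
      \<bar>cov (M m) (V m j) (V m k) - (2 * r\<^sup>2 + 4 * r * Delta2 m j * Delta2 m k)\<bar> \<le> \<kappa> m"
    using ev3[of 19]
  proof eventually_elim
    case (elim m)
    then have m: "1 \<le> n1 m" "1 \<le> n2 m" "3 \<le> real (N m)" by auto
    have \<kappa>_eq: "\<kappa> m = K2 / sqrt (real (n1 m) + real (n2 m) - 2)" by (simp add: \<kappa>_def N_def)
    show ?case
    proof (intro ballI)
      fix j k assume j: "j \<in> {1..p m}" and k: "k \<in> {1..p m}"
      show "\<exists>r. \<bar>r\<bar> \<le> 1 \<and> (j = k \<longrightarrow> r = 1) \<and>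
        \<bar>cov (M m) (V m j) (V m k) - (2 * r\<^sup>2 + 4 * r * Delta2 m j * Delta2 m k)\<bar> \<le> \<kappa> m"
        unfolding Vc[OF m j] Vc[OF m k] \<kappa>_eq K2_def dc[OF m j, symmetric] dc[OF m k, symmetric]
        by (rule two_sample.cov_Vc[OF ts[OF m] j k])
          (use b[OF j] b[OF k] dc[OF m j] dc[OF m k] elim in \<open>auto simp: N_def\<close>)
    qed
  qed
  \<comment> \<open>The squares of \<open>Dfun\<close> cancel in \<open>G2 - G1^2\<close>, and only
    the derivative term survives.\<close>
  have tau_lim: "tau2sq \<longlonglongrightarrow> 2 + 2 * (\<Sum>k. gamma (Suc k))"
  proof -
    have "(\<lambda>m. - 2 * ((real (N m))\<^sup>2 * Dfun' (real (N m) - 2)) + 2 * (\<Sum>k. gamma (Suc k))) \<longlonglongrightarrow> - 2 * (- 1) + 2 * (\<Sum>k. gamma (Suc k))"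
      by (intro tendsto_intros Dfun'_asymp real_N)
    moreover have "\<forall>\<^sub>F m in sequentially. - 2 * ((real (N m))\<^sup>2 * Dfun' (real (N m) - 2)) + 2 * (\<Sum>k. gamma (Suc k)) = tau2sq m"
      using evN[of 3]
    proof eventually_elim
      case (elim m)
      then have "deriv Dfun (real (N m) - 2) = Dfun' (real (N m) - 2)" by (intro deriv_Dfun) simp
      then show ?case unfolding tau2sq_def G2_def G1_def nu2_def by (simp add: power_mult_distrib algebra_simps)
    qed
    ultimately show ?thesis by (simp add: Lim_transform_eventually)
  qed
  define D where "D m = (\<Sum>j=1..p m. (Delta2 m j)\<^sup>2) / sqrt (real (p m))" for m
  note PA = A.power_asymptotics[where G=G1 and z="z_quant lvl", OF tau_pos tau_lim gamma_summable \<eta>1 \<eta>2 mean G1 \<kappa>1 covV]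
  have PA1: "(\<lambda>m. powT2 m - (1 - Phi (z_quant lvl - D m / sqrt (tau2sq m)))) \<longlonglongrightarrow> 0"
    unfolding powT2_def T2_def D_def by (rule PA(1))
  have PA2: "powT2 \<longlonglongrightarrow> 1" if "filterlim D at_top sequentially"
    using that unfolding powT2_def T2_def D_def[abs_def] by (rule PA(2))
  have PA3: "powT2 \<longlonglongrightarrow> 1 - Phi (z_quant lvl)" if "D \<longlonglongrightarrow> 0"
    using that unfolding powT2_def T2_def D_def[abs_def] by (rule PA(3))
  have D_eq: "(\<Sum>j=1..p m. (delta2 m j)\<^sup>2 / Sigma m j j) = (\<Sum>j=1..p m. (Delta2 m j)\<^sup>2)" for m
    using Sigma_diag_pos by (intro sum.cong refl) (simp add: Delta2_def sig_def power_divide less_imp_le)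
  have ev_p: "\<forall>\<^sub>F m in sequentially. 1 \<le> p m" using p_lim by (simp add: filterlim_at_top)
  have part2: "powT2 \<longlonglongrightarrow> 1" if o: "(\<lambda>m. sqrt (real (p m))) \<in> o(\<lambda>m. \<Sum>j=1..p m. (delta2 m j)\<^sup>2 / Sigma m j j)"
  proof (rule PA2)
    have lim: "(\<lambda>m. sqrt (real (p m)) / (\<Sum>j=1..p m. (Delta2 m j)\<^sup>2)) \<longlonglongrightarrow> 0"
      using smalloD_tendsto[OF o] unfolding D_eq .
    \<comment> \<open>Eventually the sum dominates sqrt p and is therefore positive, so inverting
      the vanishing quotient sends \<open>D\<close> to infinity and not to the default value of a
      division by 0.\<close>
    have pos: "\<forall>\<^sub>F m in sequentially. 0 < (\<Sum>j=1..p m. (Delta2 m j)\<^sup>2)"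
      using landau_o.smallD[OF o zero_less_one, unfolded D_eq] ev_p
    proof eventually_elim
      case (elim m)
      have "0 < sqrt (real (p m))" using elim by simp
      moreover have "sqrt (real (p m)) \<le> (\<Sum>j=1..p m. (Delta2 m j)\<^sup>2)"
        using elim(1) sum_nonneg[of "{1..p m}" "\<lambda>j. (Delta2 m j)\<^sup>2"] by simp
      ultimately show ?case by (rule less_le_trans)
    qed
    have "\<forall>\<^sub>F m in sequentially. 0 < sqrt (real (p m)) / (\<Sum>j=1..p m. (Delta2 m j)\<^sup>2)"
      using pos ev_p by eventually_elim simp
    from filterlim_inverse_at_top[OF lim this] show "filterlim D at_top sequentially"
      unfolding D_def[abs_def] by simp
  qed
  have part3: "powT2 \<longlonglongrightarrow> lvl" if o: "(\<lambda>m. \<Sum>j=1..p m. (delta2 m j)\<^sup>2 / Sigma m j j) \<in> o(\<lambda>m. sqrt (real (p m)))"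
  proof -
    have "D \<longlonglongrightarrow> 0" using smalloD_tendsto[OF o] unfolding D_eq D_def[abs_def] .
    from PA3[OF this] show ?thesis by (simp add: Phi_z_quant[OF lvl])
  qed
  show ?thesis using PA1 part2 part3 unfolding D_def by blast
qed

end
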